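(* Let $F$ be a field of characteristic $0$ and let $A$ be a finite dimensional non-nilpotent associative algebra over $F$ with an action of a Lie algebra $\mathfrak g$ (over $F$) by derivations. Then there exist constants $d\in\mathbb N$, $C_1, C_2 > 0$, $r_1, r_2 \in \mathbb R$ such that $$C_1 n^{r_1} d^n \leqslant c^{U(\mathfrak g)}_n(A) \leqslant C_2 n^{r_2} d^n\quad\text{for all }n \in \mathbb N.$$
   Context: Algebras $A$ are not assumed to have a unit; $\mathfrak g$ is an arbitrary Lie algebra (not assumed finite dimensional); $\mathbb N=\{1,2,3,\ldots\}$. An action of $\mathfrak g$ on $A$ by derivations is a Lie algebra homomorphism from $\mathfrak g$ to the Lie algebra of $F$-linear derivations of $A$; it extends to a unital algebra homomorphism $H\to\mathrm{End}_F(A)$, where $H=U(\mathfrak g)$ is the universal enveloping algebra. $H$-polynomials: choose a basis $(\gamma_\beta)_{\beta \in \Lambda}$ of $H=U(\mathfrak g)$ and let $F \langle X | H \rangle$ be the free associative algebra over $F$ with free generators $x_i^{\gamma_\beta}$, $\beta \in \Lambda$, $i \in \mathbb N$. For $h= \sum_{\beta} \alpha_\beta \gamma_\beta$ (finite sum, $\alpha_\beta\in F$) put $x_i^h := \sum_{\beta} \alpha_\beta x_i^{\gamma_\beta}$, and $x_i:=x_i^1$, $X=\{x_1,x_2,\ldots\}$. Any map $\psi\colon X\to A$ extends uniquely to an algebra homomorphism $\bar\psi\colon F\langle X|H\rangle\to A$ with $\bar\psi(x_i^h)=h\psi(x_i)$. An element $f\in F\langle X|H\rangle$ is an $H$-identity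 (differential identity) of $A$ if $\bar\psi(f)=0$ for all $\psi$; $\mathrm{Id}^H(A)$ is the set of all $H$-identities of $A$. Let $P^H_n = \langle x^{h_1}_{\sigma(1)} x^{h_2}_{\sigma(2)}\ldots x^{h_n}_{\sigma(n)} \mid h_i \in H, \sigma\in S_n \rangle_F$ and $c^{U(\mathfrak g)}_n(A)=c^H_n(A):=\dim\left(P^H_n/(P^H_n \cap \mathrm{Id}^H(A))\right)$. *)

theory Defs
  imports "Jordan_Normal_Form.VS_Connect" "HOL-Library.Poly_Mapping"
begin

section \<open>Algebras, Lie algebras and actions by derivations\<close>

text \<open>The class \<^class>\<open>ring\<close> does not require a unit.\<close>

locale assoc_algebra = vector_space scale
  for scale :: "'f::field \<Rightarrow> 'a::ring \<Rightarrow> 'a" +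
  assumes scale_mult_left: "scale c (a * b) = scale c a * b"
    and scale_mult_right: "scale c (a * b) = a * scale c b"

locale lie_algebra = vector_space scale
  for scale :: "'f::field \<Rightarrow> 'g::ab_group_add \<Rightarrow> 'g" +
  fixes bracket :: "'g \<Rightarrow> 'g \<Rightarrow> 'g"
  assumes bracket_linear_left: "Vector_Spaces.linear scale scale (\<lambda>x. bracket x y)"
    and bracket_linear_right: "Vector_Spaces.linear scale scale (bracket x)"
    and bracket_self: "bracket x x = 0"
    and jacobi: "bracket x (bracket y z) + bracket y (bracket z x) + bracket z (bracket x y) = 0"

definition derivation :: "('f::field \<Rightarrow> 'a::ring \<Rightarrow> 'a) \<Rightarrow> ('a \<Rightarrow> 'a) \<Rightarrow> bool" where
  "derivation scale D \<longleftrightarrow>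
     Vector_Spaces.linear scale scale D \<and> (\<forall>a b. D (a * b) = D a * b + a * D b)"

locale derivation_action =
  A: assoc_algebra scaleA + G: lie_algebra scaleG bracket
  for scaleA :: "'f::field \<Rightarrow> 'a::ring \<Rightarrow> 'a"
    and scaleG :: "'f \<Rightarrow> 'g::ab_group_add \<Rightarrow> 'g"
    and bracket :: "'g \<Rightarrow> 'g \<Rightarrow> 'g" +
  fixes act :: "'g \<Rightarrow> 'a \<Rightarrow> 'a"
  assumes act_derivation: "derivation scaleA (act x)"
    and act_add: "act (x + y) a = act x a + act y a"
    and act_scale: "act (scaleG c x) a = scaleA c (act x a)"
    and act_bracket: "act (bracket x y) a = act x (act y a) - act y (act x a)"

text \<open>The product of a nonempty list; the value at the empty list is immaterial, as there need
  not be a unit.\<close>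

definition list_product :: "'a::ring list \<Rightarrow> 'a" where
  "list_product xs = (case xs of [] \<Rightarrow> 0 | x # ys \<Rightarrow> foldl (*) x ys)"

definition nilpotent_algebra :: "'a::ring itself \<Rightarrow> bool" where
  "nilpotent_algebra _ \<longleftrightarrow> (\<exists>m\<ge>1. \<forall>xs::'a list. length xs = m \<longrightarrow> list_product xs = 0)"


section \<open>Free algebras\<close>

text \<open>The multiplication of polynomial mappings is convolution over an additively written
  monoid of exponents. Taking the free monoid of words (under concatenation) as exponents yields
  the free unital associative algebra.\<close>

datatype 'x word = Word (letters: "'x list")

instantiation word :: (type) monoid_add
begin

definition zero_word :: "'a word" where "0 = Word []"

definition plus_word :: "'a word \<Rightarrow> 'a word \<Rightarrow> 'a word" where
  "u + v = Word (letters u @ letters v)"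

instance by standard (auto simp: zero_word_def plus_word_def)

end

type_synonym ('x, 'f) free_algebra = "'x word \<Rightarrow>\<^sub>0 'f"

definition generator :: "'x \<Rightarrow> ('x, 'f::field) free_algebra" where
  "generator x = Poly_Mapping.single (Word [x]) 1"

definition free_scale :: "'f::field \<Rightarrow> ('x, 'f) free_algebra \<Rightarrow> ('x, 'f) free_algebra" where
  "free_scale c p = Poly_Mapping.map ((*) c) p"

lemma lookup_free_scale [simp]: "Poly_Mapping.lookup (free_scale c p) w = c * Poly_Mapping.lookup p w"
  by (simp add: free_scale_def Poly_Mapping.map.rep_eq when_def)

interpretation free: vector_space free_scale
  by unfold_locales (auto intro!: poly_mapping_eqI simp: lookup_add algebra_simps)


section \<open>Quotients of vector spaces\<close>

definition coset :: "'v::ab_group_add set \<Rightarrow> 'v \<Rightarrow> 'v set" where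
  "coset W v = (\<lambda>w. v + w) ` W"

text \<open>The quotient \<open>P / W\<close> of two linear subspaces \<open>W \<subseteq> P\<close>, as a vector space in the
  sense of \<^locale>\<open>vectorspace\<close>. The ring multiplication that is part of the record type is irrelevant
  for that. Adding \<open>W\<close> in the scalar multiplication matters only for the scalar \<open>0\<close>.\<close>

definition quotient_space ::
  "('f \<Rightarrow> 'v \<Rightarrow> 'v) \<Rightarrow> 'v::ab_group_add set \<Rightarrow> 'v set \<Rightarrow> ('f, 'v set) module" where
  "quotient_space scale P W =
     \<lparr>carrier = coset W ` P, mult = undefined, one = undefined,
      zero = W, add = (\<lambda>X Y. {x + y | x y. x \<in> X \<and> y \<in> Y}),
      smult = (\<lambda>c X. {scale c x + w | x w. x \<in> X \<and> w \<in> W})\<rparr>"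

text \<open>The coefficients of \<open>v\<close> with respect to a basis \<open>B\<close>, extended by \<open>0\<close> outside of \<open>B\<close>.\<close>

definition coefficients :: "('f::field, 'v) module \<Rightarrow> 'v set \<Rightarrow> 'v \<Rightarrow> 'v \<Rightarrow> 'f" where
  "coefficients V B v =
     (THE c. finite {b. c b \<noteq> 0} \<and> {b. c b \<noteq> 0} \<subseteq> B \<and> module.lincomb V c {b. c b \<noteq> 0} = v)"


section \<open>The universal enveloping algebra\<close>

text \<open>The free algebra on the underlying set of the Lie algebra modulo the first two families of
  relations is the tensor algebra.\<close>

inductive_set enveloping_ideal ::
  "('f::field \<Rightarrow> 'g::ab_group_add \<Rightarrow> 'g) \<Rightarrow> ('g \<Rightarrow> 'g \<Rightarrow> 'g) \<Rightarrow> ('g, 'f) free_algebra set"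
  for scale bracket where
  rel_add: "generator (x + y) - generator x - generator y \<in> enveloping_ideal scale bracket"
| rel_scale: "generator (scale c x) - free_scale c (generator x) \<in> enveloping_ideal scale bracket"
| rel_bracket: "generator x * generator y - generator y * generator x - generator (bracket x y)
    \<in> enveloping_ideal scale bracket"
| zero: "0 \<in> enveloping_ideal scale bracket"
| add: "p \<in> enveloping_ideal scale bracket \<Longrightarrow> q \<in> enveloping_ideal scale bracket \<Longrightarrow>
    p + q \<in> enveloping_ideal scale bracket"
| mult_left: "p \<in> enveloping_ideal scale bracket \<Longrightarrow> q * p \<in> enveloping_ideal scale bracket"
| mult_right: "p \<in> enveloping_ideal scale bracket \<Longrightarrow> p * q \<in> enveloping_ideal scale bracket"

definition enveloping_algebra ::
  "('f::field \<Rightarrow> 'g::ab_group_add \<Rightarrow> 'g) \<Rightarrow> ('g \<Rightarrow> 'g \<Rightarrow> 'g) \<Rightarrow>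
   ('f, ('g, 'f) free_algebra set) module" where
  "enveloping_algebra scale bracket =
     (let J = enveloping_ideal scale bracket in
      (quotient_space free_scale UNIV J)
        \<lparr>mult := (\<lambda>X Y. {x * y + w | x y w. x \<in> X \<and> y \<in> Y \<and> w \<in> J}), one := coset J 1\<rparr>)"

definition enveloping_basis ::
  "('f::field \<Rightarrow> 'g::ab_group_add \<Rightarrow> 'g) \<Rightarrow> ('g \<Rightarrow> 'g \<Rightarrow> 'g) \<Rightarrow>
   'b set \<Rightarrow> ('b \<Rightarrow> ('g, 'f) free_algebra set) \<Rightarrow> bool" where
  "enveloping_basis scale bracket \<Lambda> \<gamma> \<longleftrightarrow>
     inj_on \<gamma> \<Lambda> \<and> vectorspace.basis class_ring (enveloping_algebra scale bracket) (\<gamma> ` \<Lambda>)"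

definition free_act ::
  "('f::field \<Rightarrow> 'a::ring \<Rightarrow> 'a) \<Rightarrow> ('g \<Rightarrow> 'a \<Rightarrow> 'a) \<Rightarrow> ('g, 'f) free_algebra \<Rightarrow> 'a \<Rightarrow> 'a" where
  "free_act scaleA act p a =
     (\<Sum>w\<in>Poly_Mapping.keys p. scaleA (Poly_Mapping.lookup p w) (foldr act (letters w) a))"

text \<open>An element of the enveloping algebra acts through any of its representatives in the free
  algebra; they all act in the same way, see \<open>enveloping_act_coset\<close> below.\<close>

definition enveloping_act ::
  "('f::field \<Rightarrow> 'a::ring \<Rightarrow> 'a) \<Rightarrow> ('g \<Rightarrow> 'a \<Rightarrow> 'a) \<Rightarrow> ('g, 'f) free_algebra set \<Rightarrow> 'a \<Rightarrow> 'a" where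
  "enveloping_act scaleA act h a = the_elem ((\<lambda>p. free_act scaleA act p a) ` h)"


section \<open>Differential polynomials, identities and codimensions\<close>

text \<open>The free generator \<open>x\<^sub>i\<close> with exponent \<open>\<gamma> \<beta>\<close> is \<open>generator (\<beta>, i)\<close>, where \<open>i \<ge> 1\<close>. As
  algebras need not be unital, the free algebra here has no constant term.\<close>

definition differential_polys :: "'b set \<Rightarrow> ('b \<times> nat, 'f::field) free_algebra set" where
  "differential_polys \<Lambda> =
     {f. \<forall>w\<in>Poly_Mapping.keys f. letters w \<noteq> [] \<and> set (letters w) \<subseteq> \<Lambda> \<times> {1..}}"

text \<open>The element \<open>x\<^sub>i\<close> with exponent \<open>h\<close>, where \<open>h\<close> is any element of the enveloping algebra \<open>U\<close>.\<close>

definition var_power ::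
  "('f::field, 'u) module \<Rightarrow> 'b set \<Rightarrow> ('b \<Rightarrow> 'u) \<Rightarrow> nat \<Rightarrow> 'u \<Rightarrow> ('b \<times> nat, 'f) free_algebra" where
  "var_power U \<Lambda> \<gamma> i h =
     (\<Sum>\<beta> | \<beta> \<in> \<Lambda> \<and> coefficients U (\<gamma> ` \<Lambda>) h (\<gamma> \<beta>) \<noteq> 0.
        free_scale (coefficients U (\<gamma> ` \<Lambda>) h (\<gamma> \<beta>)) (generator (\<beta>, i)))"

text \<open>The homomorphism that sends \<open>x\<^sub>i\<close> with exponent \<open>h\<close> to \<open>h\<close> applied to \<open>\<psi> i\<close>, see
  \<open>poly_eval_var_power\<close> below.\<close>

definition poly_eval ::
  "('f::field \<Rightarrow> 'a::ring \<Rightarrow> 'a) \<Rightarrow> ('g \<Rightarrow> 'a \<Rightarrow> 'a) \<Rightarrow> ('b \<Rightarrow> ('g, 'f) free_algebra set) \<Rightarrow>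
   (nat \<Rightarrow> 'a) \<Rightarrow> ('b \<times> nat, 'f) free_algebra \<Rightarrow> 'a" where
  "poly_eval scaleA act \<gamma> \<psi> f =
     (\<Sum>w\<in>Poly_Mapping.keys f. scaleA (Poly_Mapping.lookup f w)
        (list_product (map (\<lambda>(\<beta>, i). enveloping_act scaleA act (\<gamma> \<beta>) (\<psi> i)) (letters w))))"

definition differential_identities ::
  "('f::field \<Rightarrow> 'a::ring \<Rightarrow> 'a) \<Rightarrow> ('g \<Rightarrow> 'a \<Rightarrow> 'a) \<Rightarrow>
   'b set \<Rightarrow> ('b \<Rightarrow> ('g, 'f) free_algebra set) \<Rightarrow> ('b \<times> nat, 'f) free_algebra set" where
  "differential_identities scaleA act \<Lambda> \<gamma> =
     {f \<in> differential_polys \<Lambda>. \<forall>\<psi>. poly_eval scaleA act \<gamma> \<psi> f = 0}"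

definition multilinear_polys ::
  "('f::field, 'u) module \<Rightarrow> 'b set \<Rightarrow> ('b \<Rightarrow> 'u) \<Rightarrow> nat \<Rightarrow> ('b \<times> nat, 'f) free_algebra set" where
  "multilinear_polys U \<Lambda> \<gamma> n =
     free.span {prod_list (map (\<lambda>k. var_power U \<Lambda> \<gamma> (\<sigma> k) (h k)) [1..<Suc n]) | \<sigma> h.
       \<sigma> permutes {1..n} \<and> (\<forall>k\<in>{1..n}. h k \<in> carrier U)}"

definition differential_codim ::
  "('f::field \<Rightarrow> 'a::ring \<Rightarrow> 'a) \<Rightarrow> ('f \<Rightarrow> 'g::ab_group_add \<Rightarrow> 'g) \<Rightarrow> ('g \<Rightarrow> 'g \<Rightarrow> 'g) \<Rightarrow>
   ('g \<Rightarrow> 'a \<Rightarrow> 'a) \<Rightarrow> 'b set \<Rightarrow> ('b \<Rightarrow> ('g, 'f) free_algebra set) \<Rightarrow> nat \<Rightarrow> nat" where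
  "differential_codim scaleA scaleG bracket act \<Lambda> \<gamma> n =
     (let P = multilinear_polys (enveloping_algebra scaleG bracket) \<Lambda> \<gamma> n in
      vectorspace.dim class_ring
        (quotient_space free_scale P (P \<inter> differential_identities scaleA act \<Lambda> \<gamma>)))"


section \<open>Well-definedness\<close>

lemma sum_single_lookup: "(\<Sum>w\<in>Poly_Mapping.keys p. Poly_Mapping.single w (Poly_Mapping.lookup p w)) = p"
  by (rule poly_mapping_eqI)
     (auto simp: lookup_sum lookup_single when_def in_keys_iff if_distrib sum.delta cong: if_cong)

context derivation_action begin

lemma act_plus: "act x (a + b) = act x a + act x b"
  and act_scaleA: "act x (scaleA c a) = scaleA c (act x a)"
  using act_derivation[of x] by (auto simp: derivation_def Vector_Spaces.linear_iff)

lemma word_act_add: "foldr act ws (a + b) = foldr act ws a + foldr act ws b"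
  by (induction ws) (auto simp: act_plus)

lemma word_act_scale: "foldr act ws (scaleA c a) = scaleA c (foldr act ws a)"
  by (induction ws) (auto simp: act_scaleA)

lemma word_act_zero: "foldr act ws 0 = 0"
  using word_act_scale[of ws 0 0] by simp

lemma word_act_sum: "foldr act ws (sum f S) = (\<Sum>i\<in>S. foldr act ws (f i))"
  by (induction S rule: infinite_finite_induct) (auto simp: word_act_add word_act_zero)

lemma free_act_superset:
  assumes "finite S" "Poly_Mapping.keys p \<subseteq> S"
  shows "free_act scaleA act p a = (\<Sum>w\<in>S. scaleA (Poly_Mapping.lookup p w) (foldr act (letters w) a))"
  unfolding free_act_def using assms
  by (intro sum.mono_neutral_left) (auto simp: in_keys_iff)

lemma free_act_add: "free_act scaleA act (p + q) a = free_act scaleA act p a + free_act scaleA act q a"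
proof -
  let ?S = "Poly_Mapping.keys p \<union> Poly_Mapping.keys q"
  have "Poly_Mapping.keys (p + q) \<subseteq> ?S" by (rule Poly_Mapping.keys_add)
  then show ?thesis
    by (subst (1 2 3) free_act_superset[of ?S])
       (auto simp: lookup_add A.scale_left_distrib sum.distrib)
qed

lemma free_act_zero: "free_act scaleA act 0 a = 0"
  by (simp add: free_act_def)

lemma free_act_scale: "free_act scaleA act (free_scale c p) a = scaleA c (free_act scaleA act p a)"
proof -
  have "Poly_Mapping.keys (free_scale c p) \<subseteq> Poly_Mapping.keys p" by (auto simp: in_keys_iff)
  then show ?thesis
    by (subst free_act_superset[of "Poly_Mapping.keys p"]) 
       (auto simp: free_act_def A.scale_sum_right)
qed

lemma free_act_diff: "free_act scaleA act (p - q) a = free_act scaleA act p a - free_act scaleA act q a"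
  using free_act_add[of "p-q" q a] by (simp add: algebra_simps)

lemma free_act_sum: "free_act scaleA act (sum f S) a = (\<Sum>i\<in>S. free_act scaleA act (f i) a)"
  by (induction S rule: infinite_finite_induct) (auto simp: free_act_add free_act_zero)

lemma free_act_single: "free_act scaleA act (Poly_Mapping.single w c) a = scaleA c (foldr act (letters w) a)"
  by (cases "c = 0") (auto simp: free_act_def)

lemma free_act_generator: "free_act scaleA act (generator x) a = act x a"
  by (simp add: generator_def free_act_single)

lemma free_act_one: "free_act scaleA act 1 a = a"
  by (simp add: free_act_single zero_word_def flip: single_one)

lemma free_act_add_right: "free_act scaleA act p (a + b) = free_act scaleA act p a + free_act scaleA act p b"
  by (auto simp: free_act_def word_act_add A.scale_right_distrib sum.distrib)

lemma free_act_sum_right: "free_act scaleA act p (sum f S) = (\<Sum>i\<in>S. free_act scaleA act p (f i))"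
  unfolding free_act_def word_act_sum A.scale_sum_right by (rule sum.swap)

lemma free_act_mult: "free_act scaleA act (p * q) a = free_act scaleA act p (free_act scaleA act q a)"
proof -
  have *: "free_act scaleA act (Poly_Mapping.single u c * Poly_Mapping.single v d) a
      = free_act scaleA act (Poly_Mapping.single u c) (free_act scaleA act (Poly_Mapping.single v d) a)" for u v c d
    by (simp add: mult_single free_act_single plus_word_def word_act_scale)
  have "free_act scaleA act ((\<Sum>w\<in>Poly_Mapping.keys p. Poly_Mapping.single w (Poly_Mapping.lookup p w)) * 
       (\<Sum>w\<in>Poly_Mapping.keys q. Poly_Mapping.single w (Poly_Mapping.lookup q w))) a =
     free_act scaleA act (\<Sum>w\<in>Poly_Mapping.keys p. Poly_Mapping.single w (Poly_Mapping.lookup p w))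
      (free_act scaleA act (\<Sum>w\<in>Poly_Mapping.keys q. Poly_Mapping.single w (Poly_Mapping.lookup q w)) a)"
    by (simp only: sum_product free_act_sum free_act_sum_right * sum.swap[of _ "Poly_Mapping.keys q" "Poly_Mapping.keys p"])
  then show ?thesis by (simp only: sum_single_lookup)
qed

lemma free_act_ideal: "p \<in> enveloping_ideal scaleG bracket \<Longrightarrow> free_act scaleA act p a = 0"
proof (induction arbitrary: a rule: enveloping_ideal.induct)
  case (mult_left p q) then show ?case 
    using free_act_sum_right[of q "\<lambda>_. 0" "{}"] by (simp add: free_act_mult)
next
qed (auto simp: free_act_add free_act_diff free_act_zero free_act_mult free_act_scale free_act_generator act_add
  act_scale act_bracket)

lemma enveloping_act_coset:
  "enveloping_act scaleA act (coset (enveloping_ideal scaleG bracket) p) a = free_act scaleA act p a"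
proof -
  have "(\<lambda>p. free_act scaleA act p a) ` coset (enveloping_ideal scaleG bracket) p = {free_act scaleA act p a}"
    using enveloping_ideal.zero
    by (force simp: coset_def free_act_add free_act_ideal image_iff)
  then show ?thesis by (simp add: enveloping_act_def)
qed
end

locale quotient_of_subspaces = vector_space scale for scale :: "'f::field \<Rightarrow> 'v::ab_group_add \<Rightarrow> 'v" +
  fixes P W assumes P: "subspace P" and W: "subspace W" and sub: "W \<subseteq> P"
begin

abbreviation "Q \<equiv> quotient_space scale P W"

lemma add_coset: "add Q (coset W x) (coset W y) = coset W (x + y)"
proof -
  have "z \<in> coset W x \<Longrightarrow> z' \<in> coset W y \<Longrightarrow> z + z' \<in> coset W (x+y)" for z z'
    using subspace_add[OF W] by (auto simp: coset_def image_iff algebra_simps)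
  moreover have "\<exists>a b. z = a + b \<and> a \<in> coset W x \<and> b \<in> coset W y" if "z \<in> coset W (x+y)" for z
    using that subspace_0[OF W] unfolding coset_def by (metis (no_types, lifting) add.assoc add.right_neutral image_iff)
  ultimately show ?thesis unfolding quotient_space_def by auto
qed

lemma smult_coset: "smult Q c (coset W x) = coset W (scale c x)"
proof -
  have "{scale c x' + w | x' w. x' \<in> coset W x \<and> w \<in> W} = coset W (scale c x)" (is "?L = ?R")
  proof
    show "?L \<subseteq> ?R" using subspace_add[OF W] subspace_scale[OF W]
      by (auto simp: coset_def scale_right_distrib image_iff add.assoc)
    show "?R \<subseteq> ?L" using subspace_0[OF W] by (force simp: coset_def)
  qed
  then show ?thesis by (simp add: quotient_space_def)
qed

lemma zero_coset: "zero Q = coset W 0" by (simp add: quotient_space_def coset_def)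

lemma carrier_coset: "carrier Q = coset W ` P" by (simp add: quotient_space_def)

lemma vectorspace_quotient: "vectorspace class_ring Q"
proof -
  have "abelian_group Q"
  proof (rule abelian_groupI)
    fix x assume "x \<in> carrier Q"
    then obtain p where p: "p \<in> P" "x = coset W p" by (auto simp: carrier_coset)
    show "\<exists>y\<in>carrier Q. y \<oplus>\<^bsub>Q\<^esub> x = \<zero>\<^bsub>Q\<^esub>"
      using p subspace_neg[OF P, of p] by (intro bexI[of _ "coset W (-p)"]) (auto simp: carrier_coset add_coset zero_coset)
  qed (use subspace_add[OF P] subspace_0[OF P] in \<open>auto simp: carrier_coset add_coset zero_coset ac_simps\<close>)
  then have "Module.module class_ring Q"
    by (intro moduleI class_cring.cring_axioms)
     (use subspace_scale[OF P] in \<open>auto simp: carrier_coset add_coset smult_coset scale_left_distrib scale_right_distrib class_cring.is_cring\<close>)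
  then show ?thesis by (simp add: vectorspace_def class_field)
qed
end

lemma coefficients_spec:
  fixes V :: "('f::field, 'v) module"
  assumes V: "vectorspace class_ring V" and B: "vectorspace.basis class_ring V B"
    and v: "v \<in> carrier V"
  defines "c \<equiv> coefficients V B v"
  shows "finite {b. c b \<noteq> 0}" "{b. c b \<noteq> 0} \<subseteq> B" "module.lincomb V c {b. c b \<noteq> 0} = v"
proof -
  interpret V: vectorspace class_ring V by (rule V)
  have li: "V.lin_indpt B" and gen: "V.gen_set B" and BV: "B \<subseteq> carrier V"
    using B by (auto simp: V.basis_def)
  let ?P = "\<lambda>c. finite {b. c b \<noteq> 0} \<and> {b. c b \<noteq> 0} \<subseteq> B \<and> V.lincomb c {b. c b \<noteq> 0} = v"
  have clean: "V.lincomb c A = V.lincomb c {b. c b \<noteq> 0}"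
    if "finite A" "A \<subseteq> carrier V" "{b. c b \<noteq> 0} \<subseteq> A" for c :: "'v \<Rightarrow> 'f" and A
  proof -
    have "V.lincomb c ({b. c b \<noteq> 0} \<union> (A - {b. c b \<noteq> 0})) = V.lincomb c {b. c b \<noteq> 0}"
      using that by (intro V.lincomb_clean) (auto intro: finite_subset)
    moreover have "{b. c b \<noteq> 0} \<union> (A - {b. c b \<noteq> 0}) = A" using that by auto
    ultimately show ?thesis by simp
  qed
  obtain a A where A: "finite A" "A \<subseteq> B" "v = V.lincomb a A"
  proof -
    have "v \<in> V.span B" using v gen by simp
    then show ?thesis using that unfolding V.span_def by blast
  qed
  let ?c = "\<lambda>b. if b \<in> A then a b else 0"
  have "V.lincomb ?c A = V.lincomb a A"
    using A BV by (intro V.lincomb_cong) auto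
  moreover have "V.lincomb ?c A = V.lincomb ?c {b. ?c b \<noteq> 0}"
    by (rule clean) (use A BV in auto)
  ultimately have "V.lincomb ?c {b. ?c b \<noteq> 0} = v" using A(3) by (simp only:)
  then have ex: "?P ?c" using A by (auto intro: finite_subset[of _ A])
  have uniq: "c = d" if c: "?P c" and d: "?P d" for c d
  proof (rule ccontr)
    assume "c \<noteq> d"
    then obtain b where b: "c b \<noteq> d b" by auto
    let ?S = "{b. c b \<noteq> 0} \<union> {b. d b \<noteq> 0}"
    have S: "finite ?S" "?S \<subseteq> carrier V" "?S \<subseteq> B" using c d BV by auto
    have "V.lincomb (\<lambda>v. c v \<ominus>\<^bsub>class_ring\<^esub> d v) ?S = V.lincomb c ?S \<ominus>\<^bsub>V\<^esub> V.lincomb d ?S"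
      using S by (intro V.lincomb_diff) auto
    also have "\<dots> = \<zero>\<^bsub>V\<^esub>"
      using clean[of ?S c] clean[of ?S d] S c d v V.M.r_neg[of v] by (auto simp: a_minus_def)
    finally have 0: "V.lincomb (\<lambda>v. c v - d v) ?S = \<zero>\<^bsub>V\<^esub>" by (simp add: class_ring_simps)
    have "b \<in> ?S" using b by auto
    then have "V.lin_dep B" unfolding V.lin_dep_def using S 0 b
      by (intro exI[of _ ?S] exI[of _ "\<lambda>v. c v - d v"] exI[of _ b]) auto
    then show False using li by auto
  qed
  have "?P c" unfolding c_def coefficients_def by (rule theI[of ?P, OF ex]) (rule uniq[OF _ ex])
  then show "finite {b. c b \<noteq> 0}" "{b. c b \<noteq> 0} \<subseteq> B" "V.lincomb c {b. c b \<noteq> 0} = v" by auto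
qed

lemma subspace_enveloping_ideal: "free.subspace (enveloping_ideal scale br)"
proof (rule free.subspaceI)
  fix c :: 'a and p assume p: "p \<in> enveloping_ideal scale br"
  have "free_scale c p = Poly_Mapping.single 0 c * p"
  proof -
    have single: "Poly_Mapping.single 0 c * Poly_Mapping.single w d
        = free_scale c (Poly_Mapping.single w d)" for w :: "'b word" and d
      by (rule poly_mapping_eqI) (simp add: mult_single lookup_single when_def)
    have "Poly_Mapping.single 0 c * p
        = Poly_Mapping.single 0 c * (\<Sum>w\<in>Poly_Mapping.keys p. Poly_Mapping.single w (Poly_Mapping.lookup p w))"
      by (simp only: sum_single_lookup)
    also have "\<dots> = (\<Sum>w\<in>Poly_Mapping.keys p. free_scale c (Poly_Mapping.single w (Poly_Mapping.lookup p w)))"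
      by (simp only: sum_distrib_left single)
    also have "\<dots> = free_scale c p"
      by (simp only: sum_single_lookup flip: free.scale_sum_right)
    finally show ?thesis by simp
  qed
  then show "free_scale c p \<in> enveloping_ideal scale br" using p enveloping_ideal.mult_left by auto
qed (auto intro: enveloping_ideal.intros)

context derivation_action begin

abbreviation "J \<equiv> enveloping_ideal scaleG bracket"
abbreviation "U \<equiv> enveloping_algebra scaleG bracket"

interpretation q: quotient_of_subspaces free_scale UNIV J
  by unfold_locales (auto intro: subspace_enveloping_ideal free.subspace_UNIV)

lemma enveloping_algebra_simps: "carrier U = carrier q.Q" "add U = add q.Q" "zero U = zero q.Q" "smult U = smult q.Q"
  by (simp_all add: enveloping_algebra_def Let_def)

lemma vectorspace_enveloping_algebra: "vectorspace class_ring U"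
proof -
  interpret q: vectorspace class_ring q.Q by (rule q.vectorspace_quotient)
  have "abelian_group U" 
  proof (rule abelian_groupI)
    show "\<exists>y\<in>carrier U. y \<oplus>\<^bsub>U\<^esub> x = \<zero>\<^bsub>U\<^esub>" if "x \<in> carrier U" for x
      using that q.l_neg[of x] q.a_inv_closed[of x] unfolding enveloping_algebra_simps by blast
  qed (auto simp: enveloping_algebra_simps q.a_ac)
  then have "Module.module class_ring U"
    by (intro moduleI class_cring.is_cring) (auto simp: enveloping_algebra_simps q.carrier_coset q.add_coset q.smult_coset
       free.scale_left_distrib free.scale_right_distrib)
  then show ?thesis by (simp add: vectorspace_def class_field)
qed

lemma enveloping_algebra_mult: "coset J x \<otimes>\<^bsub>U\<^esub> coset J y = coset J (x * y)"
proof -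
  have "(x + j) * (y + k) + l \<in> coset J (x * y)" if "j \<in> J" "k \<in> J" "l \<in> J" for j k l
  proof -
    have "(x + j) * (y + k) + l = x * y + (x * k + j * y + j * k + l)" by (simp add: algebra_simps)
    then show ?thesis using that unfolding coset_def by (blast intro: enveloping_ideal.intros)
  qed
  moreover have "\<exists>a b w. x * y + j = a * b + w \<and> a \<in> coset J x \<and> b \<in> coset J y \<and> w \<in> J" if "j \<in> J" for j
    using that enveloping_ideal.zero[of scaleG bracket]
    by (intro exI[of _ x] exI[of _ y] exI[of _ j]) (force simp: coset_def)
  ultimately show ?thesis by (auto simp: enveloping_algebra_def Let_def) (auto simp: coset_def)
qed

interpretation U: vectorspace class_ring U by (rule vectorspace_enveloping_algebra)

lemma enveloping_act_lincomb: "finite S \<Longrightarrow> S \<subseteq> carrier U \<Longrightarrow> U.lincomb c S \<in> carrier U \<and>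
  enveloping_act scaleA act (U.lincomb c S) a = (\<Sum>h\<in>S. scaleA (c h) (enveloping_act scaleA act h a))"
proof (induction S rule: finite_induct)
  case empty
  have "enveloping_act scaleA act (coset J 0) a = 0" by (simp only: enveloping_act_coset free_act_zero)
  then show ?case by (simp add: enveloping_algebra_simps q.zero_coset) (auto simp: q.carrier_coset)
next
  case (insert h S)
  then obtain p q where p: "h = coset J p" and q: "U.lincomb c S = coset J q" by (auto simp: enveloping_algebra_simps q.carrier_coset)
  have "U.lincomb c (insert h S) = coset J (free_scale (c h) p + q)"
    using insert U.lincomb_insert2[of S c h] q
    by (simp add: enveloping_algebra_simps q.smult_coset q.add_coset p)
  then show ?case using insert q
    by (simp add: enveloping_act_coset free_act_add free_act_scale p enveloping_algebra_simps q.carrier_coset)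
qed

lemma poly_eval_superset:
  assumes "finite S" "Poly_Mapping.keys p \<subseteq> S"
  shows "poly_eval scaleA act \<gamma> \<psi> p = (\<Sum>w\<in>S. scaleA (Poly_Mapping.lookup p w)  (list_product (map (\<lambda>(\<beta>, i). enveloping_act scaleA act (\<gamma> \<beta>) (\<psi> i)) (letters w))))"
  unfolding poly_eval_def using assms
  by (intro sum.mono_neutral_left) (auto simp: in_keys_iff)

lemma poly_eval_add: "poly_eval scaleA act \<gamma> \<psi> (p + q) = poly_eval scaleA act \<gamma> \<psi> p + poly_eval scaleA act \<gamma> \<psi> q"
proof -
  let ?S = "Poly_Mapping.keys p \<union> Poly_Mapping.keys q"
  have "Poly_Mapping.keys (p + q) \<subseteq> ?S" by (rule Poly_Mapping.keys_add)
  then show ?thesis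
    by (subst (1 2 3) poly_eval_superset[of ?S])
       (auto simp: lookup_add A.scale_left_distrib sum.distrib)
qed

lemma poly_eval_sum: "poly_eval scaleA act \<gamma> \<psi> (sum f S) = (\<Sum>i\<in>S. poly_eval scaleA act \<gamma> \<psi> (f i))"
  by (induction S rule: infinite_finite_induct) (auto simp: poly_eval_add, auto simp: poly_eval_def)

lemma poly_eval_var_power:
  assumes "enveloping_basis scaleG bracket \<Lambda> \<gamma>" "h \<in> carrier U"
  shows "poly_eval scaleA act \<gamma> \<psi> (var_power U \<Lambda> \<gamma> i h) = enveloping_act scaleA act h (\<psi> i)"
proof -
  let ?c = "coefficients U (\<gamma> ` \<Lambda>) h"
  have inj: "inj_on \<gamma> \<Lambda>" and B: "U.basis (\<gamma> ` \<Lambda>)" using assms by (auto simp: enveloping_basis_def)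
  note c = coefficients_spec[OF vectorspace_enveloping_algebra B assms(2)]
  have s: "poly_eval scaleA act \<gamma> \<psi> (free_scale d (generator (\<beta>, i))) = scaleA d (enveloping_act scaleA act (\<gamma> \<beta>) (\<psi> i))" for d \<beta>
  proof -
    have "Poly_Mapping.keys (free_scale d (generator (\<beta>, i))) \<subseteq> {Word [(\<beta>, i)]}"
      by (auto simp: in_keys_iff generator_def lookup_single when_def split: if_splits)
    then show ?thesis by (subst poly_eval_superset[of "{Word [(\<beta>, i)]}"]) (auto simp: generator_def list_product_def)
  qed
  have "{b. ?c b \<noteq> 0} = \<gamma> ` {\<beta> \<in> \<Lambda>. ?c (\<gamma> \<beta>) \<noteq> 0}" using c(2) by auto
  moreover have "inj_on \<gamma> {\<beta> \<in> \<Lambda>. ?c (\<gamma> \<beta>) \<noteq> 0}" using inj by (auto intro: inj_on_subset)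
  moreover have "enveloping_act scaleA act (U.lincomb ?c {b. ?c b \<noteq> 0}) (\<psi> i) = 
     (\<Sum>b | ?c b \<noteq> 0. scaleA (?c b) (enveloping_act scaleA act b (\<psi> i)))"
    using enveloping_act_lincomb[of "{b. ?c b \<noteq> 0}" ?c "\<psi> i"] c B by (auto simp: U.basis_def)
  ultimately show ?thesis using c(3) by (simp add: var_power_def poly_eval_sum s sum.reindex)
qed
end

end

theory Submission
  imports Defs "HOL-Algebra.Algebraic_Closure_Type" "HOL-Library.Function_Algebras"
    "HOL-Computational_Algebra.Formal_Power_Series" "HOL-Combinatorics.Multiset_Permutations"
begin

text \<open>
  The codimension is the dimension of the space of multilinear functions \<open>A\<^sup>n \<rightarrow> A\<close> that is
  spanned by the products \<open>h\<^sub>1 a\<^sub>1 \<dots> h\<^sub>n a\<^sub>n\<close> in all orders, so it can be computed after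
  extending the scalars to the algebraic closure \<open>K\<close>. Let \<open>J\<close> be the radical. Modulo \<open>J\<close> the extended
  algebra is a sum of matrix blocks, one for each idempotent \<open>e\<close> of a maximal family of pairwise
  orthogonal primitive idempotents. The ideals \<open>J\<close> and \<open>I\<^sub>e = A e A\<close> are invariant under
  derivations. Call a set of blocks admissible if some product of its ideals, in some order, is nonzero,
  and let \<open>d\<close> be the maximal total dimension of an admissible set of blocks.

  Upper bound: a multilinear function of the above form vanishes on a tuple of basis elements unless
  boundedly many of them lie in \<open>J\<close> and the blocks of the others form an admissible set. There are only
  polynomially many times \<open>d\<^sup>n\<close> such tuples.

  Lower bound: fix a nonzero product through an admissible set of blocks of dimension \<open>d\<close> whose
  remaining factors lie as deep as possible in the powers of \<open>J\<close>. Inserting words in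
  \<open>x\<^sub>1, \<dots>, x\<^sub>n\<close> at the idempotents gives monomials whose values on matrix units are the \<open>0/1\<close>
  incidences between words and walks. A Gram matrix \<open>G\<close> has rank at least
  \<open>(tr G)\<^sup>2 / tr G\<^sup>2\<close>, and \<open>tr G\<^sup>2\<close> is bounded by counting pairs of a permutation and
  a colouring fixed by it, as in Burnside's lemma. Summing over the distributions of the variables to
  the blocks gives \<open>d\<^sup>n\<close> up to a polynomial factor.
\<close>

text \<open>The derivations enter only the upper bound. Since \<open>J\<close> and the ideals I_e
  are invariant, an operator h in front of a variable does not move its value out of these ideals,
  and products vanish for the same reasons as for ordinary monomials. The lower bound already comes
  from the monomials with all h = 1. This is why d depends on the algebra alone.

  The obstacle is that derivations need not respect a complement of the radical, and none is chosen.
  A block is seen only through the residue functional \<open>lam e\<close> of its idempotent, and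
  its matrix units are matrix units only modulo \<open>J\<close>. The depth condition of the lower
  bound makes up for this: an error in \<open>J\<close> pushes a product to greater depth, where it
  vanishes.

  The rank estimate has the right order because, for m variables in a block of size k, the trace of
  G is m! k^m up to a factor k, whereas tr G^2 is at most (m!)^2 times a polynomial in m: coloured
  multisets with k^2 colours are polynomially few. The factorials cancel and k^(2m) remains. The
  multinomial formula turns the sum over all distributions into the n-th power of the sum of the
  k^2, which is d^n.\<close>

hide_const (open) up_ring.coeff up_ring.monom Polynomials.degree

section \<open>Linear algebra\<close>

context vector_space begin

lemma finite_independent:
  assumes "finite B" "S \<subseteq> span B" "independent S"
  shows "finite S" "card S \<le> card B"
  using independent_span_bound[OF assms(1,3,2)] by auto

lemma subspace_eqI_dim:
  assumes "finite B" "S \<subseteq> T" "T \<subseteq> span B" "subspace S" "subspace T" "dim T \<le> dim S"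
  shows "S = T"
proof (rule ccontr)
  assume "S \<noteq> T"
  then obtain x where x: "x \<in> T" "x \<notin> S" using assms(2) by auto
  obtain BS where BS: "BS \<subseteq> S" "independent BS" "S \<subseteq> span BS" "card BS = dim S"
    by (rule basis_exists)
  obtain BT where BT: "BT \<subseteq> T" "independent BT" "T \<subseteq> span BT" "card BT = dim T"
    by (rule basis_exists)
  have "finite BT" using finite_independent[OF assms(1)] BT assms(3) by auto
  have "finite BS" using finite_independent[OF assms(1)] BS assms(2,3) by auto
  have "span BS = S" using BS assms(4) span_minimal[of BS S] by auto
  then have "independent (insert x BS)" "x \<notin> BS" using x BS span_base[of x BS]
    by (auto simp: independent_insert)
  moreover have "insert x BS \<subseteq> span BT" using BS BT x assms(2) by auto
  ultimately have "card (insert x BS) \<le> card BT" using finite_independent[OF \<open>finite BT\<close>] by auto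
  then show False using \<open>finite BS\<close> \<open>x \<notin> BS\<close> BS BT assms(6) by simp
qed

lemma descending_subspaces_stable:
  assumes "finite B" "\<And>n. subspace (S n)" "\<And>n. S (Suc n) \<subseteq> S n" "S 0 \<subseteq> span B"
  obtains n where "\<And>m. m \<ge> n \<Longrightarrow> S m = S n"
proof -
  obtain n where n: "\<And>m. dim (S n) \<le> dim (S m)"
    using ex_has_least_nat[of "\<lambda>_. True" _ "\<lambda>n. dim (S n)"] by auto
  have mono: "S m \<subseteq> S n" if "n \<le> m" for n m
    using that by (rule lift_Suc_antimono_le[of S, rotated]) (use assms(3) in auto)
  have "S m = S n" if "m \<ge> n" for m
    by (rule subspace_eqI_dim[OF assms(1)]) (use mono[OF that] mono[of 0 n] assms n in auto)
  then show ?thesis by (rule that)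
qed

lemma dependent_family:
  assumes "finite B" "finite I" "f ` I \<subseteq> span B" "card B < card I"
  obtains c i where "i \<in> I" "c i \<noteq> 0" "(\<Sum>i\<in>I. scale (c i) (f i)) = 0"
proof (cases "inj_on f I")
  case True
  have "\<not> independent (f ` I)"
    using finite_independent(2)[OF assms(1,3)] assms(4) card_image[OF True] by auto
  then obtain u v where u: "v \<in> f ` I" "u v \<noteq> 0" "(\<Sum>v\<in>f ` I. scale (u v) v) = 0"
    using dependent_finite[of "f ` I"] assms(2) by auto
  then obtain i where "i \<in> I" "v = f i" by auto
  then show ?thesis using u True by (intro that[of i "u \<circ> f"]) (auto simp: sum.reindex)
next
  case False
  then obtain i j where ij: "i \<in> I" "j \<in> I" "i \<noteq> j" "f i = f j" by (auto simp: inj_on_def)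
  let ?c = "\<lambda>l. if l = i then 1 else if l = j then -1 else 0"
  have "(\<Sum>l\<in>I. scale (?c l) (f l)) = (\<Sum>l\<in>{i, j}. scale (?c l) (f l))"
    by (rule sum.mono_neutral_right) (use assms ij in auto)
  also have "\<dots> = 0" using ij by simp
  finally show ?thesis using ij by (intro that[of i ?c]) auto
qed

end

text \<open>Bounds the dimension inside a space that may be infinite dimensional: a maximal
  independent subset with more than N elements would contain a finite independent one of size N +
  1.\<close>

lemma (in vector_space) finite_spanning_subset:
  assumes "\<And>G. finite G \<Longrightarrow> G \<subseteq> S \<Longrightarrow> N < card G \<Longrightarrow> dependent G"
  obtains B where "finite B" "B \<subseteq> S" "S \<subseteq> span B" "card B \<le> N"
proof -
  obtain B where B: "B \<subseteq> S" "independent B" "S \<subseteq> span B" by (rule maximal_independent_subset)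
  have "finite B \<and> card B \<le> N"
  proof (rule ccontr)
    assume neg: "\<not> (finite B \<and> card B \<le> N)"
    have "\<exists>G. G \<subseteq> B \<and> finite G \<and> card G = Suc N"
    proof (cases "finite B")
      case True
      then have "Suc N \<le> card B" using neg by auto
      then show ?thesis by (meson obtain_subset_with_card_n)
    next
      case False
      then show ?thesis using infinite_arbitrarily_large by blast
    qed
    then obtain G where G: "G \<subseteq> B" "finite G" "card G = Suc N" by blast
    then have "dependent G" using assms[of G] B by auto
    then show False using independent_mono[OF B(2) G(1)] by auto
  qed
  then show ?thesis using B that by blast
qed

text \<open>Transfers the record-based dimension of P / W to ordinary spans: as W is the kernel of
  \<open>E\<close> on P, generating sets of the quotient correspond to spanning sets of the image.
  For the codimensions, \<open>E\<close> evaluates polynomials as functions.\<close>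

locale quotient_image = quotient_of_subspaces scale P W + F: vector_space fs
  for scale :: "'f::field \<Rightarrow> 'v::ab_group_add \<Rightarrow> 'v" and P W and fs :: "'f \<Rightarrow> 'w::ab_group_add \<Rightarrow> 'w" +
  fixes E :: "'v \<Rightarrow> 'w"
  assumes E_add: "E (x + y) = E x + E y" and E_scale: "E (scale c x) = fs c (E x)"
    and W_eq: "W = {p \<in> P. E p = 0}"
begin

lemma E_linear: "Vector_Spaces.linear scale fs E"
  by unfold_locales (auto simp: E_add E_scale algebra_simps)

lemma E_diff: "E (x - y) = E x - E y"
  using E_add[of "x - y" y] by simp

lemma coset_eq_iff: assumes "x \<in> P" "y \<in> P" shows "coset W x = coset W y \<longleftrightarrow> E x = E y"
proof
  assume eq: "coset W x = coset W y"
  have "x \<in> coset W x" unfolding coset_def using subspace_0[OF W] by (intro image_eqI[of _ _ 0]) auto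
  then obtain w where "w \<in> W" "x = y + w" unfolding eq by (auto simp: coset_def)
  then show "E x = E y" using W_eq by (auto simp: E_add)
next
  assume eq: "E x = E y"
  then have w: "x - y \<in> W" using assms subspace_diff[OF P] by (auto simp: W_eq E_diff)
  have "coset W x' \<subseteq> coset W y'" if "x' - y' \<in> W" for x' y'
  proof
    fix z assume "z \<in> coset W x'"
    then obtain w where "w \<in> W" "z = x' + w" by (auto simp: coset_def)
    then have "z = y' + ((x' - y') + w)" "(x' - y') + w \<in> W" using subspace_add[OF W that] by auto
    then show "z \<in> coset W y'" unfolding coset_def by blast
  qed
  from this[OF w] this[of y x] show "coset W x = coset W y" using subspace_neg[OF W w] by auto
qed

sublocale V: vectorspace class_ring Q by (rule vectorspace_quotient)

lemma span_cosets: assumes A: "A \<subseteq> P" shows "V.span (coset W ` A) = coset W ` span A"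
proof
  have AP: "span A \<subseteq> P" by (rule span_minimal[OF A P])
  have AC: "coset W ` A \<subseteq> carrier Q" using A by (auto simp: carrier_coset)
  have "LinearCombinations.submodule class_ring (coset W ` span A) Q"
  proof (rule LinearCombinations.submodule.intro)
    show "Module.module class_ring Q" by (rule V.module_axioms)
    show "coset W ` span A \<subseteq> carrier Q" using AP by (auto simp: carrier_coset)
    show "\<zero>\<^bsub>Q\<^esub> \<in> coset W ` span A" unfolding zero_coset using span_zero by blast
  qed (auto simp: add_coset smult_coset intro!: imageI span_add span_scale)
  then show "V.span (coset W ` A) \<subseteq> coset W ` span A"
    by (intro V.span_is_subset) (auto intro: span_base)
  have sub: "LinearCombinations.submodule class_ring (V.span (coset W ` A)) Q" by (rule V.span_is_submodule[OF AC])
  show "coset W ` span A \<subseteq> V.span (coset W ` A)"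
  proof
    fix X' assume "X' \<in> coset W ` span A"
    then obtain x where x: "x \<in> span A" "X' = coset W x" by auto
    have "coset W x \<in> V.span (coset W ` A)" using x(1)
    proof (induction rule: span_induct_alt)
      case base
      show ?case using LinearCombinations.submodule.zero_closed[OF sub] by (simp add: zero_coset)
    next
      case (step c x y)
      have "coset W x \<in> V.span (coset W ` A)" using V.in_own_span[OF AC] step(1) by auto
      then have "c \<odot>\<^bsub>Q\<^esub> coset W x \<in> V.span (coset W ` A)"
        by (intro LinearCombinations.submodule.smult_closed[OF sub]) auto
      then have "c \<odot>\<^bsub>Q\<^esub> coset W x \<oplus>\<^bsub>Q\<^esub> coset W y \<in> V.span (coset W ` A)"
        by (rule LinearCombinations.submodule.m_closed[OF sub _ step(2)])
      then show ?case by (simp add: smult_coset add_coset)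
    qed
    then show "X' \<in> V.span (coset W ` A)" using x by simp
  qed
qed

lemma generates_iff: assumes A: "A \<subseteq> P" shows "V.gen_set (coset W ` A) \<longleftrightarrow> E ` P \<subseteq> F.span (E ` A)"
proof -
  interpret E: Vector_Spaces.linear scale fs E by (rule E_linear)
  have AP: "span A \<subseteq> P" by (rule span_minimal[OF A P])
  have "V.gen_set (coset W ` A) \<longleftrightarrow> coset W ` P \<subseteq> coset W ` span A"
    unfolding span_cosets[OF A] carrier_coset using AP by auto
  also have "\<dots> \<longleftrightarrow> (\<forall>p\<in>P. \<exists>x\<in>span A. coset W p = coset W x)" by auto
  also have "\<dots> \<longleftrightarrow> (\<forall>p\<in>P. \<exists>x\<in>span A. E p = E x)" using coset_eq_iff AP by (meson subsetD)
  also have "\<dots> \<longleftrightarrow> E ` P \<subseteq> F.span (E ` A)" unfolding E.span_image by auto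
  finally show ?thesis .
qed

lemma dim_quotient_le: assumes "finite G" "G \<subseteq> E ` P" "E ` P \<subseteq> F.span G" shows "V.dim \<le> card G"
proof -
  obtain A where A: "A \<subseteq> P" "inj_on E A" "G = E ` A" using assms(2) unfolding subset_image_inj by blast
  have fin: "finite A" using assms(1) A by (auto dest: finite_imageD)
  have "V.gen_set (coset W ` A)" using generates_iff[OF A(1)] assms(3) A(3) by simp
  then have "V.dim \<le> card (coset W ` A)" unfolding V.dim_def
    by (intro Least_le exI[of _ "coset W ` A"]) (use fin A in \<open>auto simp: carrier_coset\<close>)
  also have "\<dots> \<le> card A" using fin by (rule card_image_le)
  also have "\<dots> = card G" using A by (simp add: card_image)
  finally show ?thesis .
qed

text \<open>The record-based dimension is a \<open>LEAST\<close> over finite generating sets and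
  carries information only if one exists; \<open>G\<close> provides it.\<close>

lemma dim_quotient_attained: assumes "finite G" "G \<subseteq> E ` P" "E ` P \<subseteq> F.span G"
  obtains G' where "finite G'" "E ` P \<subseteq> F.span G'" "card G' \<le> V.dim"
proof -
  let ?R = "\<lambda>n. \<exists>A. finite A \<and> card A = n \<and> A \<subseteq> carrier Q \<and> V.gen_set A"
  obtain A where A: "A \<subseteq> P" "inj_on E A" "G = E ` A" using assms(2) unfolding subset_image_inj by blast
  have fin: "finite A" using assms(1) A by (auto dest: finite_imageD)
  have "V.gen_set (coset W ` A)" using generates_iff[OF A(1)] assms(3) A(3) by simp
  then have "?R (card (coset W ` A))" using fin A by (intro exI[of _ "coset W ` A"]) (auto simp: carrier_coset)
  then have "?R V.dim" unfolding V.dim_def by (rule LeastI)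
  then obtain A' where A': "finite A'" "card A' = V.dim" "A' \<subseteq> coset W ` P" "V.gen_set A'"
    by (auto simp: carrier_coset)
  obtain B where B: "B \<subseteq> P" "inj_on (coset W) B" "A' = coset W ` B" using A'(3) unfolding subset_image_inj by blast
  have finB: "finite B" using A'(1) B by (auto dest: finite_imageD)
  have "E ` P \<subseteq> F.span (E ` B)" using generates_iff[OF B(1)] A'(4) B(3) by simp
  moreover have "card (E ` B) \<le> V.dim" using card_image_le[OF finB, of E] A' B by (simp add: card_image)
  ultimately show ?thesis using finB by (intro that[of "E ` B"]) auto
qed

end

lemma list_product_Cons: "xs \<noteq> [] \<Longrightarrow> list_product (x # xs) = x * list_product xs"
proof (cases xs)
  case (Cons y ys)
  have "foldl (*) (x * y) ys = x * foldl (*) y ys" for x y :: 'a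
    by (induction ys arbitrary: y) (auto simp: mult.assoc)
  then show ?thesis using Cons by (simp add: list_product_def)
qed simp

lemma list_product_single: "list_product [x] = x"
  by (simp add: list_product_def)

lemma list_product_append: "xs \<noteq> [] \<Longrightarrow> ys \<noteq> [] \<Longrightarrow> list_product (xs @ ys) = list_product xs * list_product ys"
proof (induction xs)
  case (Cons x xs)
  then show ?case by (cases "xs = []") (auto simp: list_product_Cons list_product_single mult.assoc)
qed simp

section \<open>Blocks and radical of a finite dimensional algebra\<close>

text \<open>The algebra is \<open>V\<close>, but the product is total on the type and takes its values in \<open>V\<close>. The
  elements outside of \<open>V\<close> do no harm, and membership conditions are rarely needed.\<close>

locale fd_algebra = vector_space scale
  for scale :: "'k::{alg_closed_field, field_char_0} \<Rightarrow> 'v::ab_group_add \<Rightarrow> 'v" (infixr "*s" 75) +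
  fixes mul :: "'v \<Rightarrow> 'v \<Rightarrow> 'v" (infixl "\<star>" 70) and V :: "'v set"
  assumes mul_add_left: "(x + y) \<star> z = x \<star> z + y \<star> z"
    and mul_add_right: "x \<star> (y + z) = x \<star> y + x \<star> z"
    and mul_scale_left [simp]: "(c *s x) \<star> y = c *s (x \<star> y)"
    and mul_scale_right [simp]: "x \<star> (c *s y) = c *s (x \<star> y)"
    and mul_assoc [simp]: "x \<star> y \<star> z = x \<star> (y \<star> z)"
    and subspace_V: "subspace V"
    and finite_dim_V: "\<exists>B. finite B \<and> V \<subseteq> span B"
    and mul_V [simp]: "x \<star> y \<in> V"
begin

lemma mul_zero [simp]: "0 \<star> x = 0" "x \<star> 0 = 0"
  using mul_add_left[of 0 0 x] mul_add_right[of x 0 0] by auto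

lemma mul_minus [simp]: "(- x) \<star> y = - (x \<star> y)" "x \<star> (- y) = - (x \<star> y)"
  using mul_add_left[of "-x" x y] mul_add_right[of x "-y" y] by (simp_all add: eq_neg_iff_add_eq_0)

lemma mul_diff_left: "(x - y) \<star> z = x \<star> z - y \<star> z"
  and mul_diff_right: "x \<star> (y - z) = x \<star> y - x \<star> z"
  using mul_add_left[of x "-y" z] mul_add_right[of x y "-z"] by auto

lemmas mul_distribs = mul_add_left mul_add_right mul_diff_left mul_diff_right

lemma mul_sum_left: "sum f S \<star> x = (\<Sum>i\<in>S. f i \<star> x)"
  by (induction S rule: infinite_finite_induct) (auto simp: mul_distribs)

lemma mul_sum_right: "x \<star> sum f S = (\<Sum>i\<in>S. x \<star> f i)"
  by (induction S rule: infinite_finite_induct) (auto simp: mul_distribs)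

lemma span_mul_left: "y \<in> span S \<Longrightarrow> (\<And>x. x \<in> S \<Longrightarrow> a \<star> x \<in> T) \<Longrightarrow> subspace T \<Longrightarrow> a \<star> y \<in> T"
  by (induction rule: span_induct_alt) (auto simp: mul_distribs subspace_0 subspace_add subspace_scale)

lemma span_mul_right: "y \<in> span S \<Longrightarrow> (\<And>x. x \<in> S \<Longrightarrow> x \<star> a \<in> T) \<Longrightarrow> subspace T \<Longrightarrow> y \<star> a \<in> T"
  by (induction rule: span_induct_alt) (auto simp: mul_distribs subspace_0 subspace_add subspace_scale)

section \<open>Idempotents, corners and Fitting's lemma\<close>

definition idem where "idem e \<longleftrightarrow> e \<noteq> 0 \<and> e \<star> e = e"

lemma idem_simps: assumes "idem e" shows "e \<star> e = e" "e \<star> (e \<star> z) = e \<star> z" "e \<noteq> 0"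
  using assms mul_assoc[of e e z] by (auto simp: idem_def simp del: mul_assoc)

definition corner where "corner e = {z. e \<star> z = z \<and> z \<star> e = z}"

lemma corner_mult: "z \<in> corner e \<Longrightarrow> w \<in> corner e \<Longrightarrow> z \<star> w \<in> corner e"
  unfolding corner_def by (metis (mono_tags, lifting) mem_Collect_eq mul_assoc)

lemma subspace_corner: "subspace (corner e)"
  by (auto simp: subspace_def corner_def mul_distribs)

lemma corner_V: "corner e \<subseteq> V"
  unfolding corner_def using mul_V by (metis (mono_tags, lifting) mem_Collect_eq subsetI)

lemma corner_eq_mult: assumes "idem e" shows "e \<star> (z \<star> e) \<in> corner e"
  using assms by (auto simp: corner_def idem_simps)

lemma idem_in_corner: "idem e \<Longrightarrow> e \<in> corner e"
  by (auto simp: corner_def idem_def)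

lemma cornerD: assumes "z \<in> corner e" shows "e \<star> z = z" "z \<star> e = z" "e \<star> (z \<star> w) = z \<star> w" "z \<star> (e \<star> w) = z \<star> w"
  using assms mul_assoc[of e z w] mul_assoc[of z e w] by (auto simp: corner_def simp del: mul_assoc)

text \<open>There is no unit, so \<open>pw a n\<close> is the power with exponent \<open>n + 1\<close>.\<close>

primrec pw where "pw a 0 = a" | "pw a (Suc n) = a \<star> pw a n"

definition nilp where "nilp a \<longleftrightarrow> (\<exists>n. pw a n = 0)"

lemma pw_add: "pw a m \<star> pw a n = pw a (Suc (m + n))"
  by (induction m) auto

lemma pw_Suc2: "pw a (Suc n) = pw a n \<star> a"
  using pw_add[of a n 0] by simp

lemma pw_corner: "a \<in> corner e \<Longrightarrow> pw a n \<in> corner e"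
  by (induction n) (auto intro: corner_mult)

lemma pw_idem: "idem e \<Longrightarrow> pw e n = e"
  by (induction n) (auto simp: idem_def)

lemma idem_not_nilp: "idem e \<Longrightarrow> \<not> nilp e"
  by (auto simp: nilp_def pw_idem idem_def)

lemma pw_scale: "pw (c *s a) n = c ^ Suc n *s pw a n"
  by (induction n) (auto simp: ac_simps)

text \<open>Fitting's lemma without a unit. The spans of the tails of the sequence of powers
  stabilise, so some power p satisfies p = p p c with c in the span of the powers. Then f = p c
  satisfies p f = p; it is idempotent because p and c commute, and nonzero because p is.\<close>

lemma fitting:
  assumes "\<not> nilp a"
  obtains c where "c \<in> span (range (pw a))" "idem (a \<star> c)" "a \<star> c = c \<star> a"
proof -
  define R where "R n = span (pw a ` {Suc n..})" for n
  obtain B where B: "finite B" "V \<subseteq> span B" using finite_dim_V by auto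
  have "pw a ` {Suc 0..} \<subseteq> V"
  proof
    fix x assume "x \<in> pw a ` {Suc 0..}"
    then obtain n where "n \<ge> Suc 0" "x = pw a n" by auto
    then show "x \<in> V" by (cases n) auto
  qed
  then have RV: "R 0 \<subseteq> V" unfolding R_def by (rule span_minimal) (rule subspace_V)
  obtain n where n: "\<And>m. m \<ge> n \<Longrightarrow> R m = R n"
  proof (rule descending_subspaces_stable[OF B(1), of R])
    show "R (Suc n) \<subseteq> R n" for n unfolding R_def by (intro span_mono image_mono) auto
    show "R 0 \<subseteq> span B" using RV B by auto
  qed (auto simp: R_def)
  let ?P = "span (range (pw a))"
  let ?p = "pw a (Suc n)"
  have "?p \<in> R n" unfolding R_def by (intro span_base imageI) simp
  \<comment> \<open>\<open>R (2 * n + 3)\<close> is spanned by the \<open>pw a j\<close> with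
    \<open>j \<ge> 2 * n + 4\<close>, of exponent at least 2 n + 5. As \<open>?p\<close> has
    exponent n + 2, each of them splits off \<open>?p\<close> twice and leaves exponent at least
    1.\<close>
  then have "?p \<in> R (2 * n + 3)" using n[of "2*n+3"] by auto
  then have "?p \<in> span (pw a ` {2*n+4..})" by (simp add: R_def eval_nat_numeral)
  then have "\<exists>c\<in>?P. ?p = ?p \<star> (?p \<star> c)"
  proof (rule span_induct_alt[where h = "\<lambda>x. \<exists>c\<in>?P. x = ?p \<star> (?p \<star> c)"])
    show "\<exists>c\<in>?P. 0 = ?p \<star> (?p \<star> c)" by (intro bexI[of _ 0]) (auto simp: span_zero)
    fix c x y assume x: "x \<in> pw a ` {2*n+4..}" and "\<exists>c\<in>?P. y = ?p \<star> (?p \<star> c)"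
    then obtain d where d: "d \<in> ?P" "y = ?p \<star> (?p \<star> d)" by auto
    obtain j where "j \<ge> 2*n+4" "x = pw a j" using x by auto
    then obtain i where i: "x = pw a (2*n+4+i)" using le_Suc_ex by blast
    have "x = ?p \<star> (?p \<star> pw a i)" unfolding pw_add i by (rule arg_cong[of _ _ "pw a"]) simp
    then have "c *s x + y = ?p \<star> (?p \<star> (c *s pw a i + d))" using d by (simp only: mul_distribs mul_scale_right)
    moreover have "c *s pw a i + d \<in> ?P" using d(1) by (intro span_add span_scale) (auto intro: span_base)
    ultimately show "\<exists>e\<in>?P. c *s x + y = ?p \<star> (?p \<star> e)" by blast
  qed
  then obtain c where c: "c \<in> ?P" "?p = ?p \<star> (?p \<star> c)" by auto
  have comm: "a \<star> d = d \<star> a" if "d \<in> ?P" for d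
    using that by (induction rule: span_induct_alt) (auto simp: mul_distribs simp flip: pw_Suc2)
  have mul: "pw a i \<star> d \<in> ?P" if "d \<in> ?P" for d i
    by (rule span_mul_left[OF that]) (auto simp: pw_add simp del: pw.simps intro: span_base)
  have pcomm: "?p \<star> d = d \<star> ?p" if "d \<in> ?P" for d
  proof -
    have "pw a i \<star> d = d \<star> pw a i" for i
    proof (induction i)
      case (Suc i)
      then show ?case using comm[OF that] mul_assoc[of a d "pw a i"] by (simp del: mul_assoc add: mul_assoc[of d a] mul_assoc[of a "pw a i"])
    qed (auto simp: comm[OF that])
    then show ?thesis .
  qed
  define f where "f = ?p \<star> c"
  have pf: "?p \<star> f = ?p" using c(2) by (simp only: f_def)
  have "f \<star> f = (c \<star> ?p) \<star> f" using pcomm[OF c(1)] by (simp only: f_def)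
  also have "\<dots> = f" using pf pcomm[OF c(1)] by (simp only: mul_assoc) (simp only: f_def)
  finally have "f \<star> f = f" .
  moreover have "f \<noteq> 0" using pf assms by (auto simp: nilp_def simp del: pw.simps)
  ultimately have f: "idem f" by (simp add: idem_def)
  define d where "d = pw a n \<star> c"
  have "f = a \<star> d" by (simp add: f_def d_def)
  then show ?thesis using f mul[OF c(1), of n] comm[of d] by (intro that[of d]) (auto simp: d_def)
qed

lemma span_pw_corner: "a \<in> corner e \<Longrightarrow> c \<in> span (range (pw a)) \<Longrightarrow> c \<in> corner e"
  using span_minimal[of "range (pw a)" "corner e"] pw_corner subspace_corner by blast

section \<open>Primitive idempotents and their local corners\<close>

definition prim where
  "prim e \<longleftrightarrow> idem e \<and> (\<forall>f. idem f \<and> f \<in> corner e \<longrightarrow> f = e)"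

lemma primD: "prim e \<Longrightarrow> idem e" by (simp add: prim_def)

text \<open>An idempotent e whose corner has least dimension is primitive: an idempotent f of
  \<open>corner e\<close> has a corner inside that of e, equality of dimensions puts e into
  \<open>corner f\<close>, and then f = e.\<close>

lemma exists_prim:
  assumes "idem g" obtains e where "prim e" "e \<in> corner g"
proof -
  obtain B where B: "finite B" "V \<subseteq> span B" using finite_dim_V by auto
  obtain e where e: "idem e" "e \<in> corner g" and min: "\<And>f. idem f \<Longrightarrow> f \<in> corner g \<Longrightarrow> dim (corner e) \<le> dim (corner f)"
    using ex_has_least_nat[of "\<lambda>e. idem e \<and> e \<in> corner g" g "\<lambda>e. dim (corner e)"] assms idem_in_corner by auto
  have "f = e" if f: "idem f" "f \<in> corner e" for f
  proof -
    have sub: "corner f \<subseteq> corner e"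
    proof
      fix z assume z: "z \<in> corner f"
      have "e \<star> (f \<star> z) = f \<star> z" "(z \<star> f) \<star> e = z \<star> f" using cornerD[OF f(2)] by simp_all
      then show "z \<in> corner e" using cornerD[OF z] by (simp add: corner_def del: mul_assoc)
    qed
    have "e \<star> (f \<star> g) = f" "g \<star> (f \<star> e) = f"
      using cornerD[OF f(2)] cornerD[OF e(2)] mul_assoc[of f e g] mul_assoc[of g e f] by (simp_all del: mul_assoc) 
    then have "f \<in> corner g" using cornerD[OF f(2)] cornerD[OF e(2)] mul_assoc[of f e g] mul_assoc[of g e f]
      by (simp add: corner_def del: mul_assoc)
    then have "corner f = corner e"
      using subspace_eqI_dim[OF B(1) sub _ subspace_corner subspace_corner min[OF f(1)]] corner_V B by blast
    then have "e \<in> corner f" using idem_in_corner[OF e(1)] by auto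
    then show ?thesis using cornerD[OF f(2)] by (simp add: corner_def)
  qed
  then show ?thesis using e by (intro that[of e]) (auto simp: prim_def)
qed

text \<open>The idempotent that \<open>fitting\<close> finds for a lies in the corner, so it is e,
  and a is invertible there. Every element of the corner is thus nilpotent or a unit.\<close>

lemma prim_local:
  assumes e: "prim e" and a: "a \<in> corner e" "\<not> nilp a"
  obtains c where "c \<in> corner e" "a \<star> c = e" "c \<star> a = e"
proof -
  obtain c where c: "c \<in> span (range (pw a))" "idem (a \<star> c)" "a \<star> c = c \<star> a" by (rule fitting[OF a(2)])
  have "c \<in> corner e" using span_pw_corner[OF a(1) c(1)] .
  moreover from this have "a \<star> c = e" using e c(2) a(1) by (auto simp: prim_def intro: corner_mult)
  ultimately show ?thesis using c that[of c] by auto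
qed

lemma unit_not_nilp:
  assumes "idem e" "a \<in> corner e" "c \<in> corner e" "a \<star> c = e"
  shows "\<not> nilp a"
proof
  assume "nilp a"
  then obtain n where n: "pw a n = 0" by (auto simp: nilp_def)
  have "pw a n \<star> pw c n = e" for n
  proof (induction n)
    case (Suc n)
    have "pw a (Suc n) \<star> pw c (Suc n) = pw a n \<star> ((a \<star> c) \<star> pw c n)"
      by (simp only: pw_Suc2 mul_assoc pw.simps) (simp only: pw_Suc2 flip: mul_assoc pw.simps)
    also have "\<dots> = e" using Suc assms(3,4) by (simp add: cornerD[OF pw_corner] del: mul_assoc)
    finally show ?case .
  qed (use assms in auto)
  from this[of n] n assms(1) show False by (simp add: idem_def)
qed

text \<open>A right inverse of u z would yield one of u. For z u, the powers of u z appear inside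
  the powers of z u.\<close>

lemma nilp_mult:
  assumes e: "prim e" and u: "u \<in> corner e" "nilp u" and z: "z \<in> corner e"
  shows "nilp (u \<star> z)" "nilp (z \<star> u)"
proof -
  have idem: "idem e" using e by (rule primD)
  have right: "nilp (u \<star> z)" if u: "u \<in> corner e" "nilp u" and z: "z \<in> corner e" for u z
  proof (rule ccontr)
    assume "\<not> nilp (u \<star> z)"
    then obtain c where "c \<in> corner e" "u \<star> z \<star> c = e" using prim_local[OF e corner_mult[OF u(1) z]] by metis
    then show False using unit_not_nilp[OF idem u(1), of "z \<star> c"] u z by (auto intro: corner_mult)
  qed
  show "nilp (u \<star> z)" by (rule right[OF u z])
  then obtain n where n: "pw (u \<star> z) n = 0" by (auto simp: nilp_def)
  have "pw (z \<star> u) (Suc m) = z \<star> (pw (u \<star> z) m \<star> u)" for m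
    by (induction m) (auto simp: mul_assoc)
  then have "pw (z \<star> u) (Suc n) = 0" using n by simp
  then show "nilp (z \<star> u)" unfolding nilp_def by blast
qed

lemma one_minus_nilp:
  assumes "idem e" "u \<in> corner e" "nilp u"
  obtains c where "c \<in> corner e" "(e - u) \<star> c = e"
proof -
  obtain n where n: "pw u n = 0" using assms by (auto simp: nilp_def)
  define s where "s m = e + (\<Sum>i<m. pw u i)" for m
  have "(e - u) \<star> s m = e - (if m = 0 then u else pw u m)" for m
  proof (induction m)
    case 0 then show ?case using assms by (simp add: s_def mul_distribs cornerD idem_simps)
  next
    case (Suc m)
    have "s (Suc m) = s m + pw u m" by (simp add: s_def add.assoc)
    then show ?case using Suc assms by (simp add: mul_add_right mul_diff_left cornerD[OF pw_corner])
  qed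
  from this[of "Suc n"] have "(e - u) \<star> s (Suc n) = e" using n by simp
  moreover have "s m \<in> corner e" for m unfolding s_def
    by (intro subspace_add subspace_sum subspace_corner idem_in_corner assms pw_corner)
  ultimately show ?thesis by (rule that[rotated])
qed

text \<open>If g inverts u + v, then g v = e - g u is right invertible by the geometric series and
  yet nilpotent.\<close>

lemma nilp_add:
  assumes e: "prim e" and u: "u \<in> corner e" "nilp u" and v: "v \<in> corner e" "nilp v"
  shows "nilp (u + v)"
proof (rule ccontr)
  assume n: "\<not> nilp (u + v)"
  have uv: "u + v \<in> corner e" using u v subspace_add[OF subspace_corner] by blast
  obtain g where g: "g \<in> corner e" "g \<star> (u + v) = e" using prim_local[OF e uv n] by metis
  have gu: "g \<star> u \<in> corner e" "nilp (g \<star> u)" using nilp_mult(2)[OF e u g(1)] corner_mult g u by auto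
  obtain c where "c \<in> corner e" "(e - g \<star> u) \<star> c = e"
    using one_minus_nilp[OF primD[OF e] gu] by metis
  moreover have "e - g \<star> u = g \<star> v" using g by (simp add: mul_distribs algebra_simps)
  ultimately show False
    using unit_not_nilp[OF primD[OF e], of "g \<star> v" c] nilp_mult(2)[OF e v g(1)] corner_mult[OF g(1) v(1)] by auto
qed

lemma nilp_scale: "nilp u \<Longrightarrow> nilp (c *s u)"
  by (auto simp: nilp_def pw_scale)

section \<open>The residue map of a local corner\<close>

definition dim_bound :: nat where
  "dim_bound = (SOME n. \<exists>B. finite B \<and> V \<subseteq> span B \<and> card B = n)"

lemma dependent_in_V:
  assumes "finite I" "f ` I \<subseteq> V" "dim_bound < card I"
  shows "\<exists>c i. i \<in> I \<and> c i \<noteq> 0 \<and> (\<Sum>i\<in>I. c i *s f i) = 0"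
proof -
  have "\<exists>n B. finite B \<and> V \<subseteq> span B \<and> card B = n" using finite_dim_V by auto
  from someI_ex[OF this] obtain B where "finite B" "V \<subseteq> span B" "card B = dim_bound"
    by (auto simp: dim_bound_def)
  show ?thesis
    by (rule dependent_family[of B I f])
      (use assms \<open>finite B\<close> \<open>V \<subseteq> span B\<close> \<open>card B = dim_bound\<close> in auto)
qed

text \<open>The corner of a primitive idempotent \<open>e\<close> is local with residue field \<open>K\<close>. On it, \<open>lam e\<close> is the
  residue map; elsewhere it is composed with \<open>z \<mapsto> e z e\<close>.\<close>

definition lam where "lam e z = (SOME c. nilp (e \<star> (z \<star> e) - c *s e))"

text \<open>Finite dimension gives a polynomial relation p(a) = 0. A linear factor a - r e that is
  not nilpotent is a unit of the corner and can be cancelled, which lowers the degree. A nonzero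
  multiple of e is never zero, so the descent must meet a nilpotent factor.\<close>

lemma exists_eigenvalue:
  assumes e: "prim e" and a: "a \<in> corner e"
  shows "\<exists>r. nilp (a - r *s e)"
proof -
  \<comment> \<open>The i-th power of a, with e as the zeroth one; \<open>pw\<close> starts at
    exponent 1.\<close>
  define q where "q i = (case i of 0 \<Rightarrow> e | Suc j \<Rightarrow> pw a j)" for i
  have q: "q 0 = e" "a \<star> q i = q (Suc i)" "q i \<in> corner e" for i
    using a idem_in_corner[OF primD[OF e]] pw_corner[OF a] by (auto simp: q_def cornerD split: nat.split)
  define pe where "pe p = (\<Sum>i\<le>degree p. coeff p i *s q i)" for p :: "'k poly"
  have pe: "pe p = (\<Sum>i\<le>n. coeff p i *s q i)" if "degree p \<le> n" for p n
    unfolding pe_def by (rule sum.mono_neutral_left) (use that in \<open>auto simp: coeff_eq_0\<close>)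
  have pe_mult: "pe ([:-r, 1:] * p) = (a - r *s e) \<star> pe p" for r p
  proof -
    have "[:-r, 1:] * p = pCons 0 p - smult r p" by simp
    moreover have "pe (pCons 0 p - smult r p) = (\<Sum>i\<le>Suc (degree p). (coeff (pCons 0 p) i - r * coeff p i) *s q i)"
      by (subst pe[of _ "Suc (degree p)"]) (auto intro!: degree_diff_le intro: order.trans[OF degree_smult_le])
    moreover have "\<dots> = (\<Sum>i\<le>Suc (degree p). coeff (pCons 0 p) i *s q i) - (\<Sum>i\<le>Suc (degree p). (r * coeff p i) *s q i)"
      by (simp only: scale_left_diff_distrib sum_subtractf)
    moreover have "(\<Sum>i\<le>Suc (degree p). coeff (pCons 0 p) i *s q i) = a \<star> pe p"
      by (subst sum.atMost_Suc_shift) (simp add: pe_def mul_sum_right q)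
    moreover have "(\<Sum>i\<le>Suc (degree p). (r * coeff p i) *s q i) = r *s pe p"
      by (simp add: pe[of p "Suc (degree p)"] scale_sum_right scale_right_distrib)
    moreover have "e \<star> pe p = pe p" by (simp add: pe_def mul_sum_right cornerD[OF q(3)])
    ultimately show ?thesis by (simp add: mul_diff_left)
  qed
  have pe_corner: "pe p \<in> corner e" for p
    unfolding pe_def by (intro subspace_sum subspace_scale subspace_corner q)
  have root: "\<exists>r. nilp (a - r *s e)" if "p \<noteq> 0" "pe p = 0" for p
    using that
  proof (induction "degree p" arbitrary: p rule: less_induct)
    case less
    have "degree p \<noteq> 0"
    proof
      assume "degree p = 0"
      then have "coeff p 0 *s e = 0" using less(3) q(1) by (simp add: pe_def)
      moreover have "coeff p 0 \<noteq> 0" using less(2) \<open>degree p = 0\<close> by (metis leading_coeff_0_iff)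
      ultimately show False using primD[OF e] by (simp add: idem_def)
    qed
    then obtain r where "poly p r = 0" using alg_closed_imp_poly_has_root by blast
    then obtain p' where p': "p = [:-r, 1:] * p'" using poly_eq_0_iff_dvd by (auto simp: dvd_def)
    then have p'0: "p' \<noteq> 0" using less by auto
    then have deg: "degree p' < degree p" unfolding p' by (subst degree_mult_eq) auto
    have eq: "(a - r *s e) \<star> pe p' = 0" using less(3) p' pe_mult by simp
    show ?case
    proof (cases "nilp (a - r *s e)")
      case False
      have ac: "a - r *s e \<in> corner e"
        using a q(3)[of 0] q(1) by (auto intro!: subspace_diff subspace_scale subspace_corner)
      obtain c where c: "c \<in> corner e" "c \<star> (a - r *s e) = e" by (rule prim_local[OF e ac False])
      have "pe p' = (c \<star> (a - r *s e)) \<star> pe p'" using c cornerD[OF pe_corner] by simp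
      also have "\<dots> = 0" using eq by (simp only: mul_assoc mul_zero)
      finally show ?thesis using less(1)[OF deg p'0] by auto
    qed auto
  qed
  have "q ` {..dim_bound} \<subseteq> V" using q(3) corner_V by auto
  then obtain c i where c: "i \<le> dim_bound" "c i \<noteq> 0" "(\<Sum>i\<le>dim_bound. c i *s q i) = 0"
    using dependent_in_V[of "{..dim_bound}" q] by fastforce
  define p where "p = (\<Sum>i\<le>dim_bound. Polynomial.monom (c i) i)"
  have cp: "coeff p j = (if j \<le> dim_bound then c j else 0)" for j by (simp add: p_def coeff_sum)
  have "degree p \<le> dim_bound" by (rule degree_le) (auto simp: cp)
  then have "pe p = 0" using c(3) by (simp add: pe[of p dim_bound] cp)
  moreover have "p \<noteq> 0" using c cp[of i] by auto
  ultimately show ?thesis using root by auto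
qed

lemma lam_spec: assumes e: "prim e" shows "nilp (e \<star> (z \<star> e) - lam e z *s e)"
  unfolding lam_def by (rule someI_ex[OF exists_eigenvalue[OF e]]) (rule corner_eq_mult[OF primD[OF e]])

text \<open>Two different residues would make a nonzero multiple of e a sum of two nilpotent
  elements of the corner, hence e nilpotent.\<close>

lemma lam_eqI:
  assumes e: "prim e" and "nilp (e \<star> (z \<star> e) - c *s e)" shows "lam e z = c"
proof (rule ccontr)
  assume ne: "lam e z \<noteq> c"
  have cor: "e \<star> (z \<star> e) - d *s e \<in> corner e" for d
    by (intro subspace_diff subspace_scale subspace_corner corner_eq_mult idem_in_corner primD[OF e])
  have "nilp ((e \<star> (z \<star> e) - c *s e) + (-1) *s (e \<star> (z \<star> e) - lam e z *s e))"
    by (intro nilp_add[OF e] nilp_scale lam_spec[OF e] cor assms subspace_scale subspace_corner)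
  then have "nilp ((lam e z - c) *s e)" by (simp add: scale_left_diff_distrib algebra_simps)
  from nilp_scale[OF this, of "inverse (lam e z - c)"] have "nilp e" using ne by simp
  then show False using idem_not_nilp primD[OF e] by auto
qed

lemma lam_sandwich [simp]: assumes "prim e"
  shows "lam e (e \<star> z) = lam e z" "lam e (z \<star> e) = lam e z"
  using assms by (auto simp: lam_def idem_simps[OF primD])

lemma lam_add: assumes e: "prim e" shows "lam e (z + w) = lam e z + lam e w"
proof (rule lam_eqI[OF e])
  have cor: "e \<star> (z \<star> e) - d *s e \<in> corner e" for d z
    by (intro subspace_diff subspace_scale subspace_corner corner_eq_mult idem_in_corner primD[OF e])
  have "nilp ((e \<star> (z \<star> e) - lam e z *s e) + (e \<star> (w \<star> e) - lam e w *s e))"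
    by (intro nilp_add[OF e] lam_spec[OF e] cor)
  then show "nilp (e \<star> ((z + w) \<star> e) - (lam e z + lam e w) *s e)"
    by (simp add: mul_distribs scale_left_distrib algebra_simps)
qed

lemma lam_scale: assumes e: "prim e" shows "lam e (c *s z) = c * lam e z"
proof (rule lam_eqI[OF e])
  have "nilp (c *s (e \<star> (z \<star> e) - lam e z *s e))" by (intro nilp_scale lam_spec[OF e])
  then show "nilp (e \<star> ((c *s z) \<star> e) - (c * lam e z) *s e)" by (simp add: scale_right_diff_distrib)
qed

text \<open>The inner e keeps the product in the corner, where e x e and e y e are scalars plus
  nilpotent elements and the latter form an ideal. Without it \<open>lam e\<close> is not
  multiplicative in general: in a larger block it is a single diagonal entry.\<close>

lemma lam_mult: assumes e: "prim e" shows "lam e (x \<star> (e \<star> y)) = lam e x * lam e y"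
proof (rule lam_eqI[OF e])
  have cor: "e \<star> (z \<star> e) - d *s e \<in> corner e" for d z
    by (intro subspace_diff subspace_scale subspace_corner corner_eq_mult idem_in_corner primD[OF e])
  let ?u = "e \<star> (x \<star> e) - lam e x *s e" and ?v = "e \<star> (y \<star> e) - lam e y *s e"
  have "nilp (?u \<star> ?v + (lam e x *s ?v + lam e y *s ?u))"
    by (intro nilp_add[OF e] nilp_mult[OF e] nilp_scale lam_spec[OF e] cor corner_mult subspace_add subspace_scale subspace_corner)
  then show "nilp (e \<star> ((x \<star> (e \<star> y)) \<star> e) - (lam e x * lam e y) *s e)"
    by (simp add: mul_distribs idem_simps[OF primD[OF e]] scale_right_diff_distrib algebra_simps)
qed

lemma lam_self: assumes e: "prim e" shows "lam e e = 1"
  by (rule lam_eqI[OF e]) (simp add: idem_simps[OF primD[OF e]] nilp_def, metis pw.simps(1))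

lemma lam_eq_0_iff: assumes e: "prim e" and z: "z \<in> corner e" shows "lam e z = 0 \<longleftrightarrow> nilp z"
  using lam_spec[OF e, of z] lam_eqI[OF e, of z 0] z by (auto simp: cornerD)

lemma lam_zero: "prim e \<Longrightarrow> lam e 0 = 0"
  using lam_scale[of e 0 0] by simp

lemma lam_diff: "prim e \<Longrightarrow> lam e (z - w) = lam e z - lam e w"
  using lam_add[of e "z - w" w] by simp

lemma lam_sum: "prim e \<Longrightarrow> lam e (sum f S) = (\<Sum>i\<in>S. lam e (f i))"
  by (induction S rule: infinite_finite_induct) (auto simp: lam_add lam_zero)

section \<open>Matrix representations from dual systems\<close>

definition dual_system where
  "dual_system e (k::nat) xs ys \<longleftrightarrow> (\<forall>i<k. \<forall>j<k. lam e (xs i \<star> ys j) = (if i = j then 1 else 0))"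

lemma dual_system_bound:
  assumes e: "prim e" and d: "dual_system e k xs ys" shows "k \<le> dim_bound"
proof (rule ccontr)
  assume "\<not> k \<le> dim_bound"
  \<comment> \<open>\<open>ys j\<close> may lie outside \<open>V\<close>, but
    \<open>ys j \<star> e\<close> is a product and so in \<open>V\<close>, and \<open>lam e\<close>
    does not see the factor e.\<close>
  then obtain c i where c: "i < k" "c i \<noteq> 0" "(\<Sum>j<k. c j *s (ys j \<star> e)) = 0"
    using dependent_in_V[of "{..<k}" "\<lambda>j. ys j \<star> e"] by fastforce
  have "lam e (xs i \<star> (\<Sum>j<k. c j *s (ys j \<star> e))) = (\<Sum>j<k. c j * (if i = j then 1 else 0))"
    unfolding mul_sum_right lam_sum[OF e] mul_scale_right lam_scale[OF e]
  proof (intro sum.cong refl)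
    fix j assume "j \<in> {..<k}"
    then have "lam e ((xs i \<star> ys j) \<star> e) = (if i = j then 1 else 0)"
      using d c by (auto simp: lam_sandwich[OF e] dual_system_def simp del: mul_assoc)
    then show "c j * lam e (xs i \<star> (ys j \<star> e)) = c j * (if i = j then 1 else 0)" by simp
  qed
  also have "\<dots> = c i" using c(1) by (simp add: if_distrib sum.delta cong: if_cong)
  finally show False using c lam_zero[OF e] by simp
qed

text \<open>A dual system of maximal size splits the pairing, so that
  \<open>a \<mapsto> (lam e (xs p \<star> a \<star> ys q))\<^sub>p\<^sub>q\<close> is a matrix representation.\<close>

lemma exists_dual_system:
  assumes e: "prim e"
  shows "\<exists>k xs ys. k \<ge> 1 \<and> dual_system e k xs ys \<and>
    (\<forall>x y. lam e (x \<star> y) = (\<Sum>l<k. lam e (x \<star> ys l) * lam e (xs l \<star> y)))"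
proof -
  let ?S = "{k. \<exists>xs ys. dual_system e k xs ys}"
  have fin: "finite ?S" by (rule Finite_Set.finite_subset[where B = "{..dim_bound}"]) (use dual_system_bound[OF e] in auto)
  have "dual_system e 1 (\<lambda>_. e) (\<lambda>_. e)" by (simp add: dual_system_def lam_self[OF e] idem_simps[OF primD[OF e]])
  then have one: "1 \<in> ?S" by blast
  define k where "k = Max ?S"
  have "k \<in> ?S" unfolding k_def using fin one by (intro Max_in) auto
  then obtain xs ys where d: "dual_system e k xs ys" by auto
  have "k \<ge> 1" unfolding k_def using fin one by (intro Max_ge) auto
  moreover have "lam e (x \<star> y) = (\<Sum>l<k. lam e (x \<star> ys l) * lam e (xs l \<star> y))" for x y
  proof (rule ccontr)
    assume ne: "lam e (x \<star> y) \<noteq> (\<Sum>l<k. lam e (x \<star> ys l) * lam e (xs l \<star> y))"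
    \<comment> \<open>Subtracting the part that the system sees leaves x' and y' that pair to zero
      with it. Their own pairing is exactly the defect of the splitting, so a nonzero defect would
      enlarge the system.\<close>
    define x' where "x' = x - (\<Sum>l<k. lam e (x \<star> ys l) *s xs l)"
    define y' where "y' = y - (\<Sum>l<k. lam e (xs l \<star> y) *s ys l)"
    have x': "lam e (x' \<star> ys j) = 0" if "j < k" for j
    proof -
      have "(\<Sum>l<k. lam e (x \<star> ys l) * lam e (xs l \<star> ys j)) = (\<Sum>l<k. if l = j then lam e (x \<star> ys j) else 0)"
        using d that by (intro sum.cong) (auto simp: dual_system_def)
      then show ?thesis using that by (simp add: x'_def mul_diff_left mul_sum_left lam_diff[OF e] lam_sum[OF e] lam_scale[OF e])
    qed
    have y': "lam e (xs j \<star> y') = 0" if "j < k" for j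
    proof -
      have "(\<Sum>l<k. lam e (xs l \<star> y) * lam e (xs j \<star> ys l)) = (\<Sum>l<k. if l = j then lam e (xs j \<star> y) else 0)"
        using d that by (intro sum.cong) (auto simp: dual_system_def)
      then show ?thesis using that by (simp add: y'_def mul_diff_right mul_sum_right lam_diff[OF e] lam_sum[OF e] lam_scale[OF e])
    qed
    define c where "c = lam e (x' \<star> y')"
    have "c = lam e (x' \<star> y) - (\<Sum>l<k. lam e (xs l \<star> y) * lam e (x' \<star> ys l))"
      by (simp add: c_def y'_def mul_diff_right mul_sum_right lam_diff[OF e] lam_sum[OF e] lam_scale[OF e])
    also have "\<dots> = lam e (x' \<star> y)" using x' by simp
    also have "\<dots> = lam e (x \<star> y) - (\<Sum>l<k. lam e (x \<star> ys l) * lam e (xs l \<star> y))"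
      by (simp add: x'_def mul_diff_left mul_sum_left lam_diff[OF e] lam_sum[OF e] lam_scale[OF e])
    finally have "c \<noteq> 0" using ne by auto
    then have "dual_system e (Suc k) (xs(k := inverse c *s x')) (ys(k := y'))"
      using d x' y' by (auto simp: dual_system_def less_Suc_eq lam_scale[OF e] c_def)
    then have "Suc k \<in> ?S" by blast
    then have "Suc k \<le> k" unfolding k_def by (intro Max_ge fin)
    then show False by simp
  qed
  ultimately show ?thesis using d by blast
qed

text \<open>Says that f is zero in the block of e, so that the two belong to different blocks. This
  is not the condition e f = 0: two diagonal matrix units of one block have product 0 but are not
  orthogonal in this sense.\<close>

definition orthogonal where "orthogonal e f \<longleftrightarrow> (\<forall>x y. lam e (x \<star> (f \<star> y)) = 0)"

text \<open>With P = f x e and Q = e y f, orthogonality makes Q P a nilpotent element of the corner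
  of e; then P Q is nilpotent in the corner of f and has residue 0.\<close>

lemma ortho_sym:
  assumes e: "prim e" and f: "prim f" and o: "orthogonal e f" shows "orthogonal f e"
proof (rule ccontr)
  assume "\<not> orthogonal f e"
  then obtain x y where xy: "lam f (x \<star> (e \<star> y)) \<noteq> 0" by (auto simp: orthogonal_def)
  note idem = idem_simps[OF primD[OF e]] idem_simps[OF primD[OF f]]
  let ?P = "f \<star> (x \<star> e)" and ?Q = "e \<star> (y \<star> f)"
  have "lam e (y \<star> (f \<star> x)) = 0" using o by (auto simp: orthogonal_def)
  then have "lam e (?Q \<star> ?P) = 0"
    using lam_sandwich[OF e] by (simp add: idem) (simp flip: mul_assoc)
  moreover have "?Q \<star> ?P \<in> corner e" by (simp add: corner_def idem)
  ultimately obtain n where n: "pw (?Q \<star> ?P) n = 0" using lam_eq_0_iff[OF e] by (auto simp: nilp_def)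
  have "pw (?P \<star> ?Q) (Suc m) = ?P \<star> (pw (?Q \<star> ?P) m \<star> ?Q)" for m
    by (induction m) (simp_all add: mul_assoc idem)
  then have "pw (?P \<star> ?Q) (Suc n) = 0" using n by (simp only: mul_zero)
  then have "nilp (?P \<star> ?Q)" unfolding nilp_def by (rule exI)
  moreover have "?P \<star> ?Q \<in> corner f" by (simp add: corner_def idem)
  ultimately have "lam f (?P \<star> ?Q) = 0" using lam_eq_0_iff[OF f] by auto
  then show False using xy lam_sandwich[OF f] by (simp add: idem) (simp flip: mul_assoc)
qed

section \<open>Maximal families of idempotents from different blocks\<close>

definition ortho_family where
  "ortho_family E \<longleftrightarrow> finite E \<and> (\<forall>e\<in>E. prim e) \<and> (\<forall>e\<in>E. \<forall>f\<in>E. e \<noteq> f \<longrightarrow> orthogonal e f)"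

text \<open>\<open>lam f\<close> is 1 at f and 0 at the other members, so the family is linearly
  independent.\<close>

lemma ortho_family_bound:
  assumes "ortho_family E" shows "card E \<le> dim_bound"
proof (rule ccontr)
  assume "\<not> card E \<le> dim_bound"
  moreover have "E \<subseteq> V"
    using assms by (auto simp: ortho_family_def dest!: primD idem_in_corner intro: subsetD[OF corner_V])
  moreover have "finite E" using assms by (simp add: ortho_family_def)
  ultimately have "\<exists>c f. f \<in> E \<and> c f \<noteq> 0 \<and> (\<Sum>e\<in>E. c e *s e) = 0"
    using dependent_in_V[of E "\<lambda>x. x"] by simp
  then obtain c f where c: "f \<in> E" "c f \<noteq> 0" "(\<Sum>e\<in>E. c e *s e) = 0" by blast
  have f: "prim f" using c assms by (auto simp: ortho_family_def)
  have "lam f e = (if e = f then 1 else 0)" if "e \<in> E" for e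
  proof (cases "e = f")
    case False
    then have "lam f (e \<star> (e \<star> e)) = 0" using assms c that unfolding ortho_family_def orthogonal_def by metis
    then show ?thesis using False assms that by (auto simp: ortho_family_def idem_simps[OF primD])
  qed (simp add: lam_self[OF f])
  then have "lam f (\<Sum>e\<in>E. c e *s e) = (\<Sum>e\<in>E. if e = f then c f else 0)"
    unfolding lam_sum[OF f] lam_scale[OF f] by (intro sum.cong) auto
  also have "\<dots> = c f" using c assms by (simp add: ortho_family_def)
  finally show False using c lam_zero[OF f] by simp
qed

text \<open>Maximality is what \<open>J_nil\<close> needs: an idempotent inside \<open>J\<close>
  would enlarge the family.\<close>

definition Es where
  "Es = (SOME E. ortho_family E \<and> (\<forall>E'. ortho_family E' \<longrightarrow> card E' \<le> card E))"

lemma Es: "ortho_family Es" "ortho_family E' \<Longrightarrow> card E' \<le> card Es"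
proof -
  have "\<exists>E. ortho_family E \<and> (\<forall>E'. ortho_family E' \<longrightarrow> card E' \<le> card E)"
    using ex_has_greatest_nat[of ortho_family "{}" card "Suc dim_bound"] ortho_family_bound
    by (auto simp: ortho_family_def less_Suc_eq_le)
  from someI_ex[OF this] show "ortho_family Es" "ortho_family E' \<Longrightarrow> card E' \<le> card Es"
    unfolding Es_def by blast+
qed

lemma finite_Es: "finite Es" and prim_Es: "e \<in> Es \<Longrightarrow> prim e" and idem_Es: "e \<in> Es \<Longrightarrow> idem e"
  and ortho_Es: "e \<in> Es \<Longrightarrow> f \<in> Es \<Longrightarrow> e \<noteq> f \<Longrightarrow> lam e (x \<star> (f \<star> y)) = 0"
  using Es(1) primD by (auto simp: ortho_family_def orthogonal_def)

text \<open>The size, the rows and the columns are chosen as one triple, since they fit together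
  only jointly.\<close>

definition splitting where
  "splitting e T \<longleftrightarrow> (case T of (k, xs, ys) \<Rightarrow> k \<ge> 1 \<and> dual_system e k xs ys \<and>
    (\<forall>x y. lam e (x \<star> y) = (\<Sum>l<k. lam e (x \<star> ys l) * lam e (xs l \<star> y))))"

definition "block_size e = fst (SOME T. splitting e T)"
definition "row_vec e = fst (snd (SOME T. splitting e T))"
definition "col_vec e = snd (snd (SOME T. splitting e T))"

lemma dual_basis:
  assumes e: "prim e"
  shows "block_size e \<ge> 1" "i < block_size e \<Longrightarrow> j < block_size e \<Longrightarrow> lam e (row_vec e i \<star> col_vec e j) = (if i = j then 1 else 0)"
    "lam e (x \<star> y) = (\<Sum>l<block_size e. lam e (x \<star> col_vec e l) * lam e (row_vec e l \<star> y))"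
proof -
  obtain k xs ys where "splitting e (k, xs, ys)"
    using exists_dual_system[OF e] unfolding splitting_def prod.case by blast
  then have "splitting e (SOME T. splitting e T)" by (rule someI)
  then have "splitting e (block_size e, row_vec e, col_vec e)" by (simp add: block_size_def row_vec_def col_vec_def)
  then show "block_size e \<ge> 1" "i < block_size e \<Longrightarrow> j < block_size e \<Longrightarrow> lam e (row_vec e i \<star> col_vec e j) = (if i = j then 1 else 0)"
    "lam e (x \<star> y) = (\<Sum>l<block_size e. lam e (x \<star> col_vec e l) * lam e (row_vec e l \<star> y))"
    unfolding splitting_def prod.case dual_system_def by blast+
qed

text \<open>The common kernel of the matrix representations of the blocks, as
  \<open>lam e (x \<star> (a \<star> y))\<close> runs through all matrix coefficients of a. That it
  is nilpotent follows in \<open>J_nil\<close> and \<open>nilpotent_J\<close>.\<close>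

definition J where "J = {a. \<forall>e\<in>Es. \<forall>x y. lam e (x \<star> (a \<star> y)) = 0}"

lemma JD: "a \<in> J \<Longrightarrow> e \<in> Es \<Longrightarrow> lam e (x \<star> (a \<star> y)) = 0"
  by (simp add: J_def)

lemma J_ideal: "subspace J" "a \<in> J \<Longrightarrow> a \<star> z \<in> J" "a \<in> J \<Longrightarrow> z \<star> a \<in> J"
proof -
  show "subspace J" unfolding J_def
    by (auto simp: subspace_def mul_distribs lam_zero lam_add lam_scale prim_Es)
  assume a: "a \<in> J"
  show "a \<star> z \<in> J" using a by (simp add: J_def)
  have "lam e (x \<star> z \<star> (a \<star> y)) = 0" if "e \<in> Es" for e x y by (rule JD[OF a that])
  then show "z \<star> a \<in> J" by (simp add: J_def)
qed

lemma J_lam: assumes "a \<in> J" "e \<in> Es" shows "lam e a = 0"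
  using JD[OF assms, of e e] lam_sandwich[OF prim_Es[OF assms(2)]] by simp

text \<open>Otherwise \<open>fitting\<close> gives an idempotent a c, which lies in
  \<open>J\<close>, and there is a primitive g below it. Then g is zero in all blocks of
  \<open>Es\<close>, and \<open>insert g Es\<close> contradicts maximality.\<close>

lemma J_nil: assumes a: "a \<in> J" shows "nilp a"
proof (rule ccontr)
  assume "\<not> nilp a"
  then obtain c where c: "idem (a \<star> c)" by (rule fitting)
  obtain g where g: "prim g" "g \<in> corner (a \<star> c)" using exists_prim[OF c] .
  have "g = a \<star> (c \<star> g)" using cornerD(1)[OF g(2)] by simp
  then have gJ: "g \<in> J" using J_ideal(2)[OF a] by metis
  have og: "orthogonal e g" if "e \<in> Es" for e using JD[OF gJ that] by (simp add: orthogonal_def)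
  have "lam g g = 1" using g lam_self by auto
  then have "g \<notin> Es" using J_lam[OF gJ] by auto
  moreover have "ortho_family (insert g Es)"
    using Es(1) g og ortho_sym unfolding ortho_family_def by auto
  ultimately show False using Es(2)[of "insert g Es"] finite_Es by auto
qed

text \<open>Between two copies of e the residue is multiplicative, so the block of e sees u only
  through \<open>lam e u\<close>; the other blocks do not see e at all.\<close>

lemma corner_J: assumes e: "e \<in> Es" and u: "u \<in> corner e" "lam e u = 0" shows "u \<in> J"
proof -
  have "lam f (x \<star> (u \<star> y)) = 0" if f: "f \<in> Es" for f x y
  proof (cases "f = e")
    case True
    have "lam e (x \<star> (e \<star> (u \<star> (e \<star> y)))) = 0" using u lam_mult[OF prim_Es[OF e]] by simp
    then show ?thesis using True cornerD[OF u(1)] by simp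
  next
    case False
    then show ?thesis using ortho_Es[OF f e False, of x "u \<star> y"] cornerD[OF u(1)] by simp
  qed
  then show ?thesis by (simp add: J_def)
qed

section \<open>Nilpotency of the radical\<close>

lemma span_mul_span:
  assumes "x \<in> span S" "y \<in> span T" "\<And>s t. s \<in> S \<Longrightarrow> t \<in> T \<Longrightarrow> s \<star> t \<in> W" "subspace W"
  shows "x \<star> y \<in> W"
  by (rule span_mul_left[OF assms(2) _ assms(4)], rule span_mul_right[OF assms(1) _ assms(4)]) (rule assms(3))

lemma dim_mono_V: "S \<subseteq> T \<Longrightarrow> T \<subseteq> V \<Longrightarrow> subspace S \<Longrightarrow> subspace T \<Longrightarrow> dim S \<le> dim T"
proof -
  assume a: "S \<subseteq> T" "T \<subseteq> V" "subspace S" "subspace T"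
  obtain B where B: "finite B" "V \<subseteq> span B" using finite_dim_V by auto
  show "dim S \<le> dim T"
  proof (rule ccontr)
    assume "\<not> dim S \<le> dim T"
    then show False using subspace_eqI_dim[OF B(1) a(1) _ a(3,4)] a B by auto
  qed
qed

text \<open>Index 0 is \<open>UNIV\<close>: a factor without a radical part has depth 0, and depths
  add under products by \<open>J_power_mult\<close>.\<close>

fun J_power :: "nat \<Rightarrow> 'v set" where
  "J_power 0 = UNIV" | "J_power (Suc 0) = J" | "J_power (Suc (Suc m)) = span {x \<star> j | x j. x \<in> J_power (Suc m) \<and> j \<in> J}"

lemma subspace_J_power: "subspace (J_power m)"
  by (cases m rule: J_power.cases) (auto simp: J_ideal)

lemma J_power_right: "x \<in> J_power m \<Longrightarrow> x \<star> z \<in> J_power m"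
proof (cases m rule: J_power.cases)
  case (3 n)
  assume "x \<in> J_power m"
  then show ?thesis unfolding 3 J_power.simps
  proof (rule span_mul_right)
    fix x assume "x \<in> {x \<star> j | x j. x \<in> J_power (Suc n) \<and> j \<in> J}"
    then obtain y j where "x = y \<star> j" "y \<in> J_power (Suc n)" "j \<in> J" by auto
    then show "x \<star> z \<in> span {x \<star> j | x j. x \<in> J_power (Suc n) \<and> j \<in> J}"
      by (intro span_base CollectI exI[of _ y] exI[of _ "j \<star> z"]) (auto intro: J_ideal)
  qed simp
qed (auto intro: J_ideal)

lemma J_power_mult_J: assumes "x \<in> J_power m" "j \<in> J" shows "x \<star> j \<in> J_power (Suc m)"
proof (cases m)
  case 0 then show ?thesis using assms J_ideal by auto
next
  case (Suc n)
  then show ?thesis using assms unfolding Suc J_power.simps by (intro span_base) auto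
qed

lemma J_power_mult: "y \<in> J_power l \<Longrightarrow> x \<in> J_power m \<Longrightarrow> x \<star> y \<in> J_power (m + l)"
proof (induction l arbitrary: y rule: J_power.induct)
  case 1 then show ?case by (simp add: J_power_right)
next
  case 2 then show ?case by (simp add: J_power_mult_J)
next
  case (3 l)
  have "x \<star> y \<in> J_power (Suc (m + Suc l))"
  proof (rule span_mul_left[OF 3(2)[unfolded J_power.simps] _ subspace_J_power])
    fix y assume "y \<in> {x \<star> j | x j. x \<in> J_power (Suc l) \<and> j \<in> J}"
    then obtain u j where u: "y = u \<star> j" "u \<in> J_power (Suc l)" "j \<in> J" by auto
    have "(x \<star> u) \<star> j \<in> J_power (Suc (m + Suc l))" by (rule J_power_mult_J[OF 3(1)[OF u(2) 3(3)] u(3)])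
    then show "x \<star> y \<in> J_power (Suc (m + Suc l))" using u by simp
  qed
  then show ?case by simp
qed

lemma J_power_Suc_subset: "J_power (Suc m) \<subseteq> J_power m"
proof (cases m)
  case (Suc n)
  show ?thesis unfolding Suc J_power.simps
    by (rule span_minimal) (auto intro: J_power_right subspace_J_power)
qed auto

lemma J_power_antimono: "m \<le> n \<Longrightarrow> J_power n \<subseteq> J_power m"
  by (rule lift_Suc_antimono_le[of J_power, rotated]) (use J_power_Suc_subset in auto)

lemma J_power_V: "J_power (Suc (Suc m)) \<subseteq> V"
  unfolding J_power.simps by (rule span_minimal) (auto intro: subspace_V)

text \<open>Nil implies nilpotent. A stable power M satisfies M = M J. If M is nonzero, let L be a
  proper subspace of M of greatest dimension that is closed under right multiplication by
  \<open>J\<close>. For x in M, the subspace L + x J is L or M. In the second case x = l + x i with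
  i in \<open>J\<close>, and iterating puts x into L because i is nilpotent. So M J is contained in
  L, a contradiction.\<close>

lemma nilpotent_J: "\<exists>p. J_power p = {0}"
proof -
  obtain B where B: "finite B" "V \<subseteq> span B" using finite_dim_V by auto
  \<comment> \<open>Counting starts at 2, since \<open>J\<close> itself need not lie in the finite
    dimensional \<open>V\<close>, while products do.\<close>
  have "\<exists>n. \<forall>m\<ge>n. J_power (Suc (Suc m)) = J_power (Suc (Suc n))"
  proof (rule descending_subspaces_stable[OF B(1), of "\<lambda>m. J_power (Suc (Suc m))"])
    show "J_power (Suc (Suc 0)) \<subseteq> span B" using J_power_V[of 0] B(2) by blast
    show "\<exists>n. \<forall>m\<ge>n. J_power (Suc (Suc m)) = J_power (Suc (Suc n))"
      if "\<And>m. m \<ge> n \<Longrightarrow> J_power (Suc (Suc m)) = J_power (Suc (Suc n))" for n using that by blast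
  qed (rule subspace_J_power J_power_Suc_subset)+
  then obtain n where n: "\<And>m. m \<ge> n \<Longrightarrow> J_power (Suc (Suc m)) = J_power (Suc (Suc n))" by metis
  define M where "M = J_power (Suc (Suc n))"
  have M: "M = span {x \<star> j | x j. x \<in> M \<and> j \<in> J}"
    using n[of "Suc n"] unfolding M_def by (simp only: J_power.simps)
  have sM: "subspace M" and MV: "M \<subseteq> V" unfolding M_def by (rule subspace_J_power J_power_V)+
  have Mr: "x \<star> z \<in> M" if "x \<in> M" for x z using that unfolding M_def by (rule J_power_right)
  have "M = {0}"
  proof (rule ccontr)
    assume "M \<noteq> {0}"
    define Q where "Q L \<longleftrightarrow> subspace L \<and> L \<subset> M \<and> (\<forall>x\<in>L. \<forall>j\<in>J. x \<star> j \<in> L)" for L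
    have "Q {0}" using \<open>M \<noteq> {0}\<close> subspace_0[OF sM] by (auto simp: Q_def)
    then obtain L where L: "Q L" and max: "\<And>L'. Q L' \<Longrightarrow> dim V - dim L \<le> dim V - dim L'"
      using ex_has_least_nat[of Q "{0}" "\<lambda>L. dim V - dim L"] by auto
    have sL: "subspace L" and LM: "L \<subset> M" and Lr: "\<And>x j. x \<in> L \<Longrightarrow> j \<in> J \<Longrightarrow> x \<star> j \<in> L"
      using L by (auto simp: Q_def)
    have "x \<star> j \<in> L" if x: "x \<in> M" and j: "j \<in> J" for x j
    proof -
      define L' where "L' = {l + x \<star> j | l j. l \<in> L \<and> j \<in> J}"
      have "subspace L'"
      proof (rule subspaceI)
        show "0 \<in> L'" unfolding L'_def using subspace_0[OF sL] subspace_0[OF J_ideal(1)] by force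
        fix u v assume "u \<in> L'" "v \<in> L'"
        then obtain l j l' j' where "u = l + x \<star> j" "v = l' + x \<star> j'" "l \<in> L" "l' \<in> L" "j \<in> J" "j' \<in> J"
          by (auto simp: L'_def)
        then show "u + v \<in> L'" unfolding L'_def
          by (intro CollectI exI[of _ "l + l'"] exI[of _ "j + j'"])
            (auto simp: mul_distribs algebra_simps intro: subspace_add sL J_ideal)
      next
        fix c u assume "u \<in> L'"
        then obtain l j where "u = l + x \<star> j" "l \<in> L" "j \<in> J" by (auto simp: L'_def)
        then show "c *s u \<in> L'" unfolding L'_def
          by (intro CollectI exI[of _ "c *s l"] exI[of _ "c *s j"])
            (auto simp: scale_right_distrib intro: subspace_scale sL J_ideal)
      qed
      moreover have "L' \<subseteq> M" using LM x unfolding L'_def by (auto intro!: subspace_add[OF sM] Mr)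
      moreover have "u \<star> i \<in> L'" if "u \<in> L'" "i \<in> J" for u i
      proof -
        obtain l j where "u = l + x \<star> j" "l \<in> L" "j \<in> J" using \<open>u \<in> L'\<close> by (auto simp: L'_def)
        then show ?thesis unfolding L'_def using that
          by (intro CollectI exI[of _ "l \<star> i"] exI[of _ "j \<star> i"])
            (auto simp: mul_distribs intro: Lr J_ideal)
      qed
      moreover have LL': "L \<subseteq> L'"
      proof
        fix l assume "l \<in> L"
        then show "l \<in> L'" unfolding L'_def using subspace_0[OF J_ideal(1)]
          by (intro CollectI exI[of _ l] exI[of _ 0]) auto
      qed
      ultimately have Q': "L' = M \<or> Q L'" by (auto simp: Q_def)
      have xj: "x \<star> j \<in> L'" if "j \<in> J" for j using that subspace_0[OF sL]
        unfolding L'_def by (intro CollectI exI[of _ 0] exI[of _ j]) auto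
      show ?thesis
      proof (cases "L' = M")
        case False
        then have "Q L'" using Q' by auto
        then have "dim L' \<le> dim V" "dim V - dim L \<le> dim V - dim L'" "subspace L'" "L' \<subseteq> span B"
          using max MV B subspace_V by (auto simp: Q_def intro!: dim_mono_V)
        then have "dim L' \<le> dim L" using LL' LM MV sL subspace_V dim_mono_V[of L V] by auto
        then have "L = L'"
          using subspace_eqI_dim[OF B(1) LL' \<open>L' \<subseteq> span B\<close> sL \<open>subspace L'\<close>] by auto
        then show ?thesis using xj j by auto
      next
        case True
        then have "x \<in> L'" using x by simp
        then obtain l i where li: "x = l + x \<star> i" "l \<in> L" "i \<in> J" unfolding L'_def by blast
        have xi: "x - x \<star> i \<in> L" using li(1,2) by (metis add_diff_cancel_right')
        have "x - x \<star> pw i n \<in> L" for n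
        proof (induction n)
          case (Suc n)
          have "(x - x \<star> i) + (x - x \<star> pw i n) \<star> i \<in> L"
            by (rule subspace_add[OF sL xi Lr[OF Suc li(3)]])
          moreover have "(x - x \<star> i) + (x - x \<star> pw i n) \<star> i = x - x \<star> pw i (Suc n)"
            by (simp only: mul_diff_left mul_assoc pw_Suc2) simp
          ultimately show ?case by simp
        qed (use xi in simp)
        moreover obtain n where "pw i n = 0" using J_nil[OF li(3)] by (auto simp: nilp_def)
        ultimately have "x \<in> L" by (metis diff_zero mul_zero(2))
        then show ?thesis using Lr j by auto
      qed
    qed
    then have "M \<subseteq> L" by (subst M, intro span_minimal sL) auto
    then show False using LM by auto
  qed
  then show ?thesis unfolding M_def by (rule exI)
qed

text \<open>The additional \<open>Suc\<close> makes the index positive, as a product length in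
  \<open>nilpotent_algebra\<close> has to be.\<close>

definition nil_index where "nil_index = Suc (SOME p. J_power p = {0})"

lemma J_power_nil_index: assumes "m \<ge> nil_index" shows "J_power m = {0}"
proof -
  have "J_power (nil_index - 1) = {0}" unfolding nil_index_def using someI_ex[OF nilpotent_J] by simp
  then have "J_power m \<subseteq> {0}" using J_power_antimono[of "nil_index - 1" m] assms by auto
  then show ?thesis using subspace_0[OF subspace_J_power] by auto
qed

section \<open>Invariance of the radical and the block ideals under derivations\<close>

definition is_deriv where
  "is_deriv D \<longleftrightarrow> (\<forall>x y. D (x + y) = D x + D y) \<and> (\<forall>c x. D (c *s x) = c *s D x) \<and>
     (\<forall>x y. D (x \<star> y) = D x \<star> y + x \<star> D y)"

text \<open>The Taylor expansion \<open>z \<mapsto> \<Sum>\<^sub>m lam e (D\<^sup>m z) / m! X\<^sup>m\<close> is a ring homomorphism into a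
  domain, so it kills nilpotent elements.\<close>

lemma lam_deriv_nilp:
  assumes e: "prim e" and D: "is_deriv D" and z: "z \<in> corner e" "nilp z"
  shows "lam e (D z) = 0"
proof -
  \<comment> \<open>\<open>D\<close> need not preserve the corner; its compression does, and it is a
    derivation of the corner.\<close>
  define d where "d x = e \<star> (D x \<star> e)" for x
  have d_corner: "d x \<in> corner e" for x unfolding d_def by (rule corner_eq_mult[OF primD[OF e]])
  have d_add: "d (x + y) = d x + d y" for x y using D by (simp add: d_def is_deriv_def mul_distribs)
  have d_mult: "d (x \<star> y) = d x \<star> y + x \<star> d y" if "x \<in> corner e" "y \<in> corner e" for x y
    using D cornerD[OF that(1)] cornerD[OF that(2)]
    by (simp add: d_def is_deriv_def mul_distribs)
  define F where "F x = Abs_fps (\<lambda>m. lam e ((d ^^ m) x) / fact m)" for x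
  have dm_add: "(d ^^ m) (x + y) = (d ^^ m) x + (d ^^ m) y" for m x y
    by (induction m arbitrary: x y) (auto simp: d_add simp del: funpow.simps(2) simp: funpow_Suc_right)
  have F_add: "F (x + y) = F x + F y" for x y
    by (rule fps_ext) (simp add: F_def dm_add lam_add[OF e] add_divide_distrib)
  have F_deriv: "fps_deriv (F x) = F (d x)" for x
  proof (rule fps_ext)
    fix n show "fps_nth (fps_deriv (F x)) n = fps_nth (F (d x)) n"
      by (simp add: F_def funpow_swap1 fact_Suc divide_simps del: of_nat_Suc)
  qed
  \<comment> \<open>Both sides obey the same Leibniz rule under \<open>fps_deriv\<close> and have
    equal constant coefficients, so induction on the coefficient applies.\<close>
  have F_mult: "fps_nth (F (x \<star> y)) m = fps_nth (F x * F y) m" if "x \<in> corner e" "y \<in> corner e" for x y m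
    using that
  proof (induction m arbitrary: x y)
    case 0
    then show ?case using lam_mult[OF e, of x y] by (simp add: F_def cornerD)
  next
    case (Suc m)
    have "of_nat (Suc m) * fps_nth (F (x \<star> y)) (Suc m) = fps_nth (fps_deriv (F (x \<star> y))) m" by simp
    also have "\<dots> = fps_nth (F (d x \<star> y)) m + fps_nth (F (x \<star> d y)) m"
      by (simp only: F_deriv d_mult[OF Suc.prems] F_add fps_add_nth)
    also have "\<dots> = fps_nth (F (d x) * F y) m + fps_nth (F x * F (d y)) m"
      using Suc d_corner by simp
    also have "\<dots> = fps_nth (fps_deriv (F x * F y)) m"
      by (simp only: fps_deriv_mult F_deriv fps_add_nth add.commute)
    also have "\<dots> = of_nat (Suc m) * fps_nth (F x * F y) (Suc m)" by (simp del: fps_deriv_mult)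
    finally show ?case by (simp del: of_nat_Suc)
  qed
  have "F (pw z n) = F z ^ Suc n" for n
  proof (induction n)
    case (Suc n)
    have "F (z \<star> pw z n) = F z * F (pw z n)"
      by (rule fps_ext) (rule F_mult[OF z(1) pw_corner[OF z(1)]])
    then show ?case using Suc by simp
  qed simp
  moreover obtain n where "pw z n = 0" using z by (auto simp: nilp_def)
  moreover have "F 0 = 0" using F_add[of 0 0] by simp
  ultimately have "F z = 0" by (metis power_not_zero)
  then have "fps_nth (F z) 1 = 0" by simp
  then show ?thesis using lam_sandwich[OF e] by (simp add: F_def d_def)
qed

text \<open>Compressed to the corner of e, an element of \<open>J\<close> is nilpotent, so its
  derivative has residue 0 by \<open>lam_deriv_nilp\<close>. In the Leibniz expansion of a' x b' the
  two terms that do not differentiate x lie in \<open>J\<close>, so the remaining one has residue 0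
  as well.\<close>

lemma J_deriv: assumes D: "is_deriv D" and x: "x \<in> J" shows "D x \<in> J"
  unfolding J_def
proof (intro CollectI ballI allI)
  fix e a b assume e: "e \<in> Es"
  note pe = prim_Es[OF e]
  define a' b' where "a' = e \<star> a" and "b' = b \<star> e"
  let ?z = "a' \<star> (x \<star> b')"
  have z: "?z \<in> J" by (intro J_ideal x)
  have c: "?z \<in> corner e" by (simp add: corner_def a'_def b'_def idem_simps[OF idem_Es[OF e]])
  have "lam e (D ?z) = 0" using lam_deriv_nilp[OF pe D c] J_nil[OF z] by auto
  moreover have "D ?z = D a' \<star> (x \<star> b') + a' \<star> (D x \<star> b') + a' \<star> (x \<star> D b')"
    using D by (simp add: is_deriv_def mul_distribs)
  moreover have "lam e (D a' \<star> (x \<star> b')) = 0" "lam e (a' \<star> (x \<star> D b')) = 0"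
    using J_lam[OF _ e] J_ideal x by blast+
  ultimately have "lam e (a' \<star> (D x \<star> b')) = 0" by (simp add: lam_add[OF pe])
  moreover have "a' \<star> (D x \<star> b') = e \<star> ((a \<star> (D x \<star> b)) \<star> e)" by (simp add: a'_def b'_def)
  ultimately show "lam e (a \<star> (D x \<star> b)) = 0" by (simp only: lam_sandwich[OF pe])
qed

definition block_ideal where "block_ideal e = span {a \<star> (e \<star> b) | a b. True}"

lemma block_ideal_base: "a \<star> (e \<star> b) \<in> block_ideal e"
  unfolding block_ideal_def by (intro span_base) auto

lemma subspace_block_ideal: "subspace (block_ideal e)" by (simp add: block_ideal_def)

lemma block_ideal_left: "x \<in> block_ideal e \<Longrightarrow> z \<star> x \<in> block_ideal e"
  unfolding block_ideal_def by (erule span_mul_left) (use block_ideal_base[of "z \<star> _" e] in \<open>auto simp: block_ideal_def\<close>)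

text \<open>Replacing e by e e before differentiating leaves a factor e in every term of the Leibniz
  expansion.\<close>

lemma block_ideal_deriv: assumes D: "is_deriv D" and e: "idem e" and x: "x \<in> block_ideal e" shows "D x \<in> block_ideal e"
  using x unfolding block_ideal_def
proof (induction rule: span_induct_alt)
  case base
  have "D 0 = 0" using D by (metis add_cancel_right_left is_deriv_def)
  then show ?case by (simp add: span_zero)
next
  case (step c x y)
  then obtain a b where x: "x = a \<star> (e \<star> b)" by auto
  have "D x = D a \<star> (e \<star> b) + (a \<star> D (e \<star> e) \<star> b + (a \<star> e) \<star> D b)"
    using D e unfolding x is_deriv_def idem_def by (simp add: mul_distribs)
  also have "\<dots> = D a \<star> (e \<star> b) + ((a \<star> D e) \<star> (e \<star> b) + a \<star> (e \<star> (D e \<star> b)) + a \<star> (e \<star> D b))"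
    using D unfolding is_deriv_def by (simp add: mul_distribs)
  also have "\<dots> \<in> block_ideal e" by (intro subspace_add[OF subspace_block_ideal] block_ideal_base)
  finally show ?case using step D unfolding is_deriv_def block_ideal_def by (auto intro: span_add span_scale)
qed

text \<open>Acts in the block of e as the matrix unit with entry 1 at (p, q), and as zero in the
  other blocks; in the algebra itself the relations of matrix units hold only modulo
  \<open>J\<close>.\<close>

definition block_unit where "block_unit e p q = col_vec e p \<star> (e \<star> row_vec e q)"

lemma block_unit_block_ideal: "block_unit e p q \<in> block_ideal e" unfolding block_unit_def by (rule block_ideal_base)

text \<open>Applying the splitting of \<open>dual_basis\<close> on both sides of x expresses each of
  its matrix coefficients through the entries
  \<open>lam f (row_vec f p \<star> (x \<star> col_vec f q))\<close>, and the sum of matrix units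
  has the same coefficients.\<close>

lemma decomposition:
  "x - (\<Sum>e\<in>Es. \<Sum>p<block_size e. \<Sum>q<block_size e. lam e (row_vec e p \<star> (x \<star> col_vec e q)) *s block_unit e p q) \<in> J"
  unfolding J_def
proof (intro CollectI ballI allI)
  fix f a b assume f: "f \<in> Es"
  note pf = prim_Es[OF f]
  have block_unit: "lam f (a \<star> (block_unit e p q \<star> b)) = (if e = f then lam f (a \<star> col_vec f p) * lam f (row_vec f q \<star> b) else 0)" if "e \<in> Es" for e p q
    using lam_mult[OF pf, of "a \<star> col_vec f p" "row_vec f q \<star> b"] ortho_Es[OF f that, of "a \<star> col_vec e p" "row_vec e q \<star> b"]
    by (auto simp: block_unit_def)
  have "lam f (a \<star> (x \<star> b)) = (\<Sum>p<block_size f. lam f (a \<star> col_vec f p) * lam f ((row_vec f p \<star> x) \<star> b))"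
    by (subst dual_basis(3)[OF pf]) simp
  also have "\<dots> = (\<Sum>p<block_size f. \<Sum>q<block_size f. lam f (row_vec f p \<star> (x \<star> col_vec f q)) * (lam f (a \<star> col_vec f p) * lam f (row_vec f q \<star> b)))"
    by (subst dual_basis(3)[OF pf, of "row_vec f _ \<star> x"]) (simp add: sum_distrib_left ac_simps)
  also have "\<dots> = (\<Sum>e\<in>Es. if e = f then (\<Sum>p<block_size f. \<Sum>q<block_size f. lam f (row_vec f p \<star> (x \<star> col_vec f q)) * (lam f (a \<star> col_vec f p) * lam f (row_vec f q \<star> b))) else 0)"
    using f finite_Es by simp
  also have "\<dots> = (\<Sum>e\<in>Es. \<Sum>p<block_size e. \<Sum>q<block_size e. lam e (row_vec e p \<star> (x \<star> col_vec e q)) * lam f (a \<star> (block_unit e p q \<star> b)))"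
    by (intro sum.cong refl) (simp add: block_unit)
  finally show "lam f (a \<star> ((x - (\<Sum>e\<in>Es. \<Sum>p<block_size e. \<Sum>q<block_size e. lam e (row_vec e p \<star> (x \<star> col_vec e q)) *s block_unit e p q)) \<star> b)) = 0"
    by (simp add: mul_distribs mul_sum_left mul_sum_right lam_diff[OF pf] lam_sum[OF pf] lam_scale[OF pf])
qed

section \<open>Products of block ideals\<close>

primrec ideal_chain where "ideal_chain [] = UNIV" | "ideal_chain (e # es) = span {x \<star> y | x y. x \<in> block_ideal e \<and> y \<in> ideal_chain es}"

lemma subspace_ideal_chain: "subspace (ideal_chain es)" by (cases es) auto

lemma ideal_chain_left: "x \<in> ideal_chain es \<Longrightarrow> z \<star> x \<in> ideal_chain es"
proof (cases es)
  case (Cons e es')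
  assume "x \<in> ideal_chain es"
  then show ?thesis unfolding Cons ideal_chain.simps
  proof (rule span_mul_left)
    fix x assume "x \<in> {x \<star> y | x y. x \<in> block_ideal e \<and> y \<in> ideal_chain es'}"
    then obtain u y where "x = u \<star> y" "u \<in> block_ideal e" "y \<in> ideal_chain es'" by auto
    then show "z \<star> x \<in> span {x \<star> y | x y. x \<in> block_ideal e \<and> y \<in> ideal_chain es'}"
      by (intro span_base CollectI exI[of _ "z \<star> u"] exI[of _ y]) (auto intro: block_ideal_left)
  qed simp
qed simp

text \<open>In Z(e1) v(e1) Z(e2) v(e2) ... z the \<open>v e\<close> are slots that later receive
  words; \<open>v = id\<close> puts each idempotent into its own slot.\<close>

definition chain where "chain Z v es z = foldr (\<lambda>e acc. Z e \<star> (v e \<star> acc)) es z"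

lemma chain_simps [simp]: "chain Z v [] z = z" "chain Z v (e # es) z = Z e \<star> (v e \<star> chain Z v es z)"
  "chain Z v (es @ fs) z = chain Z v es (chain Z v fs z)"
  by (auto simp: chain_def)

lemma chain_cong: "(\<And>e. e \<in> set es \<Longrightarrow> Z e = Z' e) \<Longrightarrow> (\<And>e. e \<in> set es \<Longrightarrow> v e = v' e) \<Longrightarrow> chain Z v es z = chain Z' v' es z"
  by (induction es) auto

lemma chain_linear: "chain Z v es (c *s x + y) = c *s chain Z v es x + chain Z v es y"
  by (induction es) (auto simp: mul_distribs)

text \<open>In a product of terms a e b the right factor b is absorbed by the \<open>Z\<close> of
  the next idempotent, or by z at the end. Distinctness makes \<open>Z\<close> a function of the
  idempotent.\<close>

lemma ideal_chain_chain: "distinct es \<Longrightarrow> ideal_chain es \<subseteq> span {chain Z id es z | Z z. True}"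
proof (induction es)
  case (Cons e es)
  have "ideal_chain (e # es) \<subseteq> span {chain Z id (e # es) z | Z z. True}" (is "_ \<subseteq> span ?T")
    unfolding ideal_chain.simps
  proof (rule span_minimal, safe)
    fix x y assume x: "x \<in> block_ideal e" and y: "y \<in> ideal_chain es"
    show "x \<star> y \<in> span ?T"
    proof (rule span_mul_span)
      show "x \<in> span {a \<star> (e \<star> b) | a b. True}" using x by (simp add: block_ideal_def)
      show "y \<in> span {chain Z id es z | Z z. True}" using y Cons.IH Cons.prems by (meson distinct.simps(2) subsetD)
    next
      fix s t assume "s \<in> {a \<star> (e \<star> b) | a b. True}" "t \<in> {chain Z id es z | Z z. True}"
      then obtain a b Z z where s: "s = a \<star> (e \<star> b)" and t: "t = chain Z id es z" by auto
      have "\<exists>Z' z'. b \<star> t = chain Z' id es z'"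
      proof (cases es)
        case (Cons f fs)
        then have "b \<star> t = chain (Z(f := b \<star> Z f)) id es z"
          using Cons.prems unfolding t Cons by (auto intro!: arg_cong[of _ _ "(\<star>) _"] chain_cong)
        then show ?thesis by blast
      qed (use t in auto)
      then obtain Z' z' where "b \<star> t = chain Z' id es z'" by auto
      then have "s \<star> t = a \<star> (e \<star> chain Z' id es z')" using s by simp
      also have "\<dots> = chain (Z'(e := a)) id (e # es) z'" using Cons.prems by (auto intro!: arg_cong[of _ _ "(\<star>) _"] chain_cong)
      finally show "s \<star> t \<in> span ?T" by (intro span_base) blast
    qed simp
  qed
  then show ?case .
qed (auto intro: span_base)

lemma chain_J_power:
  "distinct es \<Longrightarrow> (\<And>e. e \<in> set es \<Longrightarrow> Z e \<in> J_power (m e)) \<Longrightarrow> chain Z v es z \<in> J_power (sum m (set es))"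
proof (induction es)
  case (Cons e es)
  then have "v e \<star> chain Z v es z \<in> J_power (0 + sum m (set es))" by (intro J_power_mult[of _ _ _ 0]) auto
  then have "chain Z v (e # es) z \<in> J_power (m e + (0 + sum m (set es)))"
    unfolding chain_simps by (rule J_power_mult) (use Cons.prems in auto)
  then show ?case using Cons.prems by simp
qed simp

text \<open>The second claim moves a slot element u into \<open>Z\<close>, using u = u e. If u lies
  in \<open>J\<close>, this makes \<open>Z e\<close> deeper, which drives
  \<open>maximal_chain\<close>.\<close>

lemma chain_upd:
  assumes "distinct es" "e \<in> set es"
  shows "chain Z (v(e := c *s x + y)) es z = c *s chain Z (v(e := x)) es z + chain Z (v(e := y)) es z"
    and "u \<in> corner e \<Longrightarrow> chain Z (v(e := u)) es z = chain (Z(e := Z e \<star> u)) (v(e := e)) es z"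
proof -
  obtain pre post where es: "es = pre @ e # post" "e \<notin> set pre" "e \<notin> set post"
    using assms by (metis distinct.simps(2) distinct_append not_distinct_conv_prefix split_list disjoint_iff list.set_intros(1))
  have v: "chain Z (v(e := x)) es z = chain Z v pre (Z e \<star> (x \<star> chain Z v post z))" for Z v x
  proof -
    have "chain Z (v(e := x)) post z = chain Z v post z" by (rule chain_cong) (use es in auto)
    moreover have "chain Z (v(e := x)) pre z' = chain Z v pre z'" for z' by (rule chain_cong) (use es in auto)
    ultimately show ?thesis by (simp add: es)
  qed
  show "chain Z (v(e := c *s x + y)) es z = c *s chain Z (v(e := x)) es z + chain Z (v(e := y)) es z"
    unfolding v by (simp add: mul_distribs chain_linear)
  assume u: "u \<in> corner e"
  have "chain (Z(e := Z e \<star> u)) v post z = chain Z v post z" by (rule chain_cong) (use es in auto)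
  moreover have "chain (Z(e := Z e \<star> u)) v pre z' = chain Z v pre z'" for z' by (rule chain_cong) (use es in auto)
  ultimately show "chain Z (v(e := u)) es z = chain (Z(e := Z e \<star> u)) (v(e := e)) es z"
    unfolding v by (simp add: cornerD[OF u])
qed

text \<open>Choosing the elements \<open>Z e\<close> as deep in the powers of \<open>J\<close> as possible makes the value depend
  on the \<open>v e\<close> only modulo \<open>J\<close>.\<close>

lemma maximal_chain:
  assumes es: "distinct es" "set es \<subseteq> Es" and ne: "ideal_chain es \<noteq> {0}"
  obtains Z z where "chain Z id es z \<noteq> 0"
    "\<And>v. (\<And>e. e \<in> set es \<Longrightarrow> v e \<in> corner e) \<Longrightarrow>
       chain Z v es z = (\<Prod>e\<in>set es. lam e (v e)) *s chain Z id es z"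
proof -
  define P where "P Z m \<longleftrightarrow> (\<forall>e\<in>set es. Z e \<in> J_power (m e))" for Z m
  define Q where "Q n \<longleftrightarrow> (\<exists>Z m z. P Z m \<and> sum m (set es) = n \<and> chain Z id es z \<noteq> 0)" for n
  have "\<exists>Z z. chain Z id es z \<noteq> 0"
  proof (rule ccontr)
    assume "\<not> ?thesis"
    then have "span {chain Z id es z | Z z. True} \<subseteq> {0}" by (intro span_minimal) (auto simp: subspace_def)
    then show False using ideal_chain_chain[OF es(1)] ne subspace_0[OF subspace_ideal_chain] by blast
  qed
  then obtain Z0 z0 where "chain Z0 id es z0 \<noteq> 0" by auto
  then have Q0: "Q 0" unfolding Q_def P_def by (intro exI[of _ Z0] exI[of _ "\<lambda>_. 0"] exI[of _ z0]) auto
  have bound: "n < nil_index" if Qn: "Q n" for n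
  proof (rule ccontr)
    assume "\<not> n < nil_index"
    moreover obtain Z m z where "P Z m" "sum m (set es) = n" "chain Z id es z \<noteq> 0" using Qn unfolding Q_def by blast
    ultimately show False using chain_J_power[OF es(1), of Z m id z] J_power_nil_index[of n] by (auto simp: P_def)
  qed
  define n where "n = (GREATEST n. Q n)"
  have Qn: "Q n" unfolding n_def using Q0 bound by (intro GreatestI_nat[of Q 0 nil_index]) (auto intro: less_imp_le)
  have max: "n' \<le> n" if "Q n'" for n' unfolding n_def using that bound by (intro Greatest_le_nat[of Q _ nil_index]) (auto intro: less_imp_le)
  obtain Z m z where Z: "P Z m" "sum m (set es) = n" "chain Z id es z \<noteq> 0" using Qn unfolding Q_def by blast
  have upd: "P (Z(e := Z e \<star> u)) (m(e := Suc (m e)))" "sum (m(e := Suc (m e))) (set es) = Suc (sum m (set es))"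
    if "P Z m" "e \<in> set es" "u \<in> J" for Z m e u
  proof -
    show "P (Z(e := Z e \<star> u)) (m(e := Suc (m e)))" using that J_power_mult_J by (auto simp: P_def)
    have "sum (m(e := Suc (m e))) (set es - {e}) = sum m (set es - {e})" by (rule sum.cong) auto
    then show "sum (m(e := Suc (m e))) (set es) = Suc (sum m (set es))"
      using that by (simp add: sum.remove[of _ e])
  qed
  \<comment> \<open>Hybrid fillings, with the slots in \<open>M\<close> already exchanged; the
    inductions \<open>A\<close> and \<open>B\<close> exchange one slot at a time.\<close>
  define w where "w M v = (\<lambda>e. if e \<in> M then v e else e)" for M and v :: "'v \<Rightarrow> 'v"
  have w_insert: "w (insert e M) v = (w M v)(e := v e)" "e \<notin> M \<Longrightarrow> (w M v)(e := e) = w M v" for e M v by (auto simp: w_def)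
  have step: "chain Z (w (insert e M) v) es z = lam e (v e) *s chain Z (w M v) es z
      + chain (Z(e := Z e \<star> (v e - lam e (v e) *s e))) (w M v) es z \<and> v e - lam e (v e) *s e \<in> J"
    if "e \<in> set es" "e \<notin> M" "v e \<in> corner e" for e M v Z
  proof -
    have e: "e \<in> Es" using that es by auto
    let ?u = "v e - lam e (v e) *s e"
    have u: "?u \<in> corner e" by (intro subspace_diff subspace_scale subspace_corner that idem_in_corner idem_Es e)
    have "chain Z (w (insert e M) v) es z = chain Z ((w M v)(e := lam e (v e) *s e + ?u)) es z" by (simp add: w_insert)
    also have "\<dots> = lam e (v e) *s chain Z (w M v) es z + chain (Z(e := Z e \<star> ?u)) (w M v) es z"
      unfolding chain_upd(1)[OF es(1) that(1)] chain_upd(2)[OF es(1) that(1) u] w_insert(2)[OF that(2)] by simp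
    finally show ?thesis using corner_J[OF e u] by (simp add: lam_diff lam_scale lam_self prim_Es[OF e])
  qed
  \<comment> \<open>Beyond the maximal total depth n, chains with idempotents in the slots vanish.
    Exchanging a slot produces only multiples of such chains and still deeper ones, so all fillings
    vanish.\<close>
  have A: "chain Z (w M v) es z = 0"
    if "finite M" "M \<subseteq> set es" "P Z m" "sum m (set es) > n" "\<And>e. e \<in> set es \<Longrightarrow> v e \<in> corner e" for M Z m v
    using that
  proof (induction M arbitrary: Z m rule: finite_induct)
    case empty
    have "w {} v = id" by (auto simp: w_def)
    have "\<not> Q (sum m (set es))" using max empty by fastforce
    then have "chain Z id es z = 0" using empty unfolding Q_def by blast
    then show ?case using \<open>w {} v = id\<close> by (simp only:)
  next
    case (insert e M)
    then have e: "e \<in> set es" "v e \<in> corner e" by auto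
    note s = step[OF e(1) insert.hyps(2), of v Z, OF e(2)]
    show ?case using s insert.IH[OF _ upd(1)[OF insert.prems(2) e(1)]] insert.IH[of Z m] upd(2)[OF insert.prems(2) e(1)] insert.prems
      by (metis (no_types, lifting) add.right_neutral insert_subset less_SucI scale_zero_right)
  qed
  \<comment> \<open>At depth n the exchange of e for \<open>v e\<close> yields the factor
    \<open>lam e (v e)\<close> and an error of depth n + 1, which is zero by
    \<open>A\<close>.\<close>
  have B: "chain Z (w M v) es z = (\<Prod>e\<in>M. lam e (v e)) *s chain Z id es z"
    if "finite M" "M \<subseteq> set es" "\<And>e. e \<in> set es \<Longrightarrow> v e \<in> corner e" for M v
    using that
  proof (induction M rule: finite_induct)
    case empty
    have "w {} v = id" by (auto simp: w_def)
    then show ?case by simp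
  next
    case (insert e M)
    then have e: "e \<in> set es" "v e \<in> corner e" by auto
    note s = step[OF e(1) insert.hyps(2), of v Z, OF e(2)]
    have "chain (Z(e := Z e \<star> (v e - lam e (v e) *s e))) (w M v) es z = 0"
      by (rule A[OF insert.hyps(1) _ upd(1)[OF Z(1) e(1)]]) (use s upd(2)[OF Z(1) e(1)] Z insert.prems in auto)
    then show ?case using s insert by simp
  qed
  show ?thesis
  proof (rule that[OF Z(3)])
    fix v assume v: "\<And>e. e \<in> set es \<Longrightarrow> v e \<in> corner e"
    have "chain Z v es z = chain Z (w (set es) v) es z" by (rule chain_cong) (auto simp: w_def)
    then show "chain Z v es z = (\<Prod>e\<in>set es. lam e (v e)) *s chain Z id es z" using B[of "set es" v] v by simp
  qed
qed

end

section \<open>The rank of an integer matrix\<close>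

text \<open>Descends linear relations along a field embedding: applying \<phi> to all coefficients,
  with c a nonzero one, gives a relation over the smaller field that is still nontrivial. Such a
  \<phi> exists because {c} is independent over the smaller field.\<close>

lemma functional_extension:
  fixes h :: "'f::field \<Rightarrow> 'k::field"
  assumes add: "\<And>x y. h (x + y) = h x + h y" and mult: "\<And>x y. h (x * y) = h x * h y" and one: "h 1 = 1"
    and c: "c \<noteq> 0"
  obtains \<phi> :: "'k \<Rightarrow> 'f" where "\<And>x y. \<phi> (x + y) = \<phi> x + \<phi> y" "\<And>a x. \<phi> (h a * x) = a * \<phi> x" "\<phi> c = 1"
proof -
  interpret vector_space_pair "\<lambda>a x. h a * x" "(*) :: 'f \<Rightarrow> 'f \<Rightarrow> 'f"
    by unfold_locales (auto simp: add mult one algebra_simps)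
  have "vs1.independent {c}" using c by (simp add: vs1.independent_insert)
  from linear_independent_extend[OF this, of "\<lambda>_. 1"] obtain \<phi>
    where \<phi>: "Vector_Spaces.linear (\<lambda>a x. h a * x) (*) \<phi>" "\<phi> c = 1" by auto
  interpret l: Vector_Spaces.linear "\<lambda>a x. h a * x" "(*)" \<phi> by (rule \<phi>)
  show ?thesis by (rule that[of \<phi>]) (auto simp: l.add l.scale \<phi>)
qed

lemma additive_sum:
  fixes f :: "'a::ab_group_add \<Rightarrow> 'b::ab_group_add"
  assumes "\<And>x y. f (x + y) = f x + f y" shows "f (sum g S) = (\<Sum>i\<in>S. f (g i))"
proof -
  have "f 0 = 0" using assms[of 0 0] by simp
  then show ?thesis by (induction S rule: infinite_finite_induct) (auto simp: assms)
qed

section \<open>Gram matrices over the reals\<close>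

definition dot :: "'c set \<Rightarrow> ('c \<Rightarrow> real) \<Rightarrow> ('c \<Rightarrow> real) \<Rightarrow> real" where
  "dot C f g = (\<Sum>c\<in>C. f c * g c)"

lemma dot_commute: "dot C f g = dot C g f"
  by (simp add: dot_def mult.commute)

lemma dot_simps:
  "dot C (\<lambda>c. f c - f' c) g = dot C f g - dot C f' g"
  "dot C (\<lambda>c. \<Sum>s\<in>S. \<alpha> s * F s c) g = (\<Sum>s\<in>S. \<alpha> s * dot C (F s) g)"
  "dot C (\<lambda>c. f c / r) g = dot C f g / r"
proof -
  show "dot C (\<lambda>c. \<Sum>s\<in>S. \<alpha> s * F s c) g = (\<Sum>s\<in>S. \<alpha> s * dot C (F s) g)"
    unfolding dot_def sum_distrib_left sum_distrib_right by (subst sum.swap) (simp add: ac_simps)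
qed (auto simp: dot_def algebra_simps sum_subtractf sum_divide_distrib)

lemma dot_cong: "(\<And>c. c \<in> C \<Longrightarrow> f c = f' c) \<Longrightarrow> dot C f g = dot C f' g"
  by (simp add: dot_def)

lemma dot_self: "finite C \<Longrightarrow> dot C f f \<ge> 0" "finite C \<Longrightarrow> dot C f f = 0 \<Longrightarrow> c \<in> C \<Longrightarrow> f c = 0"
  unfolding dot_def by (auto simp: sum_nonneg sum_nonneg_eq_0_iff)

text \<open>A vector that depends on the previous ones contributes \<open>u s = 0\<close>.\<close>

lemma gram_schmidt_family:
  fixes v :: "'i \<Rightarrow> 'c \<Rightarrow> real"
  assumes C: "finite C" and "finite I"
  shows "\<exists>u. (\<forall>s\<in>I. \<forall>t\<in>I. s \<noteq> t \<longrightarrow> dot C (u s) (u t) = 0) \<and> (\<forall>s\<in>I. dot C (u s) (u s) \<in> {0, 1}) \<and>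
    (\<forall>i\<in>I. \<forall>c\<in>C. v i c = (\<Sum>s\<in>I. dot C (v i) (u s) * u s c))"
  using assms(2)
proof (induction I rule: finite_induct)
  case (insert x I)
  then obtain u where orth: "\<And>s t. s \<in> I \<Longrightarrow> t \<in> I \<Longrightarrow> s \<noteq> t \<Longrightarrow> dot C (u s) (u t) = 0"
    and norm: "\<And>s. s \<in> I \<Longrightarrow> dot C (u s) (u s) \<in> {0, 1}"
    and expand: "\<And>i c. i \<in> I \<Longrightarrow> c \<in> C \<Longrightarrow> v i c = (\<Sum>s\<in>I. dot C (v i) (u s) * u s c)" by blast
  define y where "y = (\<lambda>c. v x c - (\<Sum>s\<in>I. dot C (v x) (u s) * u s c))"
  define r where "r = sqrt (dot C y y)"
  \<comment> \<open>In the dependent case r = 0, and division by zero makes \<open>ux\<close> the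
    zero vector.\<close>
  define ux where "ux = (\<lambda>c. y c / r)"
  have y_orth: "dot C y (u t) = 0" if t: "t \<in> I" for t
  proof -
    have "dot C y (u t) = dot C (v x) (u t) - (\<Sum>s\<in>I. dot C (v x) (u s) * dot C (u s) (u t))"
      unfolding y_def by (simp only: dot_simps(1,2))
    also have "(\<Sum>s\<in>I. dot C (v x) (u s) * dot C (u s) (u t)) = (\<Sum>s\<in>I. if s = t then dot C (v x) (u t) * dot C (u t) (u t) else 0)"
      by (rule sum.cong) (use orth t in auto)
    also have "\<dots> = dot C (v x) (u t) * dot C (u t) (u t)" using insert t by simp
    also have "dot C (v x) (u t) * dot C (u t) (u t) = dot C (v x) (u t)"
    proof (cases "dot C (u t) (u t) = 0")
      case True
      then have "dot C (v x) (u t) = 0" using dot_self(2)[OF C True] by (simp add: dot_def)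
      then show ?thesis by simp
    qed (use norm t in auto)
    finally show ?thesis by simp
  qed
  have ux_orth: "dot C ux (u t) = 0" if "t \<in> I" for t using y_orth[OF that] by (simp add: ux_def dot_simps)
  have r2: "r * r = dot C y y" using dot_self(1)[OF C] by (simp add: r_def)
  have yux: "y c = r * ux c" if "c \<in> C" for c
    using dot_self(2)[OF C, of y c] that r2 by (cases "r = 0") (auto simp: ux_def)
  have y_ux: "dot C y ux = dot C y y / r" and ux_ux: "dot C ux ux = dot C y y / (r * r)"
    by (simp_all add: dot_def ux_def sum_divide_distrib)
  have ux_norm: "dot C ux ux \<in> {0, 1}" unfolding ux_ux r2[symmetric] by simp
  have dot_ux: "dot C f ux = 0" if "\<And>c. c \<in> C \<Longrightarrow> f c = (\<Sum>s\<in>I. \<alpha> s * u s c)" for f \<alpha>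
  proof -
    have "dot C f ux = (\<Sum>s\<in>I. \<alpha> s * dot C (u s) ux)" using that by (subst dot_cong[of C f]) (auto simp: dot_simps(2))
    then show ?thesis using ux_orth by (simp add: dot_commute[of C _ ux])
  qed
  have vx: "dot C (v x) ux = r"
  proof -
    have "dot C y ux = dot C (v x) ux - dot C (\<lambda>c. \<Sum>s\<in>I. dot C (v x) (u s) * u s c) ux" unfolding y_def by (rule dot_simps(1))
    moreover have "dot C (\<lambda>c. \<Sum>s\<in>I. dot C (v x) (u s) * u s c) ux = 0" by (rule dot_ux) simp
    moreover have "dot C y ux = r" unfolding y_ux r2[symmetric] by simp
    ultimately show ?thesis by simp
  qed
  define u' where "u' = u(x := ux)"
  have u': "u' s = u s" if "s \<in> I" for s using that insert by (auto simp: u'_def)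
  have u'x: "u' x = ux" by (simp add: u'_def)
  have sum: "(\<Sum>s\<in>insert x I. dot C f (u' s) * u' s c) = dot C f ux * ux c + (\<Sum>s\<in>I. dot C f (u s) * u s c)" for f c
    using insert by (simp add: u'x u')
  show ?case
  proof (intro exI[of _ u'] conjI ballI impI)
    fix s t assume "s \<in> insert x I" "t \<in> insert x I" "s \<noteq> t"
    moreover have "dot C (u s) ux = 0" if "s \<in> I" for s using ux_orth[OF that] by (simp add: dot_commute)
    ultimately show "dot C (u' s) (u' t) = 0" using orth ux_orth
      by (cases "s = x"; cases "t = x") (simp_all add: u'x u')
  next
    fix s assume "s \<in> insert x I"
    then show "dot C (u' s) (u' s) \<in> {0, 1}" using norm ux_norm by (cases "s = x") (simp_all add: u'x u')
  next
    fix i c assume i: "i \<in> insert x I" and c: "c \<in> C"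
    show "v i c = (\<Sum>s\<in>insert x I. dot C (v i) (u' s) * u' s c)"
    proof (cases "i = x")
      case True
      have "v x c = y c + (\<Sum>s\<in>I. dot C (v x) (u s) * u s c)" by (simp add: y_def)
      then show ?thesis using yux[OF c] by (simp only: True sum vx)
    next
      case False
      then have "i \<in> I" using i by auto
      then have "dot C (v i) ux = 0" using expand by (intro dot_ux) auto
      then show ?thesis using expand[OF \<open>i \<in> I\<close> c] by (simp only: sum)
    qed
  qed
qed auto

lemma square_sum_le:
  fixes f :: "'a \<Rightarrow> real" assumes "finite S" shows "(sum f S)\<^sup>2 \<le> card S * (\<Sum>s\<in>S. (f s)\<^sup>2)"
proof -
  have "(sum f S)\<^sup>2 = (\<Sum>s\<in>S. \<Sum>t\<in>S. f s * f t)" by (simp add: power2_eq_square sum_product)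
  also have "\<dots> \<le> (\<Sum>s\<in>S. \<Sum>t\<in>S. ((f s)\<^sup>2 + (f t)\<^sup>2) / 2)"
  proof (intro sum_mono)
    fix s t show "f s * f t \<le> ((f s)\<^sup>2 + (f t)\<^sup>2) / 2" using sum_squares_bound[of "f s" "f t"] by simp
  qed
  also have "\<dots> = card S * (\<Sum>s\<in>S. (f s)\<^sup>2)"
    by (simp add: add_divide_distrib sum.distrib sum_distrib_left flip: sum_divide_distrib)
  finally show ?thesis .
qed

text \<open>With an orthonormal basis \<open>u\<close> of the span, \<open>\<Sum>\<^sub>i \<parallel>v i\<parallel>\<^sup>2 = \<Sum>\<^sub>s w s\<close> where
  \<open>w s = \<Sum>\<^sub>i \<langle>v i, u s\<rangle>\<^sup>2\<close>, and the \<open>w s\<close> are the diagonal entries of a matrix whose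
  Frobenius norm is that of the Gram matrix.\<close>

lemma gram_rank_bound:
  fixes v :: "'i \<Rightarrow> 'c \<Rightarrow> real"
  assumes C: "finite C" and B: "finite B" and I: "finite I"
    and span: "\<And>i. i \<in> I \<Longrightarrow> \<exists>a. \<forall>c\<in>C. v i c = (\<Sum>j\<in>B. a j * v j c)"
  shows "(\<Sum>i\<in>I. dot C (v i) (v i))\<^sup>2 \<le> card B * (\<Sum>i\<in>I. \<Sum>j\<in>I. (dot C (v i) (v j))\<^sup>2)"
proof -
  obtain u where expB: "\<And>i c. i \<in> B \<Longrightarrow> c \<in> C \<Longrightarrow> v i c = (\<Sum>s\<in>B. dot C (v i) (u s) * u s c)"
    using gram_schmidt_family[OF C B, of v] by blast
  define \<alpha> where "\<alpha> i s = dot C (v i) (u s)" for i s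
  have exp: "v i c = (\<Sum>s\<in>B. \<alpha> i s * u s c)" if i: "i \<in> I" and c: "c \<in> C" for i c
  proof -
    obtain a where a: "\<And>c. c \<in> C \<Longrightarrow> v i c = (\<Sum>j\<in>B. a j * v j c)" using span[OF i] by auto
    have "\<alpha> i s = (\<Sum>j\<in>B. a j * dot C (v j) (u s))" for s
      unfolding \<alpha>_def by (subst dot_cong[OF a]) (auto simp: dot_simps(2))
    then have "(\<Sum>s\<in>B. \<alpha> i s * u s c) = (\<Sum>s\<in>B. \<Sum>j\<in>B. a j * (dot C (v j) (u s) * u s c))"
      by (simp add: sum_distrib_right mult.assoc)
    also have "\<dots> = (\<Sum>j\<in>B. a j * v j c)"
      by (subst sum.swap) (simp add: expB[OF _ c] flip: sum_distrib_left)
    finally show ?thesis using a[OF c] by simp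
  qed
  have dot: "dot C (v i) (v j) = (\<Sum>s\<in>B. \<alpha> i s * \<alpha> j s)" if "i \<in> I" "j \<in> I" for i j
  proof -
    have "dot C (v i) (v j) = dot C (\<lambda>c. \<Sum>s\<in>B. \<alpha> i s * u s c) (v j)" by (rule dot_cong) (rule exp[OF that(1)])
    then show ?thesis by (simp add: dot_simps(2) dot_commute[of C "u _"] \<alpha>_def)
  qed
  define w where "w s t = (\<Sum>i\<in>I. \<alpha> i s * \<alpha> i t)" for s t
  have "(\<Sum>i\<in>I. dot C (v i) (v i)) = (\<Sum>s\<in>B. w s s)"
    unfolding w_def by (subst sum.swap) (simp add: dot)
  also have "(\<dots>)\<^sup>2 \<le> card B * (\<Sum>s\<in>B. (w s s)\<^sup>2)" by (rule square_sum_le[OF B])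
  also have "(\<Sum>s\<in>B. (w s s)\<^sup>2) \<le> (\<Sum>s\<in>B. \<Sum>t\<in>B. (w s t)\<^sup>2)"
    by (intro sum_mono member_le_sum B) auto
  also have "\<dots> = (\<Sum>s\<in>B. \<Sum>t\<in>B. \<Sum>i\<in>I. \<Sum>j\<in>I. (\<alpha> i s * \<alpha> i t) * (\<alpha> j s * \<alpha> j t))"
    by (simp only: w_def power2_eq_square sum_product)
  also have "\<dots> = (\<Sum>s\<in>B. \<Sum>i\<in>I. \<Sum>t\<in>B. \<Sum>j\<in>I. (\<alpha> i s * \<alpha> i t) * (\<alpha> j s * \<alpha> j t))" by (intro sum.cong refl sum.swap)
  also have "\<dots> = (\<Sum>i\<in>I. \<Sum>s\<in>B. \<Sum>t\<in>B. \<Sum>j\<in>I. (\<alpha> i s * \<alpha> i t) * (\<alpha> j s * \<alpha> j t))" by (rule sum.swap)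
  also have "\<dots> = (\<Sum>i\<in>I. \<Sum>s\<in>B. \<Sum>j\<in>I. \<Sum>t\<in>B. (\<alpha> i s * \<alpha> i t) * (\<alpha> j s * \<alpha> j t))" by (intro sum.cong refl sum.swap)
  also have "\<dots> = (\<Sum>i\<in>I. \<Sum>j\<in>I. \<Sum>s\<in>B. \<Sum>t\<in>B. (\<alpha> i s * \<alpha> i t) * (\<alpha> j s * \<alpha> j t))" by (intro sum.cong refl sum.swap)
  also have "\<dots> = (\<Sum>i\<in>I. \<Sum>j\<in>I. (dot C (v i) (v j))\<^sup>2)"
    by (intro sum.cong refl) (simp add: dot power2_eq_square sum_product ac_simps)
  finally show ?thesis by (simp add: mult_left_mono)
qed

text \<open>The field is a parameter: rows are selected over the rationals, counted over the reals
  and used over the algebraic closure.\<close>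

definition indep_rows :: "'f::ring_1 itself \<Rightarrow> ('i \<Rightarrow> 'c \<Rightarrow> int) \<Rightarrow> 'i set \<Rightarrow> 'c set \<Rightarrow> bool" where
  "indep_rows _ v B C \<longleftrightarrow>
     (\<forall>a::'i \<Rightarrow> 'f. (\<forall>c\<in>C. (\<Sum>i\<in>B. a i * of_int (v i c)) = 0) \<longrightarrow> (\<forall>i\<in>B. a i = 0))"

text \<open>A rational functional with value 1 at a nonzero coefficient turns a relation over
  \<open>'f\<close> into a nontrivial rational one.\<close>

lemma indep_rows_rat:
  fixes v :: "'i \<Rightarrow> 'c \<Rightarrow> int"
  assumes "indep_rows TYPE(rat) v B C" shows "indep_rows TYPE('f::field_char_0) v B C"
  unfolding indep_rows_def
proof (intro allI impI ballI)
  fix a :: "'i \<Rightarrow> 'f" and i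
  assume a: "\<forall>c\<in>C. (\<Sum>i\<in>B. a i * of_int (v i c)) = 0" and i: "i \<in> B"
  show "a i = 0"
  proof (rule ccontr)
    assume "a i \<noteq> 0"
    obtain \<phi> :: "'f \<Rightarrow> rat" where \<phi>: "\<And>x y. \<phi> (x + y) = \<phi> x + \<phi> y" "\<And>q x. \<phi> (of_rat q * x) = q * \<phi> x" "\<phi> (a i) = 1"
      by (rule functional_extension[of of_rat "a i"]) (use \<open>a i \<noteq> 0\<close> in \<open>auto simp: of_rat_add of_rat_mult\<close>)
    have "\<phi> (x * of_int n) = \<phi> x * of_int n" for x n using \<phi>(2)[of "of_int n" x] by (simp add: mult.commute)
    then have "(\<Sum>i\<in>B. \<phi> (a i) * of_int (v i c)) = \<phi> (\<Sum>i\<in>B. a i * of_int (v i c))" for c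
      by (simp add: additive_sum[of \<phi>, OF \<phi>(1)])
    moreover have "\<phi> 0 = 0" using \<phi>(1)[of 0 0] by simp
    ultimately have "\<forall>c\<in>C. (\<Sum>i\<in>B. \<phi> (a i) * of_int (v i c)) = 0" using a by simp
    then have "\<phi> (a i) = 0" using assms i unfolding indep_rows_def by (elim allE[of _ "\<lambda>i. \<phi> (a i)"]) simp
    then show False using \<phi>(3) by simp
  qed
qed

text \<open>A maximal rationally independent set of rows spans the others over the rationals, hence
  over the reals, where \<open>gram_rank_bound\<close> applies.\<close>

lemma exists_independent_rows:
  fixes v :: "'i \<Rightarrow> 'c \<Rightarrow> int"
  assumes C: "finite C" and I: "finite I"
  shows "\<exists>B\<subseteq>I. indep_rows TYPE('f::field_char_0) v B C \<and>
    (real_of_int (\<Sum>i\<in>I. \<Sum>c\<in>C. v i c * v i c))\<^sup>2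
      \<le> card B * real_of_int (\<Sum>i\<in>I. \<Sum>j\<in>I. (\<Sum>c\<in>C. v i c * v j c)\<^sup>2)"
proof -
  let ?P = "\<lambda>B. B \<subseteq> I \<and> indep_rows TYPE(rat) v B C"
  have "?P {}" by (simp add: indep_rows_def)
  then obtain B where B: "?P B" and max: "\<And>B'. ?P B' \<Longrightarrow> card B' \<le> card B"
    using ex_has_greatest_nat[of ?P "{}" card "Suc (card I)"] card_mono[OF I] by (auto simp: less_Suc_eq_le)
  have fB: "finite B" using B I finite_subset by auto
  let ?v = "\<lambda>i c. real_of_int (v i c)"
  have span: "\<exists>a. \<forall>c\<in>C. ?v i c = (\<Sum>j\<in>B. a j * ?v j c)" if i: "i \<in> I" for i
  proof (cases "i \<in> B")
    case True
    have "?v i c = (\<Sum>j\<in>B. (if j = i then 1 else 0) * ?v j c)" for c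
      using True fB by (simp add: if_distrib[of "\<lambda>x. x * _"] cong: if_cong)
    then show ?thesis by (intro exI[of _ "\<lambda>j. if j = i then 1 else 0"]) simp
  next
    case False
    have "\<not> indep_rows TYPE(rat) v (insert i B) C" using max[of "insert i B"] False fB B i by auto
    then obtain a :: "'i \<Rightarrow> rat" and l where a: "\<And>c. c \<in> C \<Longrightarrow> (\<Sum>j\<in>insert i B. a j * of_int (v j c)) = 0"
      and l: "l \<in> insert i B" "a l \<noteq> 0" unfolding indep_rows_def by blast
    have a': "a i * of_int (v i c) + (\<Sum>j\<in>B. a j * of_int (v j c)) = 0" if "c \<in> C" for c
      using a[OF that] fB False by simp
    have ai: "a i \<noteq> 0"
    proof
      assume 0: "a i = 0"
      then have "\<forall>c\<in>C. (\<Sum>j\<in>B. a j * of_int (v j c)) = 0" using a' by simp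
      then have "\<forall>j\<in>B. a j = 0" using B unfolding indep_rows_def by blast
      then show False using l 0 by auto
    qed
    have "?v i c = (\<Sum>j\<in>B. (- of_rat (a j / a i)) * ?v j c)" if c: "c \<in> C" for c
    proof -
      have "of_int (v i c) = (\<Sum>j\<in>B. - (a j / a i) * of_int (v j c))"
        using a'[OF c] ai by (simp add: sum_negf eq_neg_iff_add_eq_0 field_simps sum_divide_distrib[symmetric])
      then have "of_rat (of_int (v i c)) = (of_rat (\<Sum>j\<in>B. - (a j / a i) * of_int (v j c)) :: real)" by simp
      then show ?thesis by (simp add: of_rat_sum of_rat_mult of_rat_minus of_rat_divide)
    qed
    then show ?thesis by (intro exI[of _ "\<lambda>j. - of_rat (a j / a i)"]) simp
  qed
  have "(\<Sum>i\<in>I. dot C (?v i) (?v i))\<^sup>2 \<le> card B * (\<Sum>i\<in>I. \<Sum>j\<in>I. (dot C (?v i) (?v j))\<^sup>2)"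
    by (rule gram_rank_bound[OF C fB I span])
  then show ?thesis using B indep_rows_rat[of v B C] by (intro exI[of _ B]) (auto simp: dot_def)
qed

section \<open>Walks through complete directed graphs\<close>

text \<open>Letter j is an edge from \<open>a j\<close> to \<open>b j\<close>. A product of matrix
  units along w has entry 1 at (p, q) if w is a walk from p to q, and 0 otherwise; see
  \<open>lam_walk\<close>.\<close>

primrec walk where
  "walk a b p [] q \<longleftrightarrow> p = q"
| "walk a b p (j # w) q \<longleftrightarrow> a j = p \<and> walk a b (b j) w q"

section \<open>Colourings fixed by a permutation\<close>

definition fixed_maps :: "'a set \<Rightarrow> 'q set \<Rightarrow> ('a \<Rightarrow> 'a) \<Rightarrow> ('a \<Rightarrow> 'q) set" where
  "fixed_maps S Q \<rho> = {A \<in> S \<rightarrow>\<^sub>E Q. \<forall>x\<in>S. A (\<rho> x) = A x}"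

lemma finite_fixed_maps: "finite S \<Longrightarrow> finite Q \<Longrightarrow> finite (fixed_maps S Q \<rho>)"
  unfolding fixed_maps_def by (rule finite_subset[of _ "S \<rightarrow>\<^sub>E Q"]) (auto intro: finite_PiE)

text \<open>By Burnside's lemma the sum below is \<open>|S|!\<close> times the number of \<open>Q\<close>-coloured multisets of size
  \<open>|S|\<close>.\<close>

lemma sum_fixed_maps_le:
  assumes "finite S" "finite Q"
  shows "real (\<Sum>\<rho> | \<rho> permutes S. card (fixed_maps S Q \<rho>)) \<le> fact (card S) * real (card S + 1) ^ card Q"
  using assms(1)
proof (induction S rule: finite_induct)
  case empty
  have "fixed_maps {} Q \<rho> = {\<lambda>_. undefined}" for \<rho> :: "'a \<Rightarrow> 'a" by (auto simp: fixed_maps_def)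
  then show ?case by simp
next
  case (insert x S)
  let ?Z = "\<Sum>\<rho> | \<rho> permutes S. card (fixed_maps S Q \<rho>)"
  \<comment> \<open>Every permutation of \<open>insert x S\<close> is some
    \<open>transpose x b \<circ> p\<close>. For b = x the point x is fixed and its colour is free;
    otherwise x joins the cycle of b and inherits the colour. So the sum grows at most by the factor
    q + m, with q colours and m = \<open>card S\<close>.\<close>
  have le: "card (fixed_maps (insert x S) Q (transpose x b \<circ> p)) \<le> (if b = x then card Q else 1) * card (fixed_maps S Q p)"
    if b: "b \<in> insert x S" and p: "p permutes S" for b p
  proof -
    have px: "p x = x" using p insert(2) by (auto simp: permutes_def)
    have pS: "p y \<in> S" "p y \<noteq> x" if "y \<in> S" for y using permutes_in_image[OF p, of y] that insert(2) by auto
    have rest: "restrict A S \<in> fixed_maps S Q p"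
      and Ab: "A b = A x" if A: "A \<in> fixed_maps (insert x S) Q (transpose x b \<circ> p)" for A
    proof -
      have fx: "A (transpose x b (p y)) = A y" if "y \<in> insert x S" for y using A that by (auto simp: fixed_maps_def)
      show Ab: "A b = A x" using fx[of x] px by (cases "b = x") auto
      have "A (p y) = A y" if "y \<in> S" for y
        using fx[of y] pS[OF that] that Ab by (cases "p y = b") (auto simp: transpose_def)
      then show "restrict A S \<in> fixed_maps S Q p" using A pS by (auto simp: fixed_maps_def)
    qed
    show ?thesis
    proof (cases "b = x")
      case True
      let ?f = "\<lambda>A. (A x, restrict A S)"
      have "inj_on ?f (fixed_maps (insert x S) Q (transpose x b \<circ> p))"
      proof (rule inj_onI)
        fix A A' assume AA: "A \<in> fixed_maps (insert x S) Q (transpose x b \<circ> p)"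
          "A' \<in> fixed_maps (insert x S) Q (transpose x b \<circ> p)" and eq: "?f A = ?f A'"
        then have "A y = A' y" if "y \<in> insert x S" for y
          using that by (cases "y = x") (auto dest: fun_cong[of _ _ y] simp: restrict_def split: if_splits)
        moreover have "A y = A' y" if "y \<notin> insert x S" for y using AA that by (auto simp: fixed_maps_def PiE_def extensional_def)
        ultimately show "A = A'" by blast
      qed
      moreover have "?f ` fixed_maps (insert x S) Q (transpose x b \<circ> p) \<subseteq> Q \<times> fixed_maps S Q p"
        using rest by (auto simp: fixed_maps_def)
      ultimately have "card (fixed_maps (insert x S) Q (transpose x b \<circ> p)) \<le> card (Q \<times> fixed_maps S Q p)"
        using assms(2) insert(1) by (intro card_inj_on_le) (auto intro: finite_fixed_maps)
      then show ?thesis using True by (simp add: card_cartesian_product)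
    next
      case False
      then have bS: "b \<in> S" using b by auto
      let ?f = "\<lambda>A. restrict A S"
      have "inj_on ?f (fixed_maps (insert x S) Q (transpose x b \<circ> p))"
      proof (rule inj_onI)
        fix A A' assume AA: "A \<in> fixed_maps (insert x S) Q (transpose x b \<circ> p)"
          "A' \<in> fixed_maps (insert x S) Q (transpose x b \<circ> p)" and eq: "?f A = ?f A'"
        have S: "A y = A' y" if "y \<in> S" for y using fun_cong[OF eq, of y] that by simp
        moreover have "A x = A' x" using S[OF bS] Ab[OF AA(1)] Ab[OF AA(2)] by simp
        moreover have "A y = A' y" if "y \<notin> insert x S" for y using AA that by (auto simp: fixed_maps_def PiE_def extensional_def)
        ultimately show "A = A'" by (metis (full_types) ext insertE)
      qed
      moreover have "?f ` fixed_maps (insert x S) Q (transpose x b \<circ> p) \<subseteq> fixed_maps S Q p" using rest by auto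
      ultimately have "card (fixed_maps (insert x S) Q (transpose x b \<circ> p)) \<le> card (fixed_maps S Q p)"
        using assms(2) insert(1) by (intro card_inj_on_le) (auto intro: finite_fixed_maps)
      then show ?thesis using False by simp
    qed
  qed
  let ?m = "card S" and ?q = "card Q"
  have "(\<Sum>\<rho> | \<rho> permutes insert x S. card (fixed_maps (insert x S) Q \<rho>))
    \<le> (\<Sum>b\<in>insert x S. \<Sum>p | p permutes S. (if b = x then ?q else 1) * card (fixed_maps S Q p))"
    unfolding sum_over_permutations_insert[OF insert(1,2)] by (intro sum_mono) (rule le, simp_all)
  also have "\<dots> = (\<Sum>b\<in>insert x S. (if b = x then ?q else 1)) * ?Z"
    by (rule sum_product[symmetric])
  also have "(\<Sum>b\<in>insert x S. (if b = x then ?q else 1)) = ?q + ?m"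
  proof -
    have "(\<Sum>b\<in>S. (if b = x then ?q else 1)) = (\<Sum>b\<in>S. 1)" by (rule sum.cong) (use insert in auto)
    then show ?thesis using insert by simp
  qed
  finally have "real (\<Sum>\<rho> | \<rho> permutes insert x S. card (fixed_maps (insert x S) Q \<rho>)) \<le> real ((?q + ?m) * ?Z)"
    by (simp only: of_nat_le_iff)
  also have "\<dots> \<le> real (?q + ?m) * (fact ?m * real (?m + 1) ^ ?q)"
    unfolding of_nat_mult by (intro mult_left_mono insert.IH) auto
  also have "real (?q + ?m) * (fact ?m * real (?m + 1) ^ ?q) \<le> fact (Suc ?m) * real (?m + 2) ^ ?q"
  proof -
    \<comment> \<open>Apart from the factorial, the bound grows by ((m + 2) / (m + 1))^q;
      Bernoulli's inequality shows that this dominates (q + m) / (m + 1).\<close>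
    have "real (?q + ?m) / real (?m + 1) \<le> 1 + real ?q * (1 / real (?m + 1))" by (simp add: divide_simps)
    also have "\<dots> \<le> (1 + 1 / real (?m + 1)) ^ ?q" by (rule Bernoulli_inequality) (simp add: field_simps)
    also have "1 + 1 / real (?m + 1) = real (?m + 2) / real (?m + 1)" by (simp add: field_simps)
    finally have "real (?q + ?m) / real (?m + 1) \<le> real (?m + 2) ^ ?q / real (?m + 1) ^ ?q"
      by (simp only: power_divide)
    then have "real (?q + ?m) * real (?m + 1) ^ ?q \<le> real (?m + 2) ^ ?q * real (?m + 1)"
      using divide_le_eq[of "real (?q + ?m)" "real (?m + 1)"] pos_le_divide_eq[of "real (?m + 1) ^ ?q"]
        pos_divide_le_eq[of "real (?m + 1)"] by (simp del: of_nat_add add: field_simps)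
    then have le: "real (?q + ?m) * real (?m + 1) ^ ?q \<le> real (?m + 1) * real (?m + 2) ^ ?q"
      by (simp only: mult.commute)
    have "real (?q + ?m) * (fact ?m * real (?m + 1) ^ ?q) = fact ?m * (real (?q + ?m) * real (?m + 1) ^ ?q)"
      by (simp only: mult.left_commute)
    also have "\<dots> \<le> fact ?m * (real (?m + 1) * real (?m + 2) ^ ?q)" by (rule mult_left_mono[OF le]) simp
    also have "\<dots> = fact (Suc ?m) * real (?m + 2) ^ ?q" by (simp add: algebra_simps)
    finally show ?thesis .
  qed
  finally show ?case using insert by simp
qed

text \<open>The vertex \<open>0\<close> closes the walk to a cycle, and \<open>successor w\<close> is that cycle.\<close>

definition successor :: "nat list \<Rightarrow> nat \<Rightarrow> nat" where
  "successor w j = (if j \<in> set (0 # w) then the (map_of (zip (0 # w) (w @ [0])) j) else j)"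

lemma successor_nth:
  assumes "distinct (0 # w)" "i < Suc (length w)"
  shows "successor w ((0 # w) ! i) = (w @ [0]) ! i"
proof -
  have "(0 # w) ! i \<in> set (0 # w)" using assms(2) nth_mem[of i "0 # w"] by simp
  moreover have "map_of (zip (0 # w) (w @ [0])) ((0 # w) ! i) = Some ((w @ [0]) ! i)"
    by (rule map_of_zip_nth) (use assms in auto)
  ultimately show ?thesis by (simp only: successor_def if_True option.sel)
qed

lemma successor_permutes:
  assumes d: "distinct (0 # w)" shows "successor w permutes insert 0 (set w)"
proof (rule bij_imp_permutes)
  let ?S = "insert 0 (set w)" and ?n = "Suc (length w)"
  have S: "?S = (\<lambda>i. (0 # w) ! i) ` {..<?n}" "?S = (\<lambda>i. (w @ [0]) ! i) ` {..<?n}"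
    using set_conv_nth[of "0 # w"] set_conv_nth[of "w @ [0]"] by (auto simp: image_def)
  have "successor w ` ?S = (\<lambda>i. successor w ((0 # w) ! i)) ` {..<?n}" by (subst S(1)) (simp only: image_image)
  also have "\<dots> = (\<lambda>i. (w @ [0]) ! i) ` {..<?n}" by (rule image_cong[OF refl]) (use successor_nth[OF d] in auto)
  also have "\<dots> = ?S" by (rule S(2)[symmetric])
  finally have im: "successor w ` ?S = ?S" .
  then have "inj_on (successor w) ?S" by (intro eq_card_imp_inj_on) (auto simp del: image_insert)
  then show "bij_betw (successor w) ?S ?S" using im by (simp add: bij_betw_def del: image_insert)
qed (auto simp: successor_def)

lemma successor_inj:
  assumes d: "distinct (0 # w)" "distinct (0 # w')" and s: "set w = set w'" and eq: "successor w = successor w'"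
  shows "w = w'"
proof -
  have len: "length w = length w'" using d s distinct_card[of w] distinct_card[of w'] by simp
  have "(0 # w) ! i = (0 # w') ! i" if "i < Suc (length w)" for i
    using that
  proof (induction i)
    case (Suc i)
    then have "w ! i = successor w ((0 # w) ! i)" using successor_nth[OF d(1), of i] by (simp add: nth_append)
    also have "\<dots> = successor w' ((0 # w') ! i)" using Suc eq by simp
    also have "\<dots> = w' ! i" using successor_nth[OF d(2), of i] Suc len by (simp add: nth_append)
    finally show ?case by simp
  qed simp
  then have "0 # w = 0 # w'" by (intro nth_equalityI) (use len in auto)
  then show ?thesis by simp
qed

lemma walk_zip:
  "(\<And>j. j \<in> set w \<Longrightarrow> B j = b j \<and> A j = a j) \<Longrightarrow>
   walk a b (B s) w (A f) \<longleftrightarrow> (\<forall>(j, i)\<in>set (zip (s # w) (w @ [f])). B j = A i)"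
proof (induction w arbitrary: s)
  case (Cons j w)
  have "B j = b j" "A j = a j" using Cons.prems by auto
  then show ?case using Cons.IH[of j] Cons.prems by auto
qed simp

text \<open>The letter 0 is treated as a loop at vertex 0. A walk from 0 to 0 then becomes a cyclic
  condition: each letter of \<open>0 # w\<close> ends where its successor begins.\<close>

lemma walk_iff_successor:
  assumes d: "distinct (0 # w)"
  shows "walk a b 0 w 0 \<longleftrightarrow> (\<forall>j\<in>insert 0 (set w). (b(0 := 0)) j = (a(0 := 0)) (successor w j))"
proof -
  let ?B = "b(0 := 0)" and ?A = "a(0 := 0)"
  have "walk a b (?B 0) w (?A 0) \<longleftrightarrow> (\<forall>(j, i)\<in>set (zip (0 # w) (w @ [0])). ?B j = ?A i)"
    by (rule walk_zip) (use d in auto)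
  also have "\<dots> \<longleftrightarrow> (\<forall>i<Suc (length w). ?B ((0 # w) ! i) = ?A ((w @ [0]) ! i))"
    by (auto simp only: set_zip) (force, auto)
  also have "\<dots> \<longleftrightarrow> (\<forall>i<Suc (length w). ?B ((0 # w) ! i) = ?A (successor w ((0 # w) ! i)))"
    using successor_nth[OF d] by (simp del: nth_Cons_Suc fun_upd_apply)
  also have "\<dots> \<longleftrightarrow> (\<forall>j\<in>set (0 # w). ?B j = ?A (successor w j))"
    using all_set_conv_all_nth[of "0 # w" "\<lambda>j. ?B j = ?A (successor w j)"] by simp
  finally show ?thesis by simp
qed

section \<open>The Gram matrix of incidences between words and walks\<close>

definition orderings :: "nat set \<Rightarrow> nat list set" where
  "orderings S = {w. distinct w \<and> set w = S}"

text \<open>A pair of tails and heads gives each letter an edge of the complete digraph with loops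
  on k vertices, that is, one of the k^2 matrix units of a block of size k.\<close>

definition edges :: "nat \<Rightarrow> nat set \<Rightarrow> ((nat \<Rightarrow> nat) \<times> (nat \<Rightarrow> nat)) set" where
  "edges k S = (S \<rightarrow>\<^sub>E {..<k}) \<times> (S \<rightarrow>\<^sub>E {..<k})"

definition walk_inc :: "nat list \<Rightarrow> (nat \<Rightarrow> nat) \<times> (nat \<Rightarrow> nat) \<Rightarrow> int" where
  "walk_inc w c = (if walk (fst c) (snd c) 0 w 0 then 1 else 0)"

definition walk_gram :: "nat \<Rightarrow> nat set \<Rightarrow> nat list \<Rightarrow> nat list \<Rightarrow> int" where
  "walk_gram k S w w' = (\<Sum>c\<in>edges k S. walk_inc w c * walk_inc w' c)"

lemma finite_orderings: "finite S \<Longrightarrow> finite (orderings S)"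
  and card_orderings: "finite S \<Longrightarrow> card (orderings S) = fact (card S)"
  using card_permutations_of_set[of S] finite_permutations_of_set[of S]
  by (auto simp: orderings_def permutations_of_set_def conj_commute)

lemma finite_edges: "finite S \<Longrightarrow> finite (edges k S)"
  unfolding edges_def by (intro finite_cartesian_product finite_PiE) auto

lemma walk_gram_card: "finite S \<Longrightarrow> walk_gram k S w w' =
   int (card {c \<in> edges k S. walk (fst c) (snd c) 0 w 0 \<and> walk (fst c) (snd c) 0 w' 0})"
proof -
  assume "finite S"
  then have "(\<Sum>c\<in>edges k S. if walk (fst c) (snd c) 0 w 0 \<and> walk (fst c) (snd c) 0 w' 0 then 1 else 0) =
    int (card {c \<in> edges k S. walk (fst c) (snd c) 0 w 0 \<and> walk (fst c) (snd c) 0 w' 0})"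
    using finite_edges by (simp add: sum.If_cases Int_def)
  moreover have "walk_inc w c * walk_inc w' c = (if walk (fst c) (snd c) 0 w 0 \<and> walk (fst c) (snd c) 0 w' 0 then 1 else 0)" for c
    by (simp add: walk_inc_def)
  ultimately show ?thesis unfolding walk_gram_def by (simp only:)
qed

text \<open>All tails are free except that of the first letter, which is 0; the heads are then
  forced. This gives k^(card S - 1) closed walks for nonempty S, and the factor k lets the bound
  include the empty S.\<close>

lemma walk_gram_self:
  assumes S: "finite S" "0 \<notin> S" and k: "k \<ge> 1" and w: "w \<in> orderings S"
  shows "k ^ card S \<le> k * walk_gram k S w w"
proof (cases w)
  case Nil
  then have "S = {}" using w by (auto simp: orderings_def)
  then have "edges k S = {(\<lambda>_. undefined, \<lambda>_. undefined)}" by (auto simp: edges_def)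
  then show ?thesis using k Nil \<open>S = {}\<close> by (simp add: walk_gram_def walk_inc_def)
next
  case (Cons j w')
  have d: "distinct (0 # w)" and wS: "set w = S" using w S by (auto simp: orderings_def)
  have j: "j \<in> S" using wS Cons by auto
  have s0: "successor w 0 = j" using successor_nth[OF d, of 0] Cons by simp
  have sS: "successor w i \<in> insert 0 S" if "i \<in> S" for i
    using permutes_in_image[OF successor_permutes[OF d], of i] that wS by auto
  let ?W = "{c \<in> edges k S. walk (fst c) (snd c) 0 w 0 \<and> walk (fst c) (snd c) 0 w 0}"
  let ?f = "\<lambda>A. (restrict (A(j := 0)) S, restrict (\<lambda>i. (A(j := 0, 0 := 0)) (successor w i)) S)"
  let ?D = "(S - {j}) \<rightarrow>\<^sub>E {..<k}"
  have "?f ` ?D \<subseteq> ?W"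
  proof
    fix c assume "c \<in> ?f ` ?D"
    then obtain A where A: "A \<in> ?D" "c = ?f A" by auto
    have Ak: "(A(j := 0)) i < k" if "i \<in> S" for i using A k that by (auto simp: PiE_def Pi_def)
    have "(A(j := 0, 0 := 0)) i < k" if "i \<in> insert 0 S" for i using Ak[of i] k that by auto
    then have "c \<in> edges k S" using Ak sS A(2) by (auto simp: edges_def simp del: fun_upd_apply)
    moreover have "walk (fst c) (snd c) 0 w 0"
      unfolding walk_iff_successor[OF d]
    proof
      fix i assume i: "i \<in> insert 0 (set w)"
      have eq: "(fst c)(0 := 0) = (\<lambda>i. if i \<in> insert 0 S then (A(j := 0, 0 := 0)) i else fst c i)"
        by (auto simp: A(2))
      have "successor w i \<in> insert 0 S" using sS i s0 j wS by auto
      then have fc: "((fst c)(0 := 0)) (successor w i) = (A(j := 0, 0 := 0)) (successor w i)"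
        using fun_cong[OF eq, of "successor w i"] by (simp del: fun_upd_apply)
      show "((snd c)(0 := 0)) i = ((fst c)(0 := 0)) (successor w i)"
        unfolding fc using i wS s0 S j by (cases "i = 0") (auto simp: A(2))
    qed
    ultimately show "c \<in> ?W" by simp
  qed
  moreover have "inj_on ?f ?D"
  proof (rule inj_onI, rule ext)
    fix A A' i assume "A \<in> ?D" "A' \<in> ?D" "?f A = ?f A'"
    then show "A i = A' i"
      by (cases "i \<in> S - {j}") (auto simp: PiE_def extensional_def dest!: fun_cong[of _ _ i])
  qed
  moreover have "finite ?W" using finite_edges[OF S(1)] by auto
  ultimately have "card ?D \<le> card ?W" by (intro card_inj_on_le)
  moreover have "card ?D = k ^ (card S - 1)" using S j by (simp add: card_PiE)
  ultimately have "k * k ^ (card S - 1) \<le> k * card ?W" by simp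
  moreover have "k * k ^ (card S - 1) = k ^ card S"
    using j S by (metis card_gt_0_iff empty_iff power_eq_if not_gr_zero)
  ultimately have "int (k ^ card S) \<le> int (k * card ?W)" by (simp only: of_nat_le_iff)
  then show ?thesis unfolding walk_gram_card[OF S(1)] by simp
qed

text \<open>If w and w' are both walks, the tails composed with either successor map give the heads.
  So the tails form a colouring fixed by the permutation, and they determine the heads. The square
  counts pairs of such colourings, which are colourings with k * k colours.\<close>

lemma walk_gram_le_fixed_maps:
  assumes S: "finite S" "0 \<notin> S" and k: "k \<ge> 1" and w: "w \<in> orderings S" "w' \<in> orderings S"
  shows "walk_gram k S w w' ^ 2 \<le> int (card (fixed_maps (insert 0 S) ({..<k} \<times> {..<k}) (successor w \<circ> Hilbert_Choice.inv (successor w'))))"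
proof -
  let ?\<rho> = "successor w \<circ> Hilbert_Choice.inv (successor w')"
  have d: "distinct (0 # w)" "distinct (0 # w')" and wS: "set w = S" "set w' = S" using w S by (auto simp: orderings_def)
  let ?W = "{c \<in> edges k S. walk (fst c) (snd c) 0 w 0 \<and> walk (fst c) (snd c) 0 w' 0}"
  let ?F = "fixed_maps (insert 0 S) {..<k} ?\<rho>"
  let ?F2 = "fixed_maps (insert 0 S) ({..<k} \<times> {..<k}) ?\<rho>"
  let ?f = "\<lambda>c. restrict ((fst c)(0 := 0)) (insert 0 S)"
  note p = successor_permutes[OF d(1), unfolded wS] successor_permutes[OF d(2), unfolded wS]
  have \<rho>S: "?\<rho> x \<in> insert 0 S" if "x \<in> insert 0 S" for x
    using permutes_in_image[OF permutes_compose[OF permutes_inv[OF p(2)] p(1)], of x] that by auto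
  have "?f ` ?W \<subseteq> ?F"
  proof
    fix A assume "A \<in> ?f ` ?W"
    then obtain c where c: "c \<in> ?W" "A = ?f c" by auto
    have 1: "((snd c)(0 := 0)) j = ((fst c)(0 := 0)) (successor w j)" if "j \<in> insert 0 S" for j
      using iffD1[OF walk_iff_successor[OF d(1)], unfolded wS, of "fst c" "snd c"] c(1) that by blast
    have 2: "((snd c)(0 := 0)) j = ((fst c)(0 := 0)) (successor w' j)" if "j \<in> insert 0 S" for j
      using iffD1[OF walk_iff_successor[OF d(2)], unfolded wS, of "fst c" "snd c"] c(1) that by blast
    have "((fst c)(0 := 0)) (?\<rho> x) = ((fst c)(0 := 0)) x" if x: "x \<in> insert 0 S" for x
    proof -
      let ?j = "Hilbert_Choice.inv (successor w') x"
      have j: "?j \<in> insert 0 S" using permutes_in_image[OF permutes_inv[OF p(2)], of x] x by simp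
      show ?thesis using 1[OF j] 2[OF j] permutes_inverses[OF p(2)] by (simp del: fun_upd_apply)
    qed
    then have "A (?\<rho> x) = A x" if "x \<in> insert 0 S" for x using that \<rho>S[OF that] c(2) by (simp del: fun_upd_apply insert_iff)
    moreover have "A \<in> insert 0 S \<rightarrow>\<^sub>E {..<k}" using c k by (auto simp: edges_def PiE_def Pi_def)
    ultimately show "A \<in> ?F" unfolding fixed_maps_def by blast
  qed
  moreover have "inj_on ?f ?W"
  proof (rule inj_onI)
    fix c c' assume c: "c \<in> ?W" "c' \<in> ?W" and eq: "?f c = ?f c'"
    have A: "((fst c)(0 := 0)) j = ((fst c')(0 := 0)) j" if "j \<in> insert 0 S" for j
      using fun_cong[OF eq, of j] that by (simp del: fun_upd_apply insert_iff)
    have fst: "fst c j = fst c' j" for j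
    proof (cases "j \<in> S")
      case True then show ?thesis using A[of j] S by (auto split: if_splits)
    qed (use c in \<open>auto simp: edges_def PiE_def extensional_def\<close>)
    have snd: "snd c j = snd c' j" for j
    proof (cases "j \<in> S")
      case True
      then have m: "j \<in> insert 0 S" "successor w j \<in> insert 0 S" using permutes_in_image[OF p(1), of j] by auto
      note wk = iffD1[OF walk_iff_successor[OF d(1)], unfolded wS]
      have "((snd c)(0 := 0)) j = ((fst c)(0 := 0)) (successor w j)"
        using wk[of "fst c" "snd c"] c(1) m(1) by blast
      moreover have "((snd c')(0 := 0)) j = ((fst c')(0 := 0)) (successor w j)"
        using wk[of "fst c'" "snd c'"] c(2) m(1) by blast
      ultimately have "((snd c)(0 := 0)) j = ((snd c')(0 := 0)) j" using A[OF m(2)] by (simp only:)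
      then show ?thesis using True S by (auto split: if_splits)
    qed (use c in \<open>auto simp: edges_def PiE_def extensional_def\<close>)
    show "c = c'" using fst snd by (auto simp: prod_eq_iff)
  qed
  ultimately have "card ?W \<le> card ?F" using S by (intro card_inj_on_le finite_fixed_maps) auto
  moreover have "card (?F \<times> ?F) \<le> card ?F2"
  proof (rule card_inj_on_le)
    let ?g = "\<lambda>(A, A'). \<lambda>x\<in>insert 0 S. (A x, A' x)"
    show "inj_on ?g (?F \<times> ?F)"
    proof (rule inj_onI, clarify)
      fix A A' B B' assume F: "A \<in> ?F" "A' \<in> ?F" "B \<in> ?F" "B' \<in> ?F"
        and eq: "(\<lambda>x\<in>insert 0 S. (A x, A' x)) = (\<lambda>x\<in>insert 0 S. (B x, B' x))"
      have "A x = B x \<and> A' x = B' x" for x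
      proof (cases "x \<in> insert 0 S")
        case True then show ?thesis using fun_cong[OF eq, of x] by simp
      next
        case False then show ?thesis using F by (auto simp: fixed_maps_def PiE_def extensional_def)
      qed
      then show "A = B \<and> A' = B'" by auto
    qed
    show "?g ` (?F \<times> ?F) \<subseteq> ?F2" using \<rho>S by (auto simp: fixed_maps_def PiE_def Pi_def)
  qed (use S in \<open>auto intro: finite_fixed_maps\<close>)
  ultimately have "card ?W ^ 2 \<le> card ?F2"
    using mult_mono[of "card ?W" "card ?F" "card ?W" "card ?F"] by (simp add: card_cartesian_product power2_eq_square)
  then have "int (card ?W ^ 2) \<le> int (card ?F2)" by (simp only: of_nat_le_iff)
  then show ?thesis unfolding walk_gram_card[OF S(1)] by simp
qed

text \<open>The permutations \<open>successor w \<circ> inv (successor w')\<close> are distinct for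
  distinct w', so the sum is at most the one over all permutations of the \<open>card S + 1\<close>
  points of \<open>insert 0 S\<close>.\<close>

lemma sum_walk_gram_le:
  assumes S: "finite S" "0 \<notin> S" and k: "k \<ge> 1" and w: "w \<in> orderings S"
  shows "real_of_int (\<Sum>w'\<in>orderings S. walk_gram k S w w' ^ 2) \<le> fact (card S + 1) * real (card S + 2) ^ (k * k)"
proof -
  let ?Q = "{..<k} \<times> {..<k}" and ?S = "insert 0 S"
  let ?\<rho> = "\<lambda>w'. successor w \<circ> Hilbert_Choice.inv (successor w')"
  have perm: "successor w permutes ?S" if "w \<in> orderings S" for w
    using successor_permutes[of w] that S by (auto simp: orderings_def)
  have "inj_on ?\<rho> (orderings S)"
  proof (rule inj_onI)
    fix u v assume uv: "u \<in> orderings S" "v \<in> orderings S" "?\<rho> u = ?\<rho> v"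
    have "Hilbert_Choice.inv (successor w) \<circ> ?\<rho> u = Hilbert_Choice.inv (successor w) \<circ> ?\<rho> v" using uv by simp
    then have "Hilbert_Choice.inv (successor u) = Hilbert_Choice.inv (successor v)"
      using permutes_inv_o(2)[OF perm[OF w]] by (simp flip: o_assoc add: comp_assoc[symmetric])
    then have "successor u = successor v" using perm uv by (metis permutes_inv_inv)
    then show "u = v" using successor_inj[of u v] uv S by (auto simp: orderings_def)
  qed
  then have "(\<Sum>w'\<in>orderings S. card (fixed_maps ?S ?Q (?\<rho> w'))) = (\<Sum>\<rho>\<in>?\<rho> ` orderings S. card (fixed_maps ?S ?Q \<rho>))"
    by (simp add: sum.reindex)
  also have "\<dots> \<le> (\<Sum>\<rho> | \<rho> permutes ?S. card (fixed_maps ?S ?Q \<rho>))"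
    using perm w S by (intro sum_mono2) (auto intro!: finite_permutations permutes_compose permutes_inv)
  finally have "real (\<Sum>w'\<in>orderings S. card (fixed_maps ?S ?Q (?\<rho> w')))
      \<le> real (\<Sum>\<rho> | \<rho> permutes ?S. card (fixed_maps ?S ?Q \<rho>))" by (simp only: of_nat_le_iff)
  also have "\<dots> \<le> fact (card ?S) * real (card ?S + 1) ^ card ?Q"
    by (rule sum_fixed_maps_le) (use S in auto)
  finally have "real (\<Sum>w'\<in>orderings S. card (fixed_maps ?S ?Q (?\<rho> w')))
      \<le> fact (card ?S) * real (card ?S + 1) ^ card ?Q" .
  moreover have "(\<Sum>w'\<in>orderings S. walk_gram k S w w' ^ 2) \<le> (\<Sum>w'\<in>orderings S. int (card (fixed_maps ?S ?Q (?\<rho> w'))))"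
    by (intro sum_mono walk_gram_le_fixed_maps S k w)
  then have "real_of_int (\<Sum>w'\<in>orderings S. walk_gram k S w w' ^ 2)
      \<le> real_of_int (\<Sum>w'\<in>orderings S. int (card (fixed_maps ?S ?Q (?\<rho> w'))))"
    by (simp only: of_int_le_iff)
  moreover have "real_of_int (\<Sum>w'\<in>orderings S. int (card (fixed_maps ?S ?Q (?\<rho> w'))))
      = real (\<Sum>w'\<in>orderings S. card (fixed_maps ?S ?Q (?\<rho> w')))"
    by (simp only: of_int_sum of_int_of_nat_eq of_nat_sum)
  ultimately show ?thesis using S by (simp add: add.commute)
qed

text \<open>The Gram matrix of product rows is the product of those of the blocks, so its trace and
  its sum of squares factor over T. The number f of all rows enters both sides of
  \<open>exists_independent_rows\<close> squared and cancels.\<close>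

lemma exists_independent_block_rows:
  fixes k :: "'e \<Rightarrow> nat" and S :: "'e \<Rightarrow> nat set"
  assumes T: "finite T" and S: "\<And>e. e \<in> T \<Longrightarrow> finite (S e)" "\<And>e. e \<in> T \<Longrightarrow> 0 \<notin> S e"
    and k: "\<And>e. e \<in> T \<Longrightarrow> k e \<ge> 1" and n: "\<And>e. e \<in> T \<Longrightarrow> card (S e) \<le> n"
  shows "\<exists>B\<subseteq>PiE T (\<lambda>e. orderings (S e)).
    indep_rows TYPE('f::field_char_0) (\<lambda>w c. \<Prod>e\<in>T. walk_inc (w e) (c e)) B (PiE T (\<lambda>e. edges (k e) (S e))) \<and>
    (\<Prod>e\<in>T. real (k e) ^ (2 * card (S e))) \<le> card B * (\<Prod>e\<in>T. (real (k e))\<^sup>2 * real (n + 2) ^ (k e * k e + 1))"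
proof -
  let ?I = "PiE T (\<lambda>e. orderings (S e))" and ?C = "PiE T (\<lambda>e. edges (k e) (S e))"
  let ?v = "\<lambda>w c. \<Prod>e\<in>T. walk_inc (w e) (c e)"
  have fin: "finite ?I" "finite ?C" using T S by (auto intro!: finite_PiE finite_orderings finite_edges)
  obtain B where B: "B \<subseteq> ?I" "indep_rows TYPE('f) ?v B ?C" and
    le: "(real_of_int (\<Sum>w\<in>?I. \<Sum>c\<in>?C. ?v w c * ?v w c))\<^sup>2
      \<le> card B * real_of_int (\<Sum>w\<in>?I. \<Sum>w'\<in>?I. (\<Sum>c\<in>?C. ?v w c * ?v w' c)\<^sup>2)"
    using exists_independent_rows[OF fin(2,1), where v = ?v and 'f = 'f] by blast
  have gram: "(\<Sum>c\<in>?C. ?v w c * ?v w' c) = (\<Prod>e\<in>T. walk_gram (k e) (S e) (w e) (w' e))" for w w'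
    unfolding walk_gram_def using T S by (subst prod_sum_PiE) (auto simp: prod.distrib finite_edges)
  define f where "f = (\<Prod>e\<in>T. fact (card (S e)) :: real)"
  define K where "K = (\<Prod>e\<in>T. real (k e) ^ card (S e))"
  define \<kappa> where "\<kappa> = (\<Prod>e\<in>T. real (k e))"
  define Z where "Z e = (fact (card (S e) + 1) * real (card (S e) + 2) ^ (k e * k e) :: real)" for e
  define P where "P = (\<Prod>e\<in>T. real (n + 2) ^ (k e * k e + 1))"
  have f0: "f > 0" unfolding f_def by (intro prod_pos) auto
  have \<kappa>0: "\<kappa> > 0" unfolding \<kappa>_def using k by (intro prod_pos) (auto simp: Suc_le_eq)
  have K0: "K \<ge> 0" unfolding K_def by (intro prod_nonneg) auto
  have D1: "f * K \<le> \<kappa> * real_of_int (\<Sum>w\<in>?I. \<Prod>e\<in>T. walk_gram (k e) (S e) (w e) (w e))"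
  proof -
    have "f * K = (\<Prod>e\<in>T. real (card (orderings (S e))) * real (k e) ^ card (S e))"
      unfolding f_def K_def prod.distrib[symmetric] by (rule prod.cong) (use S in \<open>auto simp: card_orderings\<close>)
    also have "\<dots> \<le> (\<Prod>e\<in>T. real (k e) * real_of_int (\<Sum>w\<in>orderings (S e). walk_gram (k e) (S e) w w))"
    proof (rule prod_mono)
      fix e assume e: "e \<in> T"
      have "(\<Sum>w\<in>orderings (S e). int (k e) ^ card (S e)) \<le> (\<Sum>w\<in>orderings (S e). k e * walk_gram (k e) (S e) w w)"
        by (intro sum_mono walk_gram_self S k e)
      then have "real_of_int (\<Sum>w\<in>orderings (S e). int (k e) ^ card (S e))
        \<le> real_of_int (k e * (\<Sum>w\<in>orderings (S e). walk_gram (k e) (S e) w w))"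
        by (simp only: of_int_le_iff sum_distrib_left)
      then show "0 \<le> real (card (orderings (S e))) * real (k e) ^ card (S e) \<and>
        real (card (orderings (S e))) * real (k e) ^ card (S e)
          \<le> real (k e) * real_of_int (\<Sum>w\<in>orderings (S e). walk_gram (k e) (S e) w w)" by simp
    qed
    also have "\<dots> = \<kappa> * real_of_int (\<Prod>e\<in>T. \<Sum>w\<in>orderings (S e). walk_gram (k e) (S e) w w)"
      by (simp add: \<kappa>_def prod.distrib)
    also have "(\<Prod>e\<in>T. \<Sum>w\<in>orderings (S e). walk_gram (k e) (S e) w w) = (\<Sum>w\<in>?I. \<Prod>e\<in>T. walk_gram (k e) (S e) (w e) (w e))"
      using T S by (intro prod_sum_PiE) (auto simp: finite_orderings)
    finally show ?thesis .
  qed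
  have D2: "real_of_int (\<Sum>w\<in>?I. \<Sum>w'\<in>?I. (\<Prod>e\<in>T. walk_gram (k e) (S e) (w e) (w' e))\<^sup>2) \<le> f * (\<Prod>e\<in>T. Z e)"
  proof -
    have "real_of_int (\<Sum>w'\<in>?I. (\<Prod>e\<in>T. walk_gram (k e) (S e) (w e) (w' e))\<^sup>2) \<le> (\<Prod>e\<in>T. Z e)" if w: "w \<in> ?I" for w
    proof -
      have "(\<Sum>w'\<in>?I. (\<Prod>e\<in>T. walk_gram (k e) (S e) (w e) (w' e))\<^sup>2)
        = (\<Prod>e\<in>T. \<Sum>w'\<in>orderings (S e). (walk_gram (k e) (S e) (w e) w')\<^sup>2)"
        unfolding prod_power_distrib using T S by (intro prod_sum_PiE[symmetric]) (auto simp: finite_orderings)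
      then have "real_of_int (\<Sum>w'\<in>?I. (\<Prod>e\<in>T. walk_gram (k e) (S e) (w e) (w' e))\<^sup>2)
        = (\<Prod>e\<in>T. real_of_int (\<Sum>w'\<in>orderings (S e). (walk_gram (k e) (S e) (w e) w')\<^sup>2))" by (simp only: of_int_prod)
      also have "\<dots> \<le> (\<Prod>e\<in>T. Z e)"
        unfolding Z_def by (intro prod_mono conjI sum_walk_gram_le S k) (use w in \<open>auto intro!: sum_nonneg\<close>)
      finally show ?thesis .
    qed
    then have "real_of_int (\<Sum>w\<in>?I. \<Sum>w'\<in>?I. (\<Prod>e\<in>T. walk_gram (k e) (S e) (w e) (w' e))\<^sup>2) \<le> (\<Sum>w\<in>?I. (\<Prod>e\<in>T. Z e))"
      unfolding of_int_sum[of _ ?I] by (intro sum_mono) simp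
    also have "\<dots> = real (card ?I) * (\<Prod>e\<in>T. Z e)" by simp
    also have "real (card ?I) = f" unfolding f_def using T S by (simp add: card_PiE card_orderings)
    finally show ?thesis .
  qed
  \<comment> \<open>The quotient of \<open>fact (card (S e) + 1)\<close> and
    \<open>fact (card (S e))\<close> is at most n + 2 and accounts for the 1 in the exponent
    \<open>k e * k e + 1\<close>.\<close>
  have ZP: "(\<Prod>e\<in>T. Z e) \<le> f * P"
    unfolding f_def P_def prod.distrib[symmetric]
  proof (rule prod_mono)
    fix e assume e: "e \<in> T"
    have "real (card (S e) + 1) * real (card (S e) + 2) ^ (k e * k e) \<le> real (n + 2) * real (n + 2) ^ (k e * k e)"
      by (intro mult_mono power_mono) (use n[OF e] in auto)
    then have "fact (card (S e)) * (real (card (S e) + 1) * real (card (S e) + 2) ^ (k e * k e))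
      \<le> fact (card (S e)) * (real (n + 2) * real (n + 2) ^ (k e * k e))" by (intro mult_left_mono) auto
    then show "0 \<le> Z e \<and> Z e \<le> fact (card (S e)) * real (n + 2) ^ (k e * k e + 1)"
      by (simp add: Z_def algebra_simps)
  qed
  have le': "(real_of_int (\<Sum>w\<in>?I. \<Prod>e\<in>T. walk_gram (k e) (S e) (w e) (w e)))\<^sup>2
      \<le> card B * real_of_int (\<Sum>w\<in>?I. \<Sum>w'\<in>?I. (\<Prod>e\<in>T. walk_gram (k e) (S e) (w e) (w' e))\<^sup>2)"
    using le unfolding gram .
  have "(f * K)\<^sup>2 \<le> (\<kappa> * real_of_int (\<Sum>w\<in>?I. \<Prod>e\<in>T. walk_gram (k e) (S e) (w e) (w e)))\<^sup>2"
    by (rule power_mono[OF D1]) (use f0 K0 in auto)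
  also have "\<dots> \<le> \<kappa>\<^sup>2 * (card B * (f * (\<Prod>e\<in>T. Z e)))"
    unfolding power_mult_distrib by (intro mult_left_mono order.trans[OF le'] D2) auto
  also have "\<dots> \<le> \<kappa>\<^sup>2 * (card B * (f * (f * P)))"
    by (intro mult_left_mono ZP) (use f0 in auto)
  finally have "f\<^sup>2 * K\<^sup>2 \<le> f\<^sup>2 * (card B * (\<kappa>\<^sup>2 * P))" by (simp add: power_mult_distrib power2_eq_square ac_simps)
  then have "K\<^sup>2 \<le> card B * (\<kappa>\<^sup>2 * P)" using f0 by simp
  moreover have "K\<^sup>2 = (\<Prod>e\<in>T. real (k e) ^ (2 * card (S e)))"
    unfolding K_def prod_power_distrib by (rule prod.cong) (auto simp: power_mult[symmetric] mult.commute)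
  moreover have "\<kappa>\<^sup>2 * P = (\<Prod>e\<in>T. (real (k e))\<^sup>2 * real (n + 2) ^ (k e * k e + 1))"
    unfolding \<kappa>_def P_def prod_power_distrib prod.distrib[symmetric] ..
  ultimately show ?thesis using B by (intro exI[of _ B]) auto
qed

section \<open>Multilinear functions on the algebra\<close>

text \<open>Gaussian elimination: a pivot j removes the equation x together with the unknown
  j.\<close>

lemma nontrivial_relation:
  fixes f :: "'i \<Rightarrow> 'x \<Rightarrow> 'k::field"
  assumes "finite Z" "finite I" "card Z < card I"
  shows "\<exists>c. (\<exists>i\<in>I. c i \<noteq> 0) \<and> (\<forall>x\<in>Z. (\<Sum>i\<in>I. c i * f i x) = 0)"
  using assms
proof (induction Z arbitrary: I f rule: finite_induct)
  case empty
  then obtain i where "i \<in> I" by fastforce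
  then show ?case by (intro exI[of _ "\<lambda>_. 1"]) auto
next
  case (insert x Z)
  show ?case
  proof (cases "\<forall>i\<in>I. f i x = 0")
    case True
    have "card Z < card I" using insert by simp
    then obtain c where "\<exists>i\<in>I. c i \<noteq> 0" "\<forall>x\<in>Z. (\<Sum>i\<in>I. c i * f i x) = 0"
      using insert.IH[of I f] insert.prems(1) by blast
    then show ?thesis using True by (intro exI[of _ c]) auto
  next
    case False
    then obtain j where j: "j \<in> I" "f j x \<noteq> 0" by auto
    define f' where "f' i y = f i y - f i x / f j x * f j y" for i y
    have "card Z < card (I - {j})" using insert j by simp
    then obtain c where c: "\<exists>i\<in>I - {j}. c i \<noteq> 0" "\<forall>y\<in>Z. (\<Sum>i\<in>I - {j}. c i * f' i y) = 0"
      using insert.IH[of "I - {j}" f'] insert.prems(1) by blast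
    define c' where "c' = c(j := - (\<Sum>i\<in>I - {j}. c i * f i x) / f j x)"
    have sum: "(\<Sum>i\<in>I. c' i * f i y) = (\<Sum>i\<in>I - {j}. c i * f' i y)" for y
    proof -
      have "(\<Sum>i\<in>I. c' i * f i y) = c' j * f j y + (\<Sum>i\<in>I - {j}. c' i * f i y)"
        using j insert by (simp add: sum.remove)
      also have "(\<Sum>i\<in>I - {j}. c' i * f i y) = (\<Sum>i\<in>I - {j}. c i * f i y)"
        by (rule sum.cong) (auto simp: c'_def)
      also have "c' j * f j y = - (\<Sum>i\<in>I - {j}. c i * (f i x / f j x * f j y))"
      proof -
        have "c' j * f j y = - ((\<Sum>i\<in>I - {j}. c i * f i x) * (f j y / f j x))" by (simp add: c'_def)
        also have "\<dots> = - (\<Sum>i\<in>I - {j}. c i * (f i x / f j x * f j y))"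
          unfolding sum_distrib_right by (intro arg_cong[of _ _ uminus] sum.cong) auto
        finally show ?thesis .
      qed
      finally show ?thesis by (simp add: f'_def right_diff_distrib sum_subtractf)
    qed
    have "(\<Sum>i\<in>I - {j}. c i * f' i x) = 0" using j by (simp add: f'_def)
    then have "\<forall>y\<in>insert x Z. (\<Sum>i\<in>I. c' i * f i y) = 0" using c sum by auto
    moreover have "\<exists>i\<in>I. c' i \<noteq> 0" using c(1) by (auto simp: c'_def)
    ultimately show ?thesis by blast
  qed
qed

context fd_algebra begin

definition multilinear :: "nat \<Rightarrow> ((nat \<Rightarrow> 'v) \<Rightarrow> 'v) \<Rightarrow> bool" where
  "multilinear n g \<longleftrightarrow> (\<forall>i\<in>{1..n}. \<forall>\<psi> c x y. g (\<psi>(i := c *s x + y)) = c *s g (\<psi>(i := x)) + g (\<psi>(i := y)))"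

lemma multilinear_vanish:
  assumes g: "multilinear n g" and \<Gamma>: "\<And>\<psi>. (\<And>i. i \<in> {1..n} \<Longrightarrow> \<psi> i \<in> \<Gamma>) \<Longrightarrow> g \<psi> = 0"
    and \<psi>: "\<And>i. i \<in> {1..n} \<Longrightarrow> \<psi> i \<in> span \<Gamma>"
  shows "g \<psi> = 0"
proof -
  have "g \<psi> = 0" if "m \<le> n" "\<And>i. i \<in> {1..n} \<Longrightarrow> \<psi> i \<in> (if i \<le> m then span \<Gamma> else \<Gamma>)" for m \<psi>
    using that
  proof (induction m arbitrary: \<psi>)
    case 0
    show ?case by (rule \<Gamma>) (use 0(2) in force)
  next
    case (Suc m)
    have lin: "g (\<psi>(Suc m := c *s x + y)) = c *s g (\<psi>(Suc m := x)) + g (\<psi>(Suc m := y))" for c x y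
      using g Suc.prems(1) by (simp add: multilinear_def)
    have "g (\<psi>(Suc m := x)) = 0" if "x \<in> span \<Gamma>" for x
      using that
    proof (induction rule: span_induct_alt)
      case base
      have "g (\<psi>(Suc m := 0)) = 0" using lin[of 1 0 0] by simp
      then show ?case by (simp add: fun_upd_def)
    next
      case (step c x y)
      have "g (\<psi>(Suc m := x)) = 0"
      proof (rule Suc.IH)
        fix i assume "i \<in> {1..n}"
        then show "(\<psi>(Suc m := x)) i \<in> (if i \<le> m then span \<Gamma> else \<Gamma>)"
          using Suc.prems(2)[of i] step(1) by (auto simp: le_Suc_eq split: if_splits)
      qed (use Suc.prems(1) in simp)
      then show ?case using step(2) lin[of c x y] by (simp add: fun_upd_def)
    qed
    from this[of "\<psi> (Suc m)"] show ?case using Suc.prems(2)[of "Suc m"] Suc.prems(1) by simp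
  qed
  from this[of n] show ?thesis using \<psi> by auto
qed

fun prodl :: "'v list \<Rightarrow> 'v" where
  "prodl [] = 0" | "prodl [x] = x" | "prodl (x # y # zs) = x \<star> prodl (y # zs)"

lemma prodl_append_single: "prodl (xs @ [z]) = foldr (\<star>) xs z"
  by (induction xs rule: prodl.induct) auto

lemma prodl_Cons: "xs \<noteq> [] \<Longrightarrow> prodl (x # xs) = x \<star> prodl xs"
  by (cases xs) auto

lemma prodl_linear:
  assumes "\<And>c x y. f (c *s x + y) = c *s f x + f y"
  shows "prodl (xs @ f (c *s x + y) # ys) = c *s prodl (xs @ f x # ys) + prodl (xs @ f y # ys)"
proof (induction xs)
  case Nil
  show ?case by (cases ys) (auto simp: assms mul_distribs)
next
  case (Cons a xs)
  then show ?case by (simp add: prodl_Cons mul_distribs)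
qed

lemma multilinear_monomial:
  assumes L: "distinct L" "set L = {1..n}" and f: "\<And>i c x y. f i (c *s x + y) = c *s f i x + f i y"
  shows "multilinear n (\<lambda>\<psi>. prodl (map (\<lambda>i. f i (\<psi> i)) L))"
  unfolding multilinear_def
proof (intro ballI allI)
  fix i \<psi> c x y assume "i \<in> {1..n}"
  then obtain xs ys where L': "L = xs @ i # ys" "i \<notin> set xs" "i \<notin> set ys"
    using L by (metis distinct.simps(2) distinct_append disjoint_iff list.set_intros(1) split_list)
  have "map (\<lambda>j. f j ((\<psi>(i := z)) j)) L = map (\<lambda>j. f j (\<psi> j)) xs @ f i z # map (\<lambda>j. f j (\<psi> j)) ys" for z
    using L' by auto
  then show "prodl (map (\<lambda>j. f j ((\<psi>(i := c *s x + y)) j)) L) =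
      c *s prodl (map (\<lambda>j. f j ((\<psi>(i := x)) j)) L) + prodl (map (\<lambda>j. f j ((\<psi>(i := y)) j)) L)"
    using prodl_linear[of "f i", OF f] by simp
qed

lemma multilinear_sum:
  "(\<And>i. i \<in> I \<Longrightarrow> multilinear n (g i)) \<Longrightarrow> multilinear n (\<lambda>\<psi>. \<Sum>i\<in>I. c i *s g i \<psi>)"
  by (simp add: multilinear_def sum.distrib scale_sum_right scale_right_distrib mult.commute)

section \<open>Admissible sets of blocks and the exponent\<close>

definition adm :: "'v set \<Rightarrow> bool" where
  "adm S \<longleftrightarrow> S \<subseteq> Es \<and> (\<exists>es. distinct es \<and> set es = S \<and> ideal_chain es \<noteq> {0})"

definition expo :: nat where "expo = Max ((\<lambda>S. \<Sum>e\<in>S. (block_size e)\<^sup>2) ` {S. adm S})"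

lemma finite_adm: "finite {S. adm S}"
  by (rule finite_subset[of _ "Pow Es"]) (auto simp: adm_def finite_Es)

lemma adm_expo: "adm S \<Longrightarrow> (\<Sum>e\<in>S. (block_size e)\<^sup>2) \<le> expo"
  unfolding expo_def by (intro Max_ge) (auto simp: finite_adm)

text \<open>Doubling the idempotent shows that I_e is contained in I_e A; the trailing
  \<open>UNIV\<close> of \<open>ideal_chain\<close> therefore loses no elements.\<close>

lemma block_ideal_ideal_chain: assumes e: "idem e" and x: "x \<in> block_ideal e" shows "x \<in> ideal_chain [e]"
proof -
  have "block_ideal e \<subseteq> ideal_chain [e]" unfolding block_ideal_def
  proof (rule span_minimal[OF _ subspace_ideal_chain])
    show "{a \<star> (e \<star> b) | a b. True} \<subseteq> ideal_chain [e]"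
    proof clarify
      fix a b
      have "a \<star> (e \<star> b) = (a \<star> (e \<star> e)) \<star> b" using e by (simp add: idem_simps)
      then show "a \<star> (e \<star> b) \<in> ideal_chain [e]" unfolding ideal_chain.simps
        by (intro span_base CollectI exI[of _ "a \<star> (e \<star> e)"] exI[of _ b]) (auto intro: block_ideal_base)
    qed
  qed
  then show ?thesis using x by auto
qed

lemma adm_single: assumes e: "e \<in> Es" shows "adm {e}"
proof -
  have "e \<in> ideal_chain [e]" using idem_simps[OF idem_Es[OF e]] block_ideal_base[of e e e]
    by (intro block_ideal_ideal_chain idem_Es e) simp
  then show ?thesis using e idem_simps(3)[OF idem_Es[OF e]] unfolding adm_def
    by (intro conjI exI[of _ "[e]"]) auto
qed

lemma expo_attained:
  assumes "Es \<noteq> {}"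
  obtains es where "distinct es" "set es \<subseteq> Es" "ideal_chain es \<noteq> {0}" "(\<Sum>e\<in>set es. (block_size e)\<^sup>2) = expo"
proof -
  have "{S. adm S} \<noteq> {}" using assms adm_single by blast
  then have "expo \<in> (\<lambda>S. \<Sum>e\<in>S. (block_size e)\<^sup>2) ` {S. adm S}" unfolding expo_def using finite_adm by (intro Max_in) auto
  then obtain S where S: "adm S" "(\<Sum>e\<in>S. (block_size e)\<^sup>2) = expo" by auto
  then obtain es where "distinct es" "set es = S" "ideal_chain es \<noteq> {0}" by (auto simp: adm_def)
  then show thesis using S that[of es] by (simp add: adm_def)
qed

lemma expo_pos: assumes "Es \<noteq> {}" shows "expo \<ge> 1"
proof -
  obtain e where e: "e \<in> Es" using assms by auto
  have "1 \<le> (block_size e)\<^sup>2" using dual_basis(1)[OF prim_Es[OF e]] by simp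
  then show ?thesis using adm_expo[OF adm_single[OF e]] by simp
qed

text \<open>A label stands for a basis element of a block or for a generator of \<open>J \<inter> V\<close>.\<close>

type_synonym 'w label = "('w \<times> nat \<times> nat) + 'w"

definition label_value :: "'v label \<Rightarrow> 'v" where
  "label_value l = (case l of Inl (e, p, q) \<Rightarrow> block_unit e p q | Inr x \<Rightarrow> x)"

definition radical_gens :: "'v set" where "radical_gens = (SOME B. finite B \<and> B \<subseteq> J \<inter> V \<and> J \<inter> V \<subseteq> span B)"

lemma radical_gens: "finite radical_gens" "radical_gens \<subseteq> J \<inter> V" "J \<inter> V \<subseteq> span radical_gens"
proof -
  obtain BV where BV: "finite BV" "V \<subseteq> span BV" using finite_dim_V by auto
  obtain B where B: "B \<subseteq> J \<inter> V" "independent B" "J \<inter> V \<subseteq> span B" by (rule maximal_independent_subset)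
  then have "finite B" using finite_independent(1)[OF BV(1) _ B(2)] BV(2) by auto
  then have "\<exists>B. finite B \<and> B \<subseteq> J \<inter> V \<and> J \<inter> V \<subseteq> span B" using B by auto
  from someI_ex[OF this] show "finite radical_gens" "radical_gens \<subseteq> J \<inter> V" "J \<inter> V \<subseteq> span radical_gens" by (auto simp: radical_gens_def)
qed

definition labels :: "'v set \<Rightarrow> 'v label set" where
  "labels S = Inl ` (SIGMA e:S. {..<block_size e} \<times> {..<block_size e}) \<union> Inr ` radical_gens"

lemma finite_labels: "S \<subseteq> Es \<Longrightarrow> finite (labels S)"
  unfolding labels_def using radical_gens(1) finite_Es by (auto intro!: finite_imageI finite_SigmaI intro: finite_subset)

lemma V_span_labels: "V \<subseteq> span (label_value ` labels Es)"
proof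
  fix x assume x: "x \<in> V"
  let ?s = "\<Sum>e\<in>Es. \<Sum>p<block_size e. \<Sum>q<block_size e. lam e (row_vec e p \<star> (x \<star> col_vec e q)) *s block_unit e p q"
  have "?s \<in> V" by (intro subspace_sum subspace_scale subspace_V) (simp add: block_unit_def)
  then have "x - ?s \<in> J \<inter> V" using decomposition[of x] subspace_diff[OF subspace_V x] by auto
  then have "x - ?s \<in> span radical_gens" using radical_gens by auto
  moreover have "radical_gens \<subseteq> label_value ` labels Es" by (force simp: labels_def label_value_def image_iff)
  ultimately have "x - ?s \<in> span (label_value ` labels Es)" using span_mono by blast
  moreover have "?s \<in> span (label_value ` labels Es)"
  proof (intro span_sum span_scale span_base)
    fix e p q assume "e \<in> Es" "p \<in> {..<block_size e}" "q \<in> {..<block_size e}"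
    then show "block_unit e p q \<in> label_value ` labels Es"
      by (intro image_eqI[of _ _ "Inl (e, p, q)"]) (auto simp: labels_def label_value_def)
  qed
  ultimately have "(x - ?s) + ?s \<in> span (label_value ` labels Es)" by (rule span_add)
  then show "x \<in> span (label_value ` labels Es)" by simp
qed

definition blocks :: "'v label list \<Rightarrow> 'v list" where
  "blocks ls = concat (map (\<lambda>l. case l of Inl (e, p, q) \<Rightarrow> [e] | Inr x \<Rightarrow> []) ls)"

definition Jcount :: "'v label list \<Rightarrow> nat" where "Jcount ls = length (filter (\<lambda>l. \<not> isl l) ls)"

text \<open>Factors are multiplied from the left onto the product of the rest. A block that occurs
  again further right is absorbed, as \<open>ideal_chain\<close> is closed under left
  multiplication; this matches \<open>remdups\<close>, which keeps last occurrences.\<close>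

lemma prodl_labels:
  assumes "xs \<noteq> []" "\<And>i. i \<in> set xs \<Longrightarrow> t i \<in> labels Es"
    "\<And>i e p q. i \<in> set xs \<Longrightarrow> t i = Inl (e, p, q) \<Longrightarrow> c i \<in> block_ideal e"
    "\<And>i x. i \<in> set xs \<Longrightarrow> t i = Inr x \<Longrightarrow> c i \<in> J"
  shows "prodl (map c xs) \<in> ideal_chain (remdups (blocks (map t xs))) \<and> prodl (map c xs) \<in> J_power (Jcount (map t xs))"
  using assms
proof (induction xs)
  case (Cons i xs)
  show ?case
  proof (cases "xs = []")
    case True
    show ?thesis
    proof (cases "t i")
      case (Inl l)
      obtain e p q where l: "l = (e, p, q)" by (cases l)
      then have "c i \<in> block_ideal e" "idem e" using Cons.prems(2,3)[of i] Inl by (auto simp: labels_def idem_Es)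
      then show ?thesis using block_ideal_ideal_chain[of e "c i"] Inl True l by (simp add: blocks_def Jcount_def)
    next
      case (Inr x)
      then show ?thesis using Cons.prems(4)[of i] True by (simp add: blocks_def Jcount_def)
    qed
  next
    case False
    then have IH: "prodl (map c xs) \<in> ideal_chain (remdups (blocks (map t xs)))" "prodl (map c xs) \<in> J_power (Jcount (map t xs))"
      using Cons by auto
    have p: "prodl (map c (i # xs)) = c i \<star> prodl (map c xs)" using False by (simp add: prodl_Cons)
    show ?thesis
    proof (cases "t i")
      case (Inl l)
      obtain e p' q where l: "l = (e, p', q)" by (cases l)
      then have "c i \<in> block_ideal e" using Cons.prems(3)[of i] Inl by auto
      then have "c i \<star> prodl (map c xs) \<in> ideal_chain (remdups (e # blocks (map t xs)))"
        using IH(1) ideal_chain_left by (auto intro!: span_base)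
      moreover have "c i \<star> prodl (map c xs) \<in> J_power (0 + Jcount (map t xs))" by (rule J_power_mult[OF IH(2)]) simp
      ultimately show ?thesis unfolding p using Inl l by (simp add: blocks_def Jcount_def)
    next
      case (Inr x)
      then have "c i \<star> prodl (map c xs) \<in> J_power (Suc 0 + Jcount (map t xs))"
        by (intro J_power_mult[OF IH(2)]) (use Cons.prems(4)[of i] in auto)
      moreover have "c i \<star> prodl (map c xs) \<in> ideal_chain (remdups (blocks (map t xs)))" by (rule ideal_chain_left[OF IH(1)])
      ultimately show ?thesis unfolding p using Inr by (simp add: blocks_def Jcount_def)
    qed
  qed
qed simp

section \<open>Functions determined by admissible labelings\<close>

definition block_set :: "nat \<Rightarrow> (nat \<Rightarrow> 'v label) \<Rightarrow> 'v set" where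
  "block_set n t = {e. \<exists>i\<in>{1..n}. \<exists>p q. t i = Inl (e, p, q)}"

definition adm_labelings :: "nat \<Rightarrow> (nat \<Rightarrow> 'v label) set" where
  "adm_labelings n = {t \<in> {1..n} \<rightarrow>\<^sub>E labels Es. adm (block_set n t) \<and> card {i\<in>{1..n}. \<not> isl (t i)} < nil_index}"

text \<open>The space in which the upper bound is counted: it contains the extended differential
  monomials, is closed under linear combinations, and its elements are determined on
  \<open>V\<close> by their values at \<open>adm_labelings\<close>.\<close>

definition adm_functions :: "nat \<Rightarrow> ((nat \<Rightarrow> 'v) \<Rightarrow> 'v) set" where
  "adm_functions n = {g. multilinear n g \<and> (\<forall>\<psi>. (\<forall>i\<in>{1..n}. \<psi> i \<in> V) \<longrightarrow> g \<psi> \<in> V) \<and>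
     (\<forall>\<psi> \<psi>'. (\<forall>i\<in>{1..n}. \<psi> i = \<psi>' i) \<longrightarrow> g \<psi> = g \<psi>') \<and>
     (\<forall>t\<in>{1..n} \<rightarrow>\<^sub>E labels Es. t \<notin> adm_labelings n \<longrightarrow> g (\<lambda>i. label_value (t i)) = 0)}"

lemma adm_functions_V: "g \<in> adm_functions n \<Longrightarrow> \<forall>i\<in>{1..n}. \<psi> i \<in> V \<Longrightarrow> g \<psi> \<in> V"
  unfolding adm_functions_def mem_Collect_eq by (elim conjE) (erule allE, erule mp)

lemma adm_functions_sum: assumes "\<And>i. i \<in> I \<Longrightarrow> g i \<in> adm_functions n" shows "(\<lambda>\<psi>. \<Sum>i\<in>I. c i *s g i \<psi>) \<in> adm_functions n"
  unfolding adm_functions_def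
proof (intro CollectI conjI allI impI ballI)
  show "multilinear n (\<lambda>\<psi>. \<Sum>i\<in>I. c i *s g i \<psi>)" using assms by (intro multilinear_sum) (auto simp: adm_functions_def)
  fix \<psi> :: "nat \<Rightarrow> 'v" assume "\<forall>i\<in>{1..n}. \<psi> i \<in> V"
  then show "(\<Sum>i\<in>I. c i *s g i \<psi>) \<in> V" using assms by (intro subspace_sum subspace_scale subspace_V) (auto simp: adm_functions_def)
next
  fix \<psi> \<psi>' :: "nat \<Rightarrow> 'v" assume "\<forall>i\<in>{1..n}. \<psi> i = \<psi>' i"
  then show "(\<Sum>i\<in>I. c i *s g i \<psi>) = (\<Sum>i\<in>I. c i *s g i \<psi>')"
    by (intro sum.cong refl arg_cong[of _ _ "scale _"]) (use assms in \<open>auto simp: adm_functions_def\<close>)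
qed (use assms in \<open>auto simp: adm_functions_def\<close>)

text \<open>The hypotheses on f are where the invariance under derivations is used. A value at
  labels lies in the product of the ideals of the occurring blocks and in the power of
  \<open>J\<close> given by the number of radical labels; if it is nonzero, both conditions of
  \<open>adm_labelings\<close> hold.\<close>

lemma adm_functions_monomial:
  assumes n: "n \<ge> 1" and L: "distinct L" "set L = {1..n}" and f: "\<And>i c x y. f i (c *s x + y) = c *s f i x + f i y"
    and V: "\<And>i x. x \<in> V \<Longrightarrow> f i x \<in> V" and J: "\<And>i x. x \<in> J \<Longrightarrow> f i x \<in> J"
    and block_ideal: "\<And>i x e. e \<in> Es \<Longrightarrow> x \<in> block_ideal e \<Longrightarrow> f i x \<in> block_ideal e"
  shows "(\<lambda>\<psi>. prodl (map (\<lambda>i. f i (\<psi> i)) L)) \<in> adm_functions n"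
  unfolding adm_functions_def
proof (intro CollectI conjI allI impI ballI)
  show "multilinear n (\<lambda>\<psi>. prodl (map (\<lambda>i. f i (\<psi> i)) L))" by (rule multilinear_monomial[OF L f])
  have ne: "L \<noteq> []" using L n by auto
  fix \<psi> :: "nat \<Rightarrow> 'v" assume \<psi>: "\<forall>i\<in>{1..n}. \<psi> i \<in> V"
  obtain i L' where L': "L = i # L'" using ne by (cases L) auto
  then show "prodl (map (\<lambda>i. f i (\<psi> i)) L) \<in> V" using \<psi> L V by (cases L') auto
next
  fix \<psi> \<psi>' :: "nat \<Rightarrow> 'v" assume "\<forall>i\<in>{1..n}. \<psi> i = \<psi>' i"
  then have "map (\<lambda>i. f i (\<psi> i)) L = map (\<lambda>i. f i (\<psi>' i)) L" using L by auto
  then show "prodl (map (\<lambda>i. f i (\<psi> i)) L) = prodl (map (\<lambda>i. f i (\<psi>' i)) L)" by (simp only:)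
next
  fix t assume t: "t \<in> {1..n} \<rightarrow>\<^sub>E labels Es" and na: "t \<notin> adm_labelings n"
  have ne: "L \<noteq> []" using L n by auto
  have tl: "t i \<in> labels Es" if "i \<in> set L" for i using t that L by auto
  let ?P = "prodl (map (\<lambda>i. f i (label_value (t i))) L)"
  have "?P \<in> ideal_chain (remdups (blocks (map t L))) \<and> ?P \<in> J_power (Jcount (map t L))"
  proof (rule prodl_labels[OF ne tl])
    fix i e p q assume "i \<in> set L" "t i = Inl (e, p, q)"
    then show "f i (label_value (t i)) \<in> block_ideal e" using tl[of i] by (auto simp: labels_def label_value_def intro!: block_ideal block_unit_block_ideal)
  next
    fix i x assume "i \<in> set L" "t i = Inr x"
    then show "f i (label_value (t i)) \<in> J" using tl[of i] radical_gens(2) by (auto simp: labels_def label_value_def intro!: J)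
  qed
  moreover have "set (blocks (map t L)) = block_set n t"
  proof (rule subset_antisym; rule subsetI)
    fix e assume "e \<in> set (blocks (map t L))"
    then obtain i where i: "i \<in> set L" "e \<in> set (case t i of Inl (e, p, q) \<Rightarrow> [e] | Inr x \<Rightarrow> [])"
      unfolding blocks_def by auto
    show "e \<in> block_set n t"
    proof (cases "t i")
      case (Inl l)
      then have "t i = Inl (e, fst (snd l), snd (snd l))" using i by (cases l) auto
      then show ?thesis using i(1) L(2) unfolding block_set_def by blast
    qed (use i in simp)
  next
    fix e assume "e \<in> block_set n t"
    then obtain i p q where "i \<in> set L" "t i = Inl (e, p, q)" using L(2) by (auto simp: block_set_def)
    then show "e \<in> set (blocks (map t L))" unfolding blocks_def by (auto intro!: bexI[of _ i])
  qed
  moreover have "block_set n t \<subseteq> Es"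
  proof
    fix e assume "e \<in> block_set n t"
    then obtain i p q where "i \<in> {1..n}" "t i = Inl (e, p, q)" by (auto simp: block_set_def)
    then show "e \<in> Es" using tl[of i] L by (auto simp: labels_def)
  qed
  moreover have "Jcount (map t L) = card {i\<in>{1..n}. \<not> isl (t i)}"
  proof -
    have "Jcount (map t L) = length (filter (\<lambda>i. \<not> isl (t i)) L)" by (simp add: Jcount_def filter_map o_def)
    also have "\<dots> = card (set (filter (\<lambda>i. \<not> isl (t i)) L))"
      by (rule distinct_card[symmetric]) (use L in simp)
    also have "set (filter (\<lambda>i. \<not> isl (t i)) L) = {i\<in>{1..n}. \<not> isl (t i)}" using L(2) by auto
    finally show ?thesis .
  qed
  ultimately have "adm (block_set n t) \<and> card {i\<in>{1..n}. \<not> isl (t i)} < nil_index" if "?P \<noteq> 0"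
    using that J_power_nil_index[of "Jcount (map t L)"] unfolding adm_def
    by (metis distinct_remdups not_less set_remdups singletonD)
  then show "?P = 0" using na t by (auto simp: adm_labelings_def)
qed

lemma adm_functions_eq_0:
  assumes g: "g \<in> adm_functions n" and 0: "\<And>t. t \<in> adm_labelings n \<Longrightarrow> g (\<lambda>i. label_value (t i)) = 0"
    and \<psi>: "\<And>i. i \<in> {1..n} \<Longrightarrow> \<psi> i \<in> V"
  shows "g \<psi> = 0"
proof (rule multilinear_vanish[of n g "label_value ` labels Es"])
  show "multilinear n g" using g by (simp add: adm_functions_def)
  show "\<psi> i \<in> span (label_value ` labels Es)" if "i \<in> {1..n}" for i using \<psi>[OF that] V_span_labels by auto
  fix \<psi> assume \<psi>: "\<And>i. i \<in> {1..n} \<Longrightarrow> \<psi> i \<in> label_value ` labels Es"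
  have "\<exists>l\<in>labels Es. \<psi> i = label_value l" if "i \<in> {1..n}" for i using \<psi>[OF that] by auto
  then obtain t where t: "\<And>i. i \<in> {1..n} \<Longrightarrow> t i \<in> labels Es \<and> \<psi> i = label_value (t i)" by metis
  let ?t = "restrict t {1..n}"
  have "g \<psi> = g (\<lambda>i. label_value (?t i))" using g t by (auto simp: adm_functions_def)
  also have "\<dots> = 0"
  proof (cases "?t \<in> adm_labelings n")
    case False
    moreover have "?t \<in> {1..n} \<rightarrow>\<^sub>E labels Es" using t by auto
    ultimately show ?thesis using g unfolding adm_functions_def by blast
  qed (rule 0)
  finally show "g \<psi> = 0" .
qed

lemma finite_adm_labelings: "finite (adm_labelings n)"
  by (rule finite_subset[of _ "{1..n} \<rightarrow>\<^sub>E labels Es"]) (auto simp: adm_labelings_def intro!: finite_PiE finite_labels)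

text \<open>A function has \<open>dim V\<close> coordinates at each admissible labeling, and any
  larger number of functions satisfies a relation.\<close>

lemma adm_functions_dependent:
  assumes I: "finite I" and g: "\<And>i. i \<in> I \<Longrightarrow> g i \<in> adm_functions n" and card: "card (adm_labelings n) * dim V < card I"
  shows "\<exists>c. (\<exists>i\<in>I. c i \<noteq> 0) \<and> (\<forall>\<psi>. (\<forall>i\<in>{1..n}. \<psi> i \<in> V) \<longrightarrow> (\<Sum>i\<in>I. c i *s g i \<psi>) = 0)"
proof -
  obtain BV where BV: "BV \<subseteq> V" "independent BV" "V \<subseteq> span BV" "card BV = dim V" by (rule basis_exists)
  obtain B where B: "finite B" "V \<subseteq> span B" using finite_dim_V by auto
  have fBV: "finite BV" using finite_independent(1)[OF B(1) _ BV(2)] BV B by auto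
  let ?X = "adm_labelings n \<times> BV"
  have "\<exists>c. (\<exists>i\<in>I. c i \<noteq> 0) \<and> (\<forall>x\<in>?X. (\<Sum>i\<in>I. c i * representation BV (g i (\<lambda>j. label_value (fst x j))) (snd x)) = 0)"
    by (rule nontrivial_relation) (use I card BV fBV finite_adm_labelings in \<open>auto simp: card_cartesian_product\<close>)
  then obtain c where c: "\<exists>i\<in>I. c i \<noteq> 0"
    "\<And>t b. t \<in> adm_labelings n \<Longrightarrow> b \<in> BV \<Longrightarrow> (\<Sum>i\<in>I. c i * representation BV (g i (\<lambda>j. label_value (t j))) b) = 0" by auto
  have "(\<Sum>i\<in>I. c i *s g i \<psi>) = 0" if \<psi>: "\<forall>i\<in>{1..n}. \<psi> i \<in> V" for \<psi>
  proof (rule adm_functions_eq_0[OF adm_functions_sum[OF g]])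
    fix t assume t: "t \<in> adm_labelings n"
    have "label_value l \<in> V" if "l \<in> labels Es" for l using that radical_gens(2) by (auto simp: labels_def label_value_def block_unit_def)
    moreover have "t i \<in> labels Es" if "i \<in> {1..n}" for i
      using t that PiE_mem[of t "{1..n}" "\<lambda>_. labels Es" i] by (simp add: adm_labelings_def)
    ultimately have tV: "\<forall>i\<in>{1..n}. label_value (t i) \<in> V" by simp
    have gV: "g i (\<lambda>j. label_value (t j)) \<in> span BV" if "i \<in> I" for i
    proof -
      have "g i (\<lambda>j. label_value (t j)) \<in> V" by (rule adm_functions_V[OF g[OF that] tV])
      then show ?thesis using BV(3) by auto
    qed
    let ?s = "\<Sum>i\<in>I. c i *s g i (\<lambda>j. label_value (t j))"
    have s: "?s \<in> span BV" by (intro span_sum span_scale gV)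
    have "representation BV ?s b = 0" for b
    proof (cases "b \<in> BV")
      case True
      have "representation BV ?s b = (\<Sum>i\<in>I. representation BV (c i *s g i (\<lambda>j. label_value (t j))) b)"
        by (subst representation_sum[OF BV(2)]) (auto intro: span_scale gV)
      also have "\<dots> = (\<Sum>i\<in>I. c i * representation BV (g i (\<lambda>j. label_value (t j))) b)"
        by (intro sum.cong refl) (simp add: representation_scale[OF BV(2) gV])
      finally show ?thesis using c(2)[OF t True] by simp
    qed (use representation_ne_zero in blast)
    then show "?s = 0" using sum_nonzero_representation_eq[OF BV(2) s] by simp
  qed (use \<psi> in auto)
  then show ?thesis using c(1) by blast
qed

text \<open>Weighting the labels of \<open>J\<close> with \<open>1/n\<close> bounds the number of labelings with few such labels.\<close>

lemma card_adm_labelings: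
  assumes Es: "Es \<noteq> {}"
  shows "\<exists>C>0. \<forall>n\<ge>1. real (card (adm_labelings n)) \<le> C * real n ^ nil_index * real expo ^ n"
proof -
  let ?A = "{S. adm S}" and ?j = "real (card radical_gens)"
  have d1: "expo \<ge> 1" by (rule expo_pos[OF Es])
  have bound: "real (card {t \<in> {1..n} \<rightarrow>\<^sub>E labels S. card {i\<in>{1..n}. \<not> isl (t i)} < nil_index}) \<le> exp ?j * real n ^ nil_index * real expo ^ n"
    if S: "adm S" and n: "n \<ge> 1" for S n
  proof -
    let ?M = "{t \<in> {1..n} \<rightarrow>\<^sub>E labels S. card {i\<in>{1..n}. \<not> isl (t i)} < nil_index}"
    \<comment> \<open>A labeling with fewer than \<open>nil_index\<close> radical labels has weight
      at least n^(-nil_index), so the count is at most n^nil_index times the total weight of all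
      labelings, which is a product of n equal sums.\<close>
    define w where "w l = (if isl l then 1 else 1 / real n)" for l :: "'v label"
    have SE: "S \<subseteq> Es" using S by (simp add: adm_def)
    have fin: "finite ({1..n} \<rightarrow>\<^sub>E labels S)" by (intro finite_PiE finite_labels SE) auto
    have w1: "1 \<le> real n ^ nil_index * (\<Prod>i\<in>{1..n}. w (t i))" if t: "t \<in> ?M" for t
    proof -
      let ?c = "card {i\<in>{1..n}. \<not> isl (t i)}"
      have "(\<Prod>i\<in>{1..n}. w (t i)) = (1 / real n) ^ ?c"
        unfolding w_def by (simp add: prod.If_cases Int_def)
      moreover have "real n ^ nil_index * (1 / real n) ^ ?c = real n ^ (nil_index - ?c)"
        using t n by (simp add: power_one_over power_diff field_simps)
      ultimately show ?thesis using n by simp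
    qed
    have "(\<Sum>l\<in>labels S. w l) = real (\<Sum>e\<in>S. (block_size e)\<^sup>2) + ?j / n"
    proof -
      have fS: "finite S" using SE finite_Es finite_subset by blast
      have "(\<Sum>l\<in>labels S. w l) = (\<Sum>l\<in>Inl ` (SIGMA e:S. {..<block_size e} \<times> {..<block_size e}). w l) + (\<Sum>l\<in>Inr ` radical_gens. w l)"
        unfolding labels_def by (rule sum.union_disjoint) (use fS radical_gens(1) in auto)
      also have "(\<Sum>l\<in>Inl ` (SIGMA e:S. {..<block_size e} \<times> {..<block_size e}). w l) = real (card (SIGMA e:S. {..<block_size e} \<times> {..<block_size e}))"
        by (subst sum.reindex) (auto simp: w_def)
      also have "card (SIGMA e:S. {..<block_size e} \<times> {..<block_size e}) = (\<Sum>e\<in>S. (block_size e)\<^sup>2)"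
        using fS by (subst card_SigmaI) (auto simp: card_cartesian_product power2_eq_square)
      also have "(\<Sum>l\<in>Inr ` radical_gens. w l) = ?j / n" by (subst sum.reindex) (auto simp: w_def)
      finally show ?thesis .
    qed
    then have "(\<Sum>l\<in>labels S. w l) ^ n = (real (\<Sum>e\<in>S. (block_size e)\<^sup>2) + ?j / n) ^ n" by (simp only:)
    \<comment> \<open>Uses 1 + x \<le> exp x at x = j / n, after enlarging j / n to d j / n by d
      \<ge> 1. The n-th power turns the exponential into the constant exp j.\<close>
    also have "\<dots> \<le> (real expo * exp (?j / n)) ^ n"
    proof (rule power_mono)
      have "real (\<Sum>e\<in>S. (block_size e)\<^sup>2) + ?j / n \<le> real expo + real expo * (?j / n)"
        using adm_expo[OF S] d1 mult_right_mono[of 1 "real expo" "?j / n"]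
        by (intro add_mono of_nat_mono) (auto simp del: of_nat_sum)
      also have "\<dots> = real expo * (1 + ?j / n)" by (simp add: algebra_simps)
      also have "\<dots> \<le> real expo * exp (?j / n)" by (intro mult_left_mono) auto
      finally show "real (\<Sum>e\<in>S. (block_size e)\<^sup>2) + ?j / n \<le> real expo * exp (?j / n)" .
    qed (rule add_nonneg_nonneg[OF of_nat_0_le_iff], simp)
    also have "\<dots> = real expo ^ n * exp ?j"
      using n by (simp add: power_mult_distrib flip: exp_of_nat_mult)
    finally have le: "(\<Sum>l\<in>labels S. w l) ^ n \<le> real expo ^ n * exp ?j" .
    have "real (card ?M) = (\<Sum>t\<in>?M. 1)" by simp
    also have "\<dots> \<le> (\<Sum>t\<in>?M. real n ^ nil_index * (\<Prod>i\<in>{1..n}. w (t i)))" by (rule sum_mono) (rule w1)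
    also have "\<dots> \<le> (\<Sum>t\<in>{1..n} \<rightarrow>\<^sub>E labels S. real n ^ nil_index * (\<Prod>i\<in>{1..n}. w (t i)))"
      by (rule sum_mono2[OF fin]) (auto simp: w_def intro!: mult_nonneg_nonneg prod_nonneg)
    also have "\<dots> = real n ^ nil_index * (\<Prod>i\<in>{1..n}. \<Sum>l\<in>labels S. w l)"
      using finite_labels[OF SE] by (subst prod_sum_PiE) (auto simp: sum_distrib_left)
    also have "\<dots> = real n ^ nil_index * (\<Sum>l\<in>labels S. w l) ^ n" by simp
    also have "\<dots> \<le> real n ^ nil_index * (real expo ^ n * exp ?j)" by (rule mult_left_mono[OF le]) simp
    finally show ?thesis by (simp only: ac_simps)
  qed
  have sub: "adm_labelings n \<subseteq> (\<Union>S\<in>?A. {t \<in> {1..n} \<rightarrow>\<^sub>E labels S. card {i\<in>{1..n}. \<not> isl (t i)} < nil_index})" for n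
  proof
    fix t assume t: "t \<in> adm_labelings n"
    have "t i \<in> labels (block_set n t)" if "i \<in> {1..n}" for i
    proof -
      have "t i \<in> labels Es" using t that by (auto simp: adm_labelings_def)
      then show ?thesis using that by (force simp: labels_def block_set_def)
    qed
    then have "t \<in> {1..n} \<rightarrow>\<^sub>E labels (block_set n t)" using t by (auto simp: adm_labelings_def PiE_def)
    then show "t \<in> (\<Union>S\<in>?A. {t \<in> {1..n} \<rightarrow>\<^sub>E labels S. card {i\<in>{1..n}. \<not> isl (t i)} < nil_index})"
      using t by (auto simp: adm_labelings_def)
  qed
  have "real (card (adm_labelings n)) \<le> (real (card ?A) + 1) * exp ?j * real n ^ nil_index * real expo ^ n" if n: "n \<ge> 1" for n
  proof -
    let ?M = "\<lambda>S. {t \<in> {1..n} \<rightarrow>\<^sub>E labels S. card {i\<in>{1..n}. \<not> isl (t i)} < nil_index}"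
    have "finite (?M S)" if "adm S" for S
      using that by (intro finite_subset[of "?M S" "{1..n} \<rightarrow>\<^sub>E labels S"]) (auto intro!: finite_PiE finite_labels simp: adm_def)
    then have "card (adm_labelings n) \<le> card (\<Union>S\<in>?A. ?M S)" using sub finite_adm by (intro card_mono) auto
    also have "\<dots> \<le> (\<Sum>S\<in>?A. card (?M S))" by (rule card_UN_le[OF finite_adm])
    finally have "real (card (adm_labelings n)) \<le> real (\<Sum>S\<in>?A. card (?M S))" by (simp only: of_nat_le_iff)
    also have "\<dots> \<le> (\<Sum>S\<in>?A. exp ?j * real n ^ nil_index * real expo ^ n)"
      unfolding of_nat_sum by (intro sum_mono bound) (use n in auto)
    also have "\<dots> \<le> (real (card ?A) + 1) * (exp ?j * real n ^ nil_index * real expo ^ n)" by (simp add: distrib_right)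
    finally show ?thesis by (simp add: ac_simps)
  qed
  then show ?thesis by (intro exI[of _ "(real (card ?A) + 1) * exp ?j"]) (auto intro: mult_pos_pos)
qed

lemma nilpotent_if_no_block:
  assumes "Es = {}" "length xs = nil_index" shows "prodl xs = 0"
proof -
  have "J = UNIV" using assms by (auto simp: J_def)
  have *: "prodl xs \<in> J_power (length xs)" if "xs \<noteq> []" for xs using that
  proof (induction xs)
    case (Cons x xs)
    show ?case
    proof (cases "xs = []")
      case False
      then have "x \<star> prodl xs \<in> J_power (Suc 0 + length xs)" using Cons \<open>J = UNIV\<close> by (intro J_power_mult) auto
      then show ?thesis using False by (simp add: prodl_Cons)
    qed (simp add: \<open>J = UNIV\<close>)
  qed simp
  then show ?thesis using *[of xs] assms J_power_nil_index[of nil_index] by (cases "xs = []") auto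
qed

end

section \<open>Monomials with independent values\<close>

lemma walk_cong: "(\<And>j. j \<in> set w \<Longrightarrow> a j = a' j \<and> b j = b' j) \<Longrightarrow> walk a b p w q = walk a' b' p w q"
  by (induction w arbitrary: p) auto

context fd_algebra begin

text \<open>At each idempotent \<open>lam_mult\<close> splits the residue, and
  \<open>dual_basis\<close> leaves 1 or 0 according to whether neighbouring edges meet. A letter
  from another block is killed by orthogonality.\<close>

lemma lam_walk:
  assumes e: "e \<in> Es" and "\<And>j. j \<in> set w \<Longrightarrow> N j \<in> Es \<and> a j < block_size (N j) \<and> b j < block_size (N j)" "p < block_size e" "q < block_size e"
  shows "lam e (row_vec e p \<star> foldr (\<star>) (map (\<lambda>j. block_unit (N j) (a j) (b j)) w) (col_vec e q)) =
    (if (\<forall>j\<in>set w. N j = e) \<and> walk a b p w q then 1 else 0)"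
  using assms(2,3)
proof (induction w arbitrary: p)
  case Nil
  then show ?case using dual_basis(2)[OF prim_Es[OF e]] assms(4) by simp
next
  case (Cons j w)
  let ?R = "foldr (\<star>) (map (\<lambda>j. block_unit (N j) (a j) (b j)) w) (col_vec e q)"
  have j: "N j \<in> Es" "a j < block_size (N j)" "b j < block_size (N j)" using Cons.prems by auto
  have "lam e (row_vec e p \<star> (block_unit (N j) (a j) (b j) \<star> ?R)) =
    lam e ((row_vec e p \<star> col_vec (N j) (a j)) \<star> (N j \<star> (row_vec (N j) (b j) \<star> ?R)))" by (simp add: block_unit_def)
  also have "\<dots> = (if N j = e \<and> a j = p \<and> (\<forall>j\<in>set w. N j = e) \<and> walk a b (b j) w q then 1 else 0)"
  proof (cases "N j = e")
    case True
    then have "lam e ((row_vec e p \<star> col_vec (N j) (a j)) \<star> (N j \<star> (row_vec (N j) (b j) \<star> ?R)))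
      = lam e (row_vec e p \<star> col_vec e (a j)) * lam e (row_vec e (b j) \<star> ?R)"
      using lam_mult[OF prim_Es[OF e], of "row_vec e p \<star> col_vec e (a j)" "row_vec e (b j) \<star> ?R"] True by simp
    also have "lam e (row_vec e (b j) \<star> ?R) = (if (\<forall>j\<in>set w. N j = e) \<and> walk a b (b j) w q then 1 else 0)"
      by (rule Cons.IH) (use Cons.prems True j in auto)
    also have "lam e (row_vec e p \<star> col_vec e (a j)) = (if p = a j then 1 else 0)"
      using dual_basis(2)[OF prim_Es[OF e], of p "a j"] j True Cons.prems by auto
    finally show ?thesis using True by auto
  next
    case False
    then show ?thesis using ortho_Es[OF e j(1), of "row_vec e p \<star> col_vec (N j) (a j)"] by auto
  qed
  finally show ?case by auto
qed

lemma foldr_mul: "foldr (\<star>) xs (y \<star> z) = foldr (\<star>) xs y \<star> z"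
  by (induction xs) auto

type_synonym 'w var = "nat + ('w \<times> nat) + unit"

text \<open>One segment per block: the auxiliary variable (e, 0) is meant for \<open>Z e\<close>,
  the variables (e, 1) and (e, 2) for the row and the column that read off the entry (0, 0) of the
  word between them, and the last variable for z.\<close>

definition word :: "'v list \<Rightarrow> ('v \<Rightarrow> nat list) \<Rightarrow> 'v var list" where
  "word es w = concat (map (\<lambda>e. [Inr (Inl (e, 0)), Inr (Inl (e, 1))] @ map Inl (w e) @ [Inr (Inl (e, 2))]) es) @ [Inr (Inr ())]"

definition var_set :: "nat \<Rightarrow> 'v set \<Rightarrow> 'v var set" where
  "var_set n T = Inl ` {1..n} \<union> Inr ` (Inl ` (T \<times> {0, 1, 2}) \<union> {Inr ()})"

lemma card_var_set: "finite T \<Longrightarrow> finite (var_set n T) \<and> card (var_set n T) = n + (3 * card T + 1)"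
proof -
  assume T: "finite T"
  let ?A = "Inr ` Inl ` (T \<times> {0, 1, 2}) :: 'v var set" and ?B = "Inl ` {1..n} :: 'v var set"
  have cA: "card ?A = 3 * card T" and cB: "card ?B = n" by (simp_all add: card_image card_cartesian_product)
  have fin: "finite ?A" "finite ?B" using T by auto
  have "?B \<inter> ?A = {}" by auto
  then have "card (?B \<union> ?A) = n + 3 * card T" using card_Un_disjoint[OF fin(2,1)] cA cB by simp
  moreover have "Inr (Inr ()) \<notin> ?B \<union> ?A" by auto
  moreover have "var_set n T = insert (Inr (Inr ())) (?B \<union> ?A)" by (auto simp: var_set_def)
  ultimately show ?thesis using fin card_insert_disjoint[of "?B \<union> ?A"] by (simp del: Un_insert_left)
qed

lemma word_var_set:
  assumes es: "distinct es" and N: "N \<in> {1..n} \<rightarrow>\<^sub>E set es"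
    and w: "\<And>e. e \<in> set es \<Longrightarrow> w e \<in> orderings {j\<in>{1..n}. N j = e}"
  shows "distinct (word es w)" "set (word es w) = var_set n (set es)"
proof -
  let ?b = "\<lambda>e. [Inr (Inl (e, 0)), Inr (Inl (e, 1))] @ map Inl (w e) @ [Inr (Inl (e, 2))] :: 'v var list"
  have sw: "distinct (w e)" "set (w e) = {j\<in>{1..n}. N j = e}" if "e \<in> set es" for e
    using w[OF that] by (auto simp: orderings_def)
  have "distinct (concat (map ?b es))"
  proof (rule distinct_concat)
    show "distinct (map ?b es)" using es by (auto simp: distinct_map intro!: inj_onI)
    show "distinct ys" if "ys \<in> set (map ?b es)" for ys using that sw by (auto simp: distinct_map)
    fix ys zs assume "ys \<in> set (map ?b es)" "zs \<in> set (map ?b es)" "ys \<noteq> zs"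
    then show "set ys \<inter> set zs = {}" using sw by auto
  qed
  then show "distinct (word es w)" unfolding word_def by auto
  show "set (word es w) = var_set n (set es)"
  proof (rule subset_antisym; rule subsetI)
    fix x assume "x \<in> set (word es w)"
    then show "x \<in> var_set n (set es)" using sw by (auto simp: word_def var_set_def)
  next
    fix x assume "x \<in> var_set n (set es)"
    then consider j where "x = Inl j" "j \<in> {1..n}" | e i where "x = Inr (Inl (e, i))" "e \<in> set es" "i \<in> {0, 1, 2}" | "x = Inr (Inr ())"
      by (auto simp: var_set_def)
    then show "x \<in> set (word es w)"
    proof cases
      case (1 j)
      have "N j \<in> set es" by (rule PiE_mem[OF N 1(2)])
      moreover from this have "j \<in> set (w (N j))" using sw(2)[of "N j"] 1(2) by auto
      ultimately show ?thesis using 1 unfolding word_def by auto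
    qed (auto simp: word_def)
  qed
qed

lemma prodl_word:
  "prodl (map \<Phi> (word es w)) = chain (\<lambda>e. \<Phi> (Inr (Inl (e, 0))))
     (\<lambda>e. \<Phi> (Inr (Inl (e, 1))) \<star> foldr (\<star>) (map (\<lambda>j. \<Phi> (Inl j)) (w e)) (\<Phi> (Inr (Inl (e, 2))))) es (\<Phi> (Inr (Inr ())))"
proof -
  have "foldr (\<star>) (map \<Phi> (concat (map (\<lambda>e. [Inr (Inl (e, 0)), Inr (Inl (e, 1))] @ map Inl (w e) @ [Inr (Inl (e, 2))]) es))) z =
    chain (\<lambda>e. \<Phi> (Inr (Inl (e, 0))))
     (\<lambda>e. \<Phi> (Inr (Inl (e, 1))) \<star> foldr (\<star>) (map (\<lambda>j. \<Phi> (Inl j)) (w e)) (\<Phi> (Inr (Inl (e, 2))))) es z" for z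
    by (induction es) (auto simp: foldr_mul o_def)
  then show ?thesis unfolding word_def by (simp add: prodl_append_single)
qed

text \<open>For each distribution N of the variables to the blocks, words with independent incidence
  rows are taken. Evaluating the letters in the blocks prescribed by N kills the words of all other
  distributions, so the families for different N are jointly independent.\<close>

lemma independent_monomials:
  assumes Es: "Es \<noteq> {}"
  shows "\<exists>c \<kappa> r. \<kappa> > (0::real) \<and> (\<forall>n. \<exists>(I :: ('v \<Rightarrow> nat list) set) L. finite I \<and>
    (\<forall>w\<in>I. distinct (L w) \<and> set (L w) = {1..n + c}) \<and>
    real expo ^ n \<le> real (card I) * (\<kappa> * real (n + 2) ^ r) \<and>
    (\<forall>a. (\<forall>\<psi>. (\<forall>i\<in>{1..n+c}. \<psi> i \<in> V) \<longrightarrow> (\<Sum>w\<in>I. a w *s prodl (map \<psi> (L w))) = 0) \<longrightarrow> (\<forall>w\<in>I. a w = 0)))"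
proof -
  obtain es where es: "distinct es" "set es \<subseteq> Es" "ideal_chain es \<noteq> {0}" "(\<Sum>e\<in>set es. (block_size e)\<^sup>2) = expo"
    by (rule expo_attained[OF Es])
  define T where "T = set es"
  have T: "finite T" "T \<subseteq> Es" using es by (auto simp: T_def)
  have idT: "idem e" and prT: "prim e" if "e \<in> T" for e using T that idem_Es prim_Es by auto
  have kT: "block_size e \<ge> 1" if "e \<in> T" for e using dual_basis(1)[OF prT[OF that]] .
  have "es \<noteq> []" using es(4) expo_pos[OF Es] by auto
  \<comment> \<open>The last idempotent f allows z to be replaced by f z, which lies in
    \<open>V\<close>.\<close>
  then obtain es' f where f: "es = es' @ [f]" by (metis append_butlast_last_id)
  obtain Z z where Z: "chain Z id es z \<noteq> 0"
    "\<And>v. (\<And>e. e \<in> set es \<Longrightarrow> v e \<in> corner e) \<Longrightarrow>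
       chain Z v es z = (\<Prod>e\<in>set es. lam e (v e)) *s chain Z id es z"
    by (rule maximal_chain[OF es(1-3)]) blast
  let ?c0 = "chain Z id es z"
  define \<kappa> where "\<kappa> = (\<Prod>e\<in>T. (real (block_size e))\<^sup>2)"
  define r where "r = (\<Sum>e\<in>T. block_size e * block_size e + 1)"
  \<comment> \<open>Three auxiliary variables for each block and one for z.\<close>
  define c where "c = 3 * card T + 1"
  have "\<kappa> > 0" unfolding \<kappa>_def using kT by (intro prod_pos) (auto simp: Suc_le_eq)
  moreover have "\<exists>(I :: ('v \<Rightarrow> nat list) set) L. finite I \<and>
    (\<forall>w\<in>I. distinct (L w) \<and> set (L w) = {1..n + c}) \<and>
    real expo ^ n \<le> real (card I) * (\<kappa> * real (n + 2) ^ r) \<and>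
    (\<forall>a. (\<forall>\<psi>. (\<forall>i\<in>{1..n+c}. \<psi> i \<in> V) \<longrightarrow> (\<Sum>w\<in>I. a w *s prodl (map \<psi> (L w))) = 0) \<longrightarrow> (\<forall>w\<in>I. a w = 0))" for n
  proof -
    let ?S = "\<lambda>N e. {j\<in>{1..n}. N j = e}"
    let ?NN = "{1..n} \<rightarrow>\<^sub>E T"
    let ?rows = "\<lambda>N. PiE T (\<lambda>e. orderings (?S N e))" and ?cols = "\<lambda>N. PiE T (\<lambda>e. edges (block_size e) (?S N e))"
    let ?v = "\<lambda>w c. \<Prod>e\<in>T. walk_inc (w e) (c e)"
    have finNN: "finite ?NN" using T by (intro finite_PiE) auto
    let ?Q = "\<lambda>N B. B \<subseteq> ?rows N \<and> indep_rows TYPE('k) ?v B (?cols N) \<and>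
      (\<Prod>e\<in>T. real (block_size e) ^ (2 * card (?S N e))) \<le> card B * (\<Prod>e\<in>T. (real (block_size e))\<^sup>2 * real (n + 2) ^ (block_size e * block_size e + 1))"
    have ex: "\<exists>B. ?Q N B" for N
    proof (rule exists_independent_block_rows[OF T(1)])
      fix e
      have "card (?S N e) \<le> card {1..n}" by (intro card_mono) auto
      then show "card (?S N e) \<le> n" by simp
    qed (use kT in auto)
    define B where "B N = (SOME B. ?Q N B)" for N
    have Q: "?Q N (B N)" for N unfolding B_def by (rule someI_ex[OF ex])
    have B: "B N \<subseteq> ?rows N" "indep_rows TYPE('k) ?v (B N) (?cols N)"
      "(\<Prod>e\<in>T. real (block_size e) ^ (2 * card (?S N e))) \<le> card (B N) * (\<Prod>e\<in>T. (real (block_size e))\<^sup>2 * real (n + 2) ^ (block_size e * block_size e + 1))" for N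
      using Q[of N] by blast+
    have finB: "finite (B N)" for N by (rule finite_subset[OF B(1)[of N]]) (use T in \<open>auto intro!: finite_PiE finite_orderings\<close>)
    define I where "I = (\<Union>N\<in>?NN. B N)"
    have finI: "finite I" using finNN finB by (simp add: I_def)
    have P: "(\<Prod>e\<in>T. (real (block_size e))\<^sup>2 * real (n + 2) ^ (block_size e * block_size e + 1)) = \<kappa> * real (n + 2) ^ r"
      unfolding \<kappa>_def r_def by (simp add: prod.distrib power_sum)
    have mem: "j \<in> set (w (N j))" "set (w e) = ?S N e"
      if "w \<in> B N" "N \<in> ?NN" "j \<in> {1..n}" "e \<in> T" for w N j e
    proof -
      have *: "set (w e) = ?S N e" if "e \<in> T" for e using B(1)[of N] \<open>w \<in> B N\<close> that by (auto simp: orderings_def PiE_def Pi_def)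
      show "set (w e) = ?S N e" by (rule *[OF that(4)])
      have "N j \<in> T" by (rule PiE_mem[OF that(2,3)])
      then show "j \<in> set (w (N j))" using *[of "N j"] that(3) by auto
    qed
    have disj: "B N \<inter> B N' = {}" if N: "N \<in> ?NN" "N' \<in> ?NN" "N \<noteq> N'" for N N'
    proof (rule ccontr)
      assume "B N \<inter> B N' \<noteq> {}"
      then obtain w where w: "w \<in> B N" "w \<in> B N'" by auto
      have "N j = N' j" for j
      proof (cases "j \<in> {1..n}")
        case True
        have NT: "N j \<in> T" by (rule PiE_mem[OF N(1) True])
        then show ?thesis using mem(1)[OF w(1) N(1) True NT] mem(2)[OF w(2) N(2) True NT] by auto
      next
        case False
        then show ?thesis using N by (auto simp: PiE_def extensional_def)
      qed
      then show False using N by auto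
    qed
    \<comment> \<open>The n-th power of \<open>expo\<close> expands over the distributions N, and
      the term of N is bounded by the number of rows in \<open>B N\<close> up to the polynomial
      factor.\<close>
    have cardI: "real expo ^ n \<le> real (card I) * (\<kappa> * real (n + 2) ^ r)"
    proof -
      have "real expo = (\<Sum>e\<in>T. (real (block_size e))\<^sup>2)" unfolding es(4)[symmetric] T_def by simp
      then have "real expo ^ n = (\<Prod>j\<in>{1..n}. \<Sum>e\<in>T. (real (block_size e))\<^sup>2)" by simp
      also have "\<dots> = (\<Sum>N\<in>?NN. \<Prod>j\<in>{1..n}. (real (block_size (N j)))\<^sup>2)" using T by (intro prod_sum_PiE) auto
      also have "\<dots> = (\<Sum>N\<in>?NN. \<Prod>e\<in>T. real (block_size e) ^ (2 * card (?S N e)))"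
      proof (rule sum.cong[OF refl])
        fix N assume N: "N \<in> ?NN"
        have "(\<Prod>j\<in>{1..n}. (real (block_size (N j)))\<^sup>2) = (\<Prod>e\<in>T. \<Prod>j\<in>?S N e. (real (block_size (N j)))\<^sup>2)"
          by (rule prod.group[symmetric]) (use T PiE_mem[OF N] in auto)
        also have "\<dots> = (\<Prod>e\<in>T. real (block_size e) ^ (2 * card (?S N e)))"
          by (rule prod.cong) (auto simp: power_mult)
        finally show "(\<Prod>j\<in>{1..n}. (real (block_size (N j)))\<^sup>2) = (\<Prod>e\<in>T. real (block_size e) ^ (2 * card (?S N e)))" .
      qed
      also have "\<dots> \<le> (\<Sum>N\<in>?NN. real (card (B N)) * (\<kappa> * real (n + 2) ^ r))"
        by (rule sum_mono) (use B(3) P in simp)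
      also have "\<dots> = real (\<Sum>N\<in>?NN. card (B N)) * (\<kappa> * real (n + 2) ^ r)" by (simp add: sum_distrib_right)
      also have "(\<Sum>N\<in>?NN. card (B N)) = card I"
        unfolding I_def using finNN finB disj by (subst card_UN_disjoint) auto
      finally show ?thesis .
    qed
    obtain \<pi> where \<pi>: "bij_betw \<pi> {1..n + c} (var_set n T)"
      using ex_bij_betw_nat_finite_1[of "var_set n T"] card_var_set[OF T(1), of n] by (auto simp: c_def)
    define \<pi>' where "\<pi>' = inv_into {1..n + c} \<pi>"
    have \<pi>': "bij_betw \<pi>' (var_set n T) {1..n + c}" unfolding \<pi>'_def by (rule bij_betw_inv_into[OF \<pi>])
    have \<pi>\<pi>': "\<pi> (\<pi>' x) = x" if "x \<in> var_set n T" for x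
      unfolding \<pi>'_def using \<pi> that by (intro f_inv_into_f) (auto simp: bij_betw_def)
    define L where "L w = map \<pi>' (word es w)" for w
    have word: "distinct (word es w)" "set (word es w) = var_set n T" if wI: "w \<in> I" for w
    proof -
      obtain N where N: "N \<in> ?NN" "w \<in> B N" using wI unfolding I_def by blast
      have "w e \<in> orderings (?S N e)" if "e \<in> set es" for e
        using B(1)[of N] N(2) that by (auto simp: T_def)
      then show "distinct (word es w)" "set (word es w) = var_set n T"
        using word_var_set[OF es(1), of N n w] N(1) by (auto simp: T_def)
    qed
    have L: "distinct (L w)" "set (L w) = {1..n + c}" if "w \<in> I" for w
      using word[OF that] \<pi>' unfolding L_def by (auto simp: distinct_map bij_betw_def)
    have indep: "a w = 0" if a: "\<forall>\<psi>. (\<forall>i\<in>{1..n+c}. \<psi> i \<in> V) \<longrightarrow> (\<Sum>w\<in>I. a w *s prodl (map \<psi> (L w))) = 0" and w: "w \<in> I" for a w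
    proof -
      obtain N where N: "N \<in> ?NN" "w \<in> B N" using w by (auto simp: I_def)
      have "(\<Sum>w\<in>B N. a w * of_int (?v w d)) = 0" if d: "d \<in> ?cols N" for d
      proof -
        define A where "A j = fst (d (N j)) j" for j
        define A' where "A' j = snd (d (N j)) j" for j
        have NT: "N j \<in> T" if "j \<in> {1..n}" for j by (rule PiE_mem[OF N(1) that])
        have Ak: "A j < block_size (N j)" "A' j < block_size (N j)" if "j \<in> {1..n}" for j
        proof -
          have "d (N j) \<in> edges (block_size (N j)) (?S N (N j))" using d NT[OF that] by auto
          then show "A j < block_size (N j)" "A' j < block_size (N j)" using that by (auto simp: A_def A'_def edges_def PiE_def Pi_def mem_Times_iff)
        qed
        \<comment> \<open>The factors e and f force the values into \<open>V\<close>. Those at the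
          row and the column also put the slot into the corner of e, and then those at
          \<open>Z e\<close> and z leave the product unchanged.\<close>
        define \<Phi> :: "'v var \<Rightarrow> 'v" where "\<Phi> x = (case x of Inl j \<Rightarrow> block_unit (N j) (A j) (A' j)
          | Inr (Inl (e, i)) \<Rightarrow> (if i = 0 then Z e \<star> e else if i = 1 then e \<star> row_vec e 0 else col_vec e 0 \<star> e)
          | Inr (Inr u) \<Rightarrow> f \<star> z)" for x
        have \<Phi>s: "\<Phi> (Inr (Inl (e, 0))) = Z e \<star> e" "\<Phi> (Inr (Inl (e, 1))) = e \<star> row_vec e 0"
          "\<Phi> (Inr (Inl (e, 2))) = col_vec e 0 \<star> e" "\<Phi> (Inr (Inr ())) = f \<star> z" "\<Phi> (Inl j) = block_unit (N j) (A j) (A' j)" for e j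
          by (simp_all add: \<Phi>_def)
        have \<Phi>V: "\<Phi> x \<in> V" for x by (auto simp: \<Phi>_def block_unit_def split: sum.splits)
        define ve where "ve u e = (e \<star> row_vec e 0) \<star> foldr (\<star>) (map (\<lambda>j. block_unit (N j) (A j) (A' j)) (u e)) (col_vec e 0 \<star> e)" for u :: "'v \<Rightarrow> nat list" and e
        have ve: "ve u e = e \<star> ((row_vec e 0 \<star> foldr (\<star>) (map (\<lambda>j. block_unit (N j) (A j) (A' j)) (u e)) (col_vec e 0)) \<star> e)" for u e
          by (simp add: ve_def foldr_mul)
        have vec: "ve u e \<in> corner e" if "e \<in> T" for u e unfolding ve by (rule corner_eq_mult[OF idT[OF that]])
        have val: "prodl (map (\<lambda>i. \<Phi> (\<pi> i)) (L u)) = (\<Prod>e\<in>T. lam e (ve u e)) *s ?c0" if "u \<in> I" for u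
        proof -
          have "map (\<lambda>i. \<Phi> (\<pi> i)) (L u) = map \<Phi> (word es u)" unfolding L_def using \<pi>\<pi>' word(2)[OF that] by auto
          then have "prodl (map (\<lambda>i. \<Phi> (\<pi> i)) (L u)) = chain (\<lambda>e. Z e \<star> e) (ve u) es (f \<star> z)"
            by (simp only: prodl_word \<Phi>s ve_def[abs_def])
          also have "\<dots> = chain Z (ve u) es (f \<star> z)"
          proof -
            have "chain (\<lambda>e. Z e \<star> e) (ve u) xs y = chain Z (ve u) xs y" if "set xs \<subseteq> T" for xs y
              using that by (induction xs) (auto simp: cornerD[OF vec])
            then show ?thesis by (simp add: T_def)
          qed
          also have "\<dots> = chain Z (ve u) es z"
            using vec[of f u] f by (simp add: T_def cornerD)
          also have "\<dots> = (\<Prod>e\<in>T. lam e (ve u e)) *s ?c0" unfolding T_def by (rule Z(2)) (use vec in \<open>auto simp: T_def\<close>)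
          finally show ?thesis .
        qed
        have lamve: "lam e (ve u e) = (if (\<forall>j\<in>set (u e). N j = e) \<and> walk A A' 0 (u e) 0 then 1 else 0)"
          if "e \<in> T" "set (u e) \<subseteq> {1..n}" for u e
          unfolding ve lam_sandwich[OF prT[OF that(1)]]
        proof (rule lam_walk)
          show "e \<in> Es" using T(2) that(1) by blast
          fix j assume "j \<in> set (u e)"
          then have "j \<in> {1..n}" using that(2) by blast
          then show "N j \<in> Es \<and> A j < block_size (N j) \<and> A' j < block_size (N j)" using NT Ak T(2) by blast
        qed (use kT[OF that(1)] in auto)
        have "(\<Sum>u\<in>I. a u *s prodl (map (\<lambda>i. \<Phi> (\<pi> i)) (L u))) = 0" using a \<Phi>V by simp
        then have "(\<Sum>u\<in>I. a u * (\<Prod>e\<in>T. lam e (ve u e))) *s ?c0 = 0" by (simp add: val scale_sum_left)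
        then have "(\<Sum>u\<in>I. a u * (\<Prod>e\<in>T. lam e (ve u e))) = 0" using Z(1) by simp
        \<comment> \<open>A word of another distribution N' has a letter j in the segment of the
          block \<open>N' j\<close> that is evaluated in the different block \<open>N j\<close>,
          which makes the residue of that segment 0.\<close>
        moreover have "(\<Sum>u\<in>I. a u * (\<Prod>e\<in>T. lam e (ve u e))) = (\<Sum>u\<in>B N. a u * (\<Prod>e\<in>T. lam e (ve u e)))"
        proof (rule sum.mono_neutral_right[OF finI])
          show "B N \<subseteq> I" using N by (auto simp: I_def)
          show "\<forall>u\<in>I - B N. a u * (\<Prod>e\<in>T. lam e (ve u e)) = 0"
          proof
            fix u assume u: "u \<in> I - B N"
            then obtain N' where N': "N' \<in> ?NN" "u \<in> B N'" by (auto simp: I_def)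
            then have "N' \<noteq> N" using u by auto
            then obtain j where "N' j \<noteq> N j" by auto
            then have j: "j \<in> {1..n}" using PiE_arb[OF N(1), of j] PiE_arb[OF N'(1), of j] by metis
            have e: "N' j \<in> T" by (rule PiE_mem[OF N'(1) j])
            have "set (u (N' j)) \<subseteq> {1..n}" using mem(2)[OF N'(2,1) j e] by auto
            then have "lam (N' j) (ve u (N' j)) = 0"
              using lamve[OF e] mem(1)[OF N'(2,1) j e] \<open>N' j \<noteq> N j\<close> by auto
            then have "(\<Prod>e\<in>T. lam e (ve u e)) = 0" using e T(1) by (intro prod_zero) auto
            then show "a u * (\<Prod>e\<in>T. lam e (ve u e)) = 0" by simp
          qed
        qed
        moreover have "(\<Prod>e\<in>T. lam e (ve u e)) = of_int (?v u d)" if u: "u \<in> B N" for u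
        proof -
          have "lam e (ve u e) = of_int (walk_inc (u e) (d e))" if e: "e \<in> T" for e
          proof -
            have su: "set (u e) = ?S N e"
              using B(1)[of N] u e by (auto simp: orderings_def PiE_def Pi_def)
            have "walk A A' 0 (u e) 0 = walk (fst (d e)) (snd (d e)) 0 (u e) 0"
              by (rule walk_cong) (use su in \<open>auto simp: A_def A'_def\<close>)
            moreover have "set (u e) \<subseteq> {1..n}" "\<forall>j\<in>set (u e). N j = e" using su by auto
            ultimately show ?thesis using lamve[OF e, of u] by (simp add: walk_inc_def)
          qed
          then show ?thesis by simp
        qed
        ultimately show ?thesis by simp
      qed
      then show ?thesis using B(2)[of N] N(2) unfolding indep_rows_def by blast
    qed
    show ?thesis using finI L cardI indep by (intro exI[of _ I] exI[of _ L]) blast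
  qed
  ultimately show ?thesis by blast
qed

end

section \<open>Extension of scalars\<close>

locale fd_action = derivation_action scaleA scaleG bracket act
  for scaleA :: "'f::field_char_0 \<Rightarrow> 'a::ring \<Rightarrow> 'a"
    and scaleG :: "'f \<Rightarrow> 'g::ab_group_add \<Rightarrow> 'g"
    and bracket :: "'g \<Rightarrow> 'g \<Rightarrow> 'g" and act :: "'g \<Rightarrow> 'a \<Rightarrow> 'a" +
  fixes Basis :: "'a set"
  assumes finite_Basis: "finite Basis" and indep_Basis: "A.independent Basis" and span_Basis: "A.span Basis = UNIV"
begin

text \<open>The algebra over the algebraic closure consists of the functions supported on \<open>Basis\<close>, read as
  coordinate vectors.\<close>

definition emb :: "'a \<Rightarrow> 'a \<Rightarrow> 'f alg_closure" where "emb a b = to_ac (A.representation Basis a b)"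

lemma emb_add: "emb (a + b) = emb a + emb b"
  by (rule ext) (simp add: emb_def A.representation_add[OF indep_Basis] span_Basis)

lemma emb_scale: "emb (scaleA c a) b = to_ac c * emb a b"
  by (simp add: emb_def A.representation_scale[OF indep_Basis] span_Basis)

lemma emb_eq_0: "emb a = 0 \<Longrightarrow> a = 0"
  using A.sum_nonzero_representation_eq[OF indep_Basis, of a] by (simp add: span_Basis emb_def fun_eq_iff)

lemma emb_zero: "emb 0 = 0" using emb_add[of 0 0] by simp

lemma emb_sum: "emb (sum f S) k = (\<Sum>i\<in>S. emb (f i) k)"
  by (induction S rule: infinite_finite_induct) (auto simp: emb_add emb_zero)

lemma emb_linear:
  assumes "\<And>x y. G (x + y) = G x + G y" "\<And>c x. G (scaleA c x) = scaleA c (G x)"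
  shows "emb (G a) k = (\<Sum>i\<in>Basis. emb a i * emb (G i) k)"
proof -
  have "a = (\<Sum>i\<in>Basis. scaleA (A.representation Basis a i) i)"
    using A.sum_representation_eq[OF indep_Basis _ finite_Basis, of a] by (simp add: span_Basis)
  then have "G a = G (\<Sum>i\<in>Basis. scaleA (A.representation Basis a i) i)" by simp
  also have "\<dots> = (\<Sum>i\<in>Basis. scaleA (A.representation Basis a i) (G i))"
    by (subst additive_sum[of G, OF assms(1)]) (simp add: assms(2))
  finally show ?thesis by (simp add: emb_sum emb_scale) (simp add: emb_def)
qed

definition kscale :: "'f alg_closure \<Rightarrow> ('a \<Rightarrow> 'f alg_closure) \<Rightarrow> 'a \<Rightarrow> 'f alg_closure" where
  "kscale c x = (\<lambda>b. c * x b)"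

text \<open>The structure constants of A with respect to \<open>Basis\<close>. Only coordinates on
  \<open>Basis\<close> are read, so arbitrary functions can be multiplied and the result lies in
  \<open>KV\<close>.\<close>

definition kmul :: "('a \<Rightarrow> 'f alg_closure) \<Rightarrow> ('a \<Rightarrow> 'f alg_closure) \<Rightarrow> 'a \<Rightarrow> 'f alg_closure" where
  "kmul x y = (\<lambda>k. \<Sum>i\<in>Basis. \<Sum>j\<in>Basis. x i * y j * emb (i * j) k)"

definition kext :: "('a \<Rightarrow> 'a) \<Rightarrow> ('a \<Rightarrow> 'f alg_closure) \<Rightarrow> 'a \<Rightarrow> 'f alg_closure" where
  "kext G x = (\<lambda>k. \<Sum>i\<in>Basis. x i * emb (G i) k)"

definition KV :: "('a \<Rightarrow> 'f alg_closure) set" where "KV = {x. \<forall>k. k \<notin> Basis \<longrightarrow> x k = 0}"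

sublocale K: vector_space kscale
  by unfold_locales (auto simp: kscale_def algebra_simps)

lemma kmul_emb_left: "kmul (emb a) z k = (\<Sum>j\<in>Basis. z j * emb (a * j) k)"
proof -
  have "kmul (emb a) z k = (\<Sum>j\<in>Basis. \<Sum>i\<in>Basis. z j * (emb a i * emb (i * j) k))"
    unfolding kmul_def by (subst sum.swap) (simp add: ac_simps)
  also have "\<dots> = (\<Sum>j\<in>Basis. z j * emb (a * j) k)"
    by (subst emb_linear[of "\<lambda>x. x * _"]) (auto simp: distrib_right A.scale_mult_left sum_distrib_left)
  finally show ?thesis .
qed

lemma kmul_emb_right: "kmul z (emb a) k = (\<Sum>i\<in>Basis. z i * emb (i * a) k)"
proof -
  have "kmul z (emb a) k = (\<Sum>i\<in>Basis. \<Sum>j\<in>Basis. z i * (emb a j * emb (i * j) k))"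
    unfolding kmul_def by (simp add: ac_simps)
  also have "\<dots> = (\<Sum>i\<in>Basis. z i * emb (i * a) k)"
    by (subst emb_linear[of "\<lambda>x. _ * x"]) (auto simp: distrib_left A.scale_mult_right sum_distrib_left)
  finally show ?thesis .
qed

lemma emb_mult: "emb (a * b) = kmul (emb a) (emb b)"
proof
  fix k show "emb (a * b) k = kmul (emb a) (emb b) k"
    unfolding kmul_emb_left by (rule emb_linear) (auto simp: distrib_left A.scale_mult_right)
qed

lemma sum_app: "(sum F S) k = (\<Sum>i\<in>S. F i k)" for F :: "'i \<Rightarrow> 'a \<Rightarrow> 'f alg_closure"
  by (rule additive_sum[of "\<lambda>F. F k"]) simp

lemma kmul_linear:
  "kmul (x + y) z = kmul x z + kmul y z" "kmul x (y + z) = kmul x y + kmul x z"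
  "kmul (kscale c x) y = kscale c (kmul x y)" "kmul x (kscale c y) = kscale c (kmul x y)"
  by (simp_all add: kmul_def kscale_def algebra_simps sum.distrib sum_distrib_left fun_eq_iff)

lemma kmul_expand: "kmul x y = (\<Sum>i\<in>Basis. \<Sum>j\<in>Basis. kscale (x i * y j) (emb (i * j)))"
  by (rule ext) (simp add: sum_app kmul_def kscale_def)

lemma kmul_assoc: "kmul (kmul x y) z = kmul x (kmul y z)"
proof
  fix k
  have "kmul (kmul x y) z = (\<Sum>i\<in>Basis. \<Sum>j\<in>Basis. kscale (x i * y j) (kmul (emb (i * j)) z))"
    unfolding kmul_expand[of x y] by (simp only: additive_sum[of "\<lambda>u. kmul u z", OF kmul_linear(1)] kmul_linear)
  then have "kmul (kmul x y) z k = (\<Sum>i\<in>Basis. \<Sum>j\<in>Basis. \<Sum>l\<in>Basis. x i * (y j * (z l * emb (i * (j * l)) k)))"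
    by (simp add: sum_app kscale_def kmul_emb_left sum_distrib_left mult.assoc)
  also have "\<dots> = (\<Sum>j\<in>Basis. \<Sum>i\<in>Basis. \<Sum>l\<in>Basis. x i * (y j * (z l * emb (i * (j * l)) k)))"
    by (rule sum.swap)
  also have "\<dots> = (\<Sum>j\<in>Basis. \<Sum>l\<in>Basis. \<Sum>i\<in>Basis. x i * (y j * (z l * emb (i * (j * l)) k)))"
    by (intro sum.cong refl sum.swap)
  also have "\<dots> = kmul x (kmul y z) k"
  proof -
    have "kmul x (kmul y z) = (\<Sum>j\<in>Basis. \<Sum>l\<in>Basis. kscale (y j * z l) (kmul x (emb (j * l))))"
      unfolding kmul_expand[of y z] by (simp only: additive_sum[of "kmul x", OF kmul_linear(2)] kmul_linear)
    then show ?thesis by (simp add: sum_app kscale_def kmul_emb_right sum_distrib_left ac_simps)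
  qed
  finally show "kmul (kmul x y) z k = kmul x (kmul y z) k" .
qed

lemma kext_emb: 
  assumes "\<And>x y. G (x + y) = G x + G y" "\<And>c x. G (scaleA c x) = scaleA c (G x)"
  shows "kext G (emb a) = emb (G a)"
  unfolding kext_def by (rule ext) (rule emb_linear[OF assms, symmetric])

lemma KV_span: "KV \<subseteq> K.span (emb ` Basis)"
proof
  fix x assume x: "x \<in> KV"
  have "x = (\<Sum>b\<in>Basis. kscale (x b) (emb b))"
  proof
    fix k
    have "(\<Sum>b\<in>Basis. kscale (x b) (emb b)) k = (\<Sum>b\<in>Basis. x b * emb b k)"
      by (subst additive_sum[of "\<lambda>f. f k"]) (auto simp: kscale_def)
    also have "\<dots> = (\<Sum>b\<in>Basis. if b = k then x k else 0)"
      by (rule sum.cong) (auto simp: emb_def A.representation_basis[OF indep_Basis])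
    also have "\<dots> = x k" using x finite_Basis by (auto simp: KV_def)
    finally show "x k = (\<Sum>b\<in>Basis. kscale (x b) (emb b)) k" by simp
  qed
  also have "\<dots> \<in> K.span (emb ` Basis)" by (intro K.span_sum K.span_scale K.span_base) auto
  finally show "x \<in> K.span (emb ` Basis)" .
qed

lemma emb_KV: "emb a \<in> KV"
  by (auto simp: KV_def emb_def dest: A.representation_ne_zero)

lemma emb_outside: "k \<notin> Basis \<Longrightarrow> emb a k = 0"
  using emb_KV[of a] by (simp add: KV_def)

lemma kext_KV: "kext G x \<in> KV" by (auto simp: KV_def kext_def emb_outside)

sublocale K: fd_algebra kscale kmul KV
proof unfold_locales
  show "kmul (x + y) z = kmul x z + kmul y z" "kmul x (y + z) = kmul x y + kmul x z"
    "kmul (kscale c x) y = kscale c (kmul x y)" "kmul x (kscale c y) = kscale c (kmul x y)" for x y z c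
    by (rule kmul_linear)+
  show "kmul (kmul x y) z = kmul x (kmul y z)" for x y z by (rule kmul_assoc)
  show "K.subspace KV" by (auto simp: K.subspace_def KV_def kscale_def)
  show "\<exists>B. finite B \<and> KV \<subseteq> K.span B" using finite_Basis KV_span by blast
  show "kmul x y \<in> KV" for x y by (auto simp: KV_def kmul_def emb_outside)
qed

lemma kext_linear: "kext G (kscale c x + y) = kscale c (kext G x) + kext G y"
  by (rule ext) (simp add: kext_def kscale_def algebra_simps sum.distrib sum_distrib_left)

lemma kext_deriv:
  assumes D: "derivation scaleA D" shows "K.is_deriv (kext D)"
proof -
  have add: "D (x + y) = D x + D y" and scale: "D (scaleA c x) = scaleA c (D x)" and mult: "D (x * y) = D x * y + x * D y" for x y c
    using D by (auto simp: derivation_def Vector_Spaces.linear_iff)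
  have kadd: "kext D (x + y) = kext D x + kext D y" for x y using kext_linear[of D 1 x y] by (simp add: kscale_def)
  have kscl: "kext D (kscale c x) = kscale c (kext D x)" for c x
    by (rule ext) (simp add: kext_def kscale_def sum_distrib_left mult.assoc)
  have expand: "kext D x = (\<Sum>i\<in>Basis. kscale (x i) (emb (D i)))" for x
    by (rule ext) (simp add: sum_app kext_def kscale_def)
  have "kext D (kmul x y) = kmul (kext D x) y + kmul x (kext D y)" for x y
  proof
    fix k
    have "kext D (kmul x y) = (\<Sum>i\<in>Basis. \<Sum>j\<in>Basis. kscale (x i * y j) (emb (D (i * j))))"
      unfolding kmul_expand[of x y]
      by (simp only: additive_sum[of "kext D", OF kadd] kscl kext_emb[of D, OF add scale])
    then have "kext D (kmul x y) k = (\<Sum>i\<in>Basis. \<Sum>j\<in>Basis. x i * (y j * emb (D i * j) k))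
        + (\<Sum>i\<in>Basis. \<Sum>j\<in>Basis. x i * (y j * emb (i * D j) k))"
      by (simp add: sum_app kscale_def mult emb_add distrib_left sum.distrib mult.assoc)
    also have "(\<Sum>i\<in>Basis. \<Sum>j\<in>Basis. x i * (y j * emb (D i * j) k)) = kmul (kext D x) y k"
    proof -
      have "kmul (kext D x) y = (\<Sum>i\<in>Basis. kscale (x i) (kmul (emb (D i)) y))"
        unfolding expand[of x] by (subst additive_sum[of "\<lambda>u. kmul u y"]) (simp_all only: kmul_linear)
      then show ?thesis by (simp add: sum_app kscale_def kmul_emb_left sum_distrib_left)
    qed
    also have "(\<Sum>i\<in>Basis. \<Sum>j\<in>Basis. x i * (y j * emb (i * D j) k)) = kmul x (kext D y) k"
    proof -
      have "kmul x (kext D y) = (\<Sum>j\<in>Basis. kscale (y j) (kmul x (emb (D j))))"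
        unfolding expand[of y] by (subst additive_sum[of "kmul x"]) (simp_all only: kmul_linear)
      then have "kmul x (kext D y) k = (\<Sum>j\<in>Basis. \<Sum>i\<in>Basis. x i * (y j * emb (i * D j) k))"
        by (simp add: sum_app kscale_def kmul_emb_right sum_distrib_left mult.left_commute)
      then show ?thesis by (subst sum.swap) simp
    qed
    finally show "kext D (kmul x y) k = (kmul (kext D x) y + kmul x (kext D y)) k" by simp
  qed
  then show ?thesis using kadd kscl by (simp add: K.is_deriv_def)
qed

end

section \<open>Codimensions\<close>

locale differential_action = fd_action scaleA scaleG bracket act Basis
  for scaleA :: "'f::field_char_0 \<Rightarrow> 'a::ring \<Rightarrow> 'a"
    and scaleG :: "'f \<Rightarrow> 'g::ab_group_add \<Rightarrow> 'g"
    and bracket :: "'g \<Rightarrow> 'g \<Rightarrow> 'g" and act :: "'g \<Rightarrow> 'a \<Rightarrow> 'a" and Basis +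
  fixes \<Lambda> :: "'b set" and \<gamma> :: "'b \<Rightarrow> ('g, 'f) free_algebra set"
  assumes basis: "enveloping_basis scaleG bracket \<Lambda> \<gamma>"
begin

section \<open>Evaluation of differential polynomials\<close>

definition ev :: "('b \<times> nat, 'f) free_algebra \<Rightarrow> (nat \<Rightarrow> 'a) \<Rightarrow> 'a" where
  "ev p = (\<lambda>\<psi>. poly_eval scaleA act \<gamma> \<psi> p)"

definition fscale :: "'f \<Rightarrow> ((nat \<Rightarrow> 'a) \<Rightarrow> 'a) \<Rightarrow> (nat \<Rightarrow> 'a) \<Rightarrow> 'a" where
  "fscale c f = (\<lambda>\<psi>. scaleA c (f \<psi>))"

sublocale FF: vector_space fscale
  by unfold_locales (auto simp: fscale_def A.scale_right_distrib A.scale_left_distrib)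

lemma ev_add: "ev (p + q) = ev p + ev q"
  by (rule ext) (simp add: ev_def poly_eval_add)

lemma ev_scale: "ev (free_scale c p) = fscale c (ev p)"
proof
  fix \<psi>
  have "Poly_Mapping.keys (free_scale c p) \<subseteq> Poly_Mapping.keys p" by (auto simp: in_keys_iff)
  then show "ev (free_scale c p) \<psi> = fscale c (ev p) \<psi>" unfolding ev_def fscale_def
    by (subst poly_eval_superset[of "Poly_Mapping.keys p"]) (auto simp: poly_eval_def A.scale_sum_right)
qed

text \<open>Evaluation is multiplicative only in the absence of constant terms:
  \<open>list_product []\<close> is 0, where a unit would be required.\<close>

definition noconst :: "('b \<times> nat, 'f) free_algebra \<Rightarrow> bool" where
  "noconst p \<longleftrightarrow> (\<forall>w\<in>Poly_Mapping.keys p. letters w \<noteq> [])"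

lemma poly_eval_mult:
  assumes "noconst p" "noconst q"
  shows "poly_eval scaleA act \<gamma> \<psi> (p * q) = poly_eval scaleA act \<gamma> \<psi> p * poly_eval scaleA act \<gamma> \<psi> q"
proof -
  let ?l = "Poly_Mapping.lookup" and ?k = "Poly_Mapping.keys"
  let ?val = "\<lambda>w. map (\<lambda>(\<beta>, i). enveloping_act scaleA act (\<gamma> \<beta>) (\<psi> i)) (letters w)"
  have single: "poly_eval scaleA act \<gamma> \<psi> (Poly_Mapping.single w c) = scaleA c (list_product (?val w))" for w c
    by (cases "c = 0") (auto simp: poly_eval_def)
  have "p * q = (\<Sum>u\<in>?k p. Poly_Mapping.single u (?l p u)) * (\<Sum>v\<in>?k q. Poly_Mapping.single v (?l q v))"
    by (simp only: sum_single_lookup)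
  also have "\<dots> = (\<Sum>u\<in>?k p. \<Sum>v\<in>?k q. Poly_Mapping.single (u + v) (?l p u * ?l q v))"
    by (simp only: sum_product mult_single)
  finally have "poly_eval scaleA act \<gamma> \<psi> (p * q) =
    (\<Sum>u\<in>?k p. \<Sum>v\<in>?k q. scaleA (?l p u * ?l q v) (list_product (?val (u + v))))"
    by (simp only: poly_eval_sum single)
  also have "\<dots> = (\<Sum>u\<in>?k p. \<Sum>v\<in>?k q. scaleA (?l p u) (list_product (?val u)) * scaleA (?l q v) (list_product (?val v)))"
  proof (intro sum.cong refl)
    fix u v assume "u \<in> ?k p" "v \<in> ?k q"
    then have ne: "?val u \<noteq> []" "?val v \<noteq> []" using assms by (auto simp: noconst_def)
    have "?val (u + v) = ?val u @ ?val v" by (simp add: plus_word_def)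
    then have "list_product (?val (u + v)) = list_product (?val u) * list_product (?val v)"
      using list_product_append[OF ne] by (simp only:)
    then show "scaleA (?l p u * ?l q v) (list_product (?val (u + v))) =
      scaleA (?l p u) (list_product (?val u)) * scaleA (?l q v) (list_product (?val v))"
      by (simp add: A.scale_mult_left[symmetric] A.scale_mult_right[symmetric])
  qed
  finally show ?thesis by (simp only: poly_eval_def sum_product)
qed

lemma noconst_mult: assumes "noconst p" "noconst q" shows "noconst (p * q)"
  unfolding noconst_def
proof
  fix w assume "w \<in> Poly_Mapping.keys (p * q)"
  then obtain u v where "w = u + v" "u \<in> Poly_Mapping.keys p" using keys_mult[of p q] by blast
  then show "letters w \<noteq> []" using assms(1) by (auto simp: plus_word_def noconst_def)
qed

lemma poly_eval_prod_list:
  assumes "ps \<noteq> []" "\<And>p. p \<in> set ps \<Longrightarrow> noconst p"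
  shows "noconst (prod_list ps) \<and> poly_eval scaleA act \<gamma> \<psi> (prod_list ps) = list_product (map (poly_eval scaleA act \<gamma> \<psi>) ps)"
  using assms
proof (induction ps)
  case (Cons p ps)
  then show ?case
    by (cases "ps = []") (auto simp: list_product_single list_product_Cons poly_eval_mult noconst_mult)
qed simp

lemma var_power_keys:
  assumes "w \<in> Poly_Mapping.keys (var_power U \<Lambda> \<gamma> i h)" shows "\<exists>\<beta>\<in>\<Lambda>. w = Word [(\<beta>, i)]"
proof -
  let ?c = "coefficients U (\<gamma> ` \<Lambda>) h"
  have "w \<in> (\<Union>\<beta>\<in>{\<beta>. \<beta> \<in> \<Lambda> \<and> ?c (\<gamma> \<beta>) \<noteq> 0}. Poly_Mapping.keys (free_scale (?c (\<gamma> \<beta>)) (generator (\<beta>, i))))"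
    using subsetD[OF Poly_Mapping.keys_sum] assms unfolding var_power_def .
  then obtain \<beta> where "\<beta> \<in> \<Lambda>" "w \<in> Poly_Mapping.keys (free_scale (?c (\<gamma> \<beta>)) (generator (\<beta>, i)))" by blast
  then show ?thesis by (auto simp: in_keys_iff generator_def lookup_single when_def split: if_splits)
qed

lemma differential_polys_mult:
  assumes "p \<in> differential_polys \<Lambda>" "q \<in> differential_polys \<Lambda>" shows "p * q \<in> differential_polys \<Lambda>"
  unfolding differential_polys_def mem_Collect_eq
proof
  fix w assume "w \<in> Poly_Mapping.keys (p * q)"
  then obtain u v where "w = u + v" "u \<in> Poly_Mapping.keys p" "v \<in> Poly_Mapping.keys q" using keys_mult[of p q] by blast
  then show "letters w \<noteq> [] \<and> set (letters w) \<subseteq> \<Lambda> \<times> {1..}"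
    using assms by (auto simp: plus_word_def differential_polys_def)
qed

lemma subspace_differential_polys:
  "free.subspace (differential_polys \<Lambda> :: ('b \<times> nat, 'f) free_algebra set)"
proof (rule free.subspaceI)
  fix p q :: "('b \<times> nat, 'f) free_algebra" assume "p \<in> differential_polys \<Lambda>" "q \<in> differential_polys \<Lambda>"
  then show "p + q \<in> differential_polys \<Lambda>" using Poly_Mapping.keys_add[of p q] unfolding differential_polys_def by blast
next
  fix c and p :: "('b \<times> nat, 'f) free_algebra" assume "p \<in> differential_polys \<Lambda>"
  moreover have "Poly_Mapping.keys (free_scale c p) \<subseteq> Poly_Mapping.keys p" by (auto simp: in_keys_iff)
  ultimately show "free_scale c p \<in> differential_polys \<Lambda>" unfolding differential_polys_def by blast
qed (auto simp: differential_polys_def)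

abbreviation PP where "PP n \<equiv> multilinear_polys U \<Lambda> \<gamma> n"

lemma PP_differential: assumes "n \<ge> 1" shows "PP n \<subseteq> differential_polys \<Lambda>"
  unfolding multilinear_polys_def
proof (rule free.span_minimal[OF _ subspace_differential_polys], rule subsetI)
  fix x :: "('b \<times> nat, 'f) free_algebra"
  assume "x \<in> {prod_list (map (\<lambda>k. var_power U \<Lambda> \<gamma> (\<sigma> k) (h k)) [1..<Suc n]) | \<sigma> h.
       \<sigma> permutes {1..n} \<and> (\<forall>k\<in>{1..n}. h k \<in> carrier U)}"
  then obtain \<sigma> h where x: "x = prod_list (map (\<lambda>k. var_power U \<Lambda> \<gamma> (\<sigma> k) (h k)) [1..<Suc n])"
    and \<sigma>: "\<sigma> permutes {1..n}" by blast
  have v: "var_power U \<Lambda> \<gamma> (\<sigma> k) (h k) \<in> differential_polys \<Lambda>" if "k \<in> {1..n}" for k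
    using var_power_keys permutes_in_image[OF \<sigma>, of k] that by (fastforce simp: differential_polys_def)
  have plist: "prod_list ps \<in> differential_polys \<Lambda>" if "ps \<noteq> []" "\<And>p. p \<in> set ps \<Longrightarrow> p \<in> differential_polys \<Lambda>"
    for ps :: "('b \<times> nat, 'f) free_algebra list"
    using that
  proof (induction ps)
    case (Cons p ps)
    then show ?case by (cases "ps = []") (auto intro: differential_polys_mult)
  qed simp
  show "x \<in> differential_polys \<Lambda>" unfolding x
    by (rule plist) (use v assms in \<open>auto simp: less_Suc_eq_le simp del: upt_Suc\<close>)
qed

lemma ev_monomial:
  assumes n: "n \<ge> 1" and h: "\<And>k. k \<in> {1..n} \<Longrightarrow> h k \<in> carrier U"
  shows "ev (prod_list (map (\<lambda>k. var_power U \<Lambda> \<gamma> (\<sigma> k) (h k)) [1..<Suc n])) \<psi> =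
    list_product (map (\<lambda>k. enveloping_act scaleA act (h k) (\<psi> (\<sigma> k))) [1..<Suc n])"
proof -
  let ?ps = "map (\<lambda>k. var_power U \<Lambda> \<gamma> (\<sigma> k) (h k)) [1..<Suc n]"
  have "noconst p" if "p \<in> set ?ps" for p using that var_power_keys by (fastforce simp: noconst_def)
  then have "ev (prod_list ?ps) \<psi> = list_product (map (poly_eval scaleA act \<gamma> \<psi>) ?ps)"
    unfolding ev_def using poly_eval_prod_list[of ?ps] n by auto
  also have "map (poly_eval scaleA act \<gamma> \<psi>) ?ps = map (\<lambda>k. enveloping_act scaleA act (h k) (\<psi> (\<sigma> k))) [1..<Suc n]"
    unfolding map_map by (rule map_cong) (use h poly_eval_var_power[OF basis] in \<open>auto simp: less_Suc_eq_le\<close>)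
  finally show ?thesis .
qed

abbreviation WW where "WW n \<equiv> PP n \<inter> differential_identities scaleA act \<Lambda> \<gamma>"

lemma quotient_image: assumes "n \<ge> 1" shows "quotient_image free_scale (PP n) (WW n) fscale ev"
proof -
  have eq: "WW n = {p \<in> PP n. ev p = 0}"
    using PP_differential[OF assms] by (auto simp: differential_identities_def ev_def fun_eq_iff)
  have P: "free.subspace (PP n)" by (simp add: multilinear_polys_def free.subspace_span)
  have ev0: "ev 0 = 0" using ev_add[of 0 0] by simp
  show ?thesis
  proof unfold_locales
    show "free.subspace (PP n)" by (rule P)
    show "free.subspace (WW n)" unfolding eq
      by (rule free.subspaceI) (auto simp: ev_add ev_scale ev0 free.subspace_0[OF P] free.subspace_add[OF P] free.subspace_scale[OF P])
  qed (auto simp: ev_add ev_scale eq)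
qed

lemma differential_codim_eq:
  "differential_codim scaleA scaleG bracket act \<Lambda> \<gamma> n = vectorspace.dim class_ring (quotient_space free_scale (PP n) (WW n))"
  by (simp add: differential_codim_def Let_def)

section \<open>Lifting functions to the extended algebra\<close>

definition kact :: "('g, 'f) free_algebra \<Rightarrow> ('a \<Rightarrow> 'f alg_closure) \<Rightarrow> 'a \<Rightarrow> 'f alg_closure" where
  "kact p x = (\<Sum>w\<in>Poly_Mapping.keys p. kscale (to_ac (Poly_Mapping.lookup p w)) (foldr (\<lambda>g. kext (act g)) (letters w) x))"

lemma kact_emb: "emb (free_act scaleA act p a) = kact p (emb a)"
proof -
  have w: "emb (foldr act ws a) = foldr (\<lambda>g. kext (act g)) ws (emb a)" for ws
  proof (induction ws)
    case (Cons g ws)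
    have "emb (act g (foldr act ws a)) = kext (act g) (emb (foldr act ws a))"
      by (rule kext_emb[symmetric]) (rule act_plus act_scaleA)+
    then show ?case using Cons by simp
  qed simp
  show ?thesis
    by (rule ext) (simp add: free_act_def kact_def emb_sum emb_scale sum_app w kscale_def)
qed

lemma kact_linear: "kact p (kscale c x + y) = kscale c (kact p x) + kact p y"
proof -
  have w: "foldr (\<lambda>g. kext (act g)) ws (kscale c x + y) =
      kscale c (foldr (\<lambda>g. kext (act g)) ws x) + foldr (\<lambda>g. kext (act g)) ws y" for ws
    by (induction ws) (simp_all only: foldr.simps id_apply o_apply kext_linear)
  show ?thesis unfolding kact_def w
    by (rule ext) (simp add: sum_app kscale_def distrib_left sum.distrib sum_distrib_left mult.left_commute)
qed

lemma kact_closed: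
  assumes "K.subspace S" "\<And>g x. x \<in> S \<Longrightarrow> kext (act g) x \<in> S" "x \<in> S" shows "kact p x \<in> S"
proof -
  have "foldr (\<lambda>g. kext (act g)) ws x \<in> S" for ws using assms(2,3) by (induction ws) auto
  then show ?thesis unfolding kact_def by (intro K.subspace_sum K.subspace_scale assms(1))
qed

lemma emb_list_product: "xs \<noteq> [] \<Longrightarrow> emb (list_product xs) = K.prodl (map emb xs)"
proof (induction xs)
  case (Cons x xs)
  then show ?case by (cases "xs = []") (auto simp: list_product_single list_product_Cons K.prodl_Cons emb_mult)
qed simp

text \<open>The extension g lives over the algebraically closed field, where labelings can be
  counted; f is recovered from it because \<open>emb\<close> is injective.\<close>

definition lifts :: "nat \<Rightarrow> ((nat \<Rightarrow> 'a) \<Rightarrow> 'a) \<Rightarrow> ((nat \<Rightarrow> 'a \<Rightarrow> 'f alg_closure) \<Rightarrow> 'a \<Rightarrow> 'f alg_closure) \<Rightarrow> bool" where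
  "lifts n f g \<longleftrightarrow> g \<in> K.adm_functions n \<and> (\<forall>\<psi>. g (\<lambda>i. emb (\<psi> i)) = emb (f \<psi>))"

lemma monomial_lifts:
  assumes n: "n \<ge> 1" and \<sigma>: "\<sigma> permutes {1..n}"
  shows "\<exists>g. lifts n (\<lambda>\<psi>. list_product (map (\<lambda>k. free_act scaleA act (q k) (\<psi> (\<sigma> k))) [1..<Suc n])) g"
proof -
  let ?L = "map \<sigma> [1..<Suc n]"
  \<comment> \<open>The operator \<open>q k\<close> belongs to the position k of a factor;
    \<open>?q\<close> attaches it to the variable i = \<sigma> k.\<close>
  let ?q = "\<lambda>i. q (Hilbert_Choice.inv \<sigma> i)"
  let ?g = "\<lambda>\<psi>. K.prodl (map (\<lambda>i. kact (?q i) (\<psi> i)) ?L)"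
  have s: "set [1..<Suc n] = {1..n}" by auto
  have L: "distinct ?L" "set ?L = {1..n}"
    using permutes_inj_on[OF \<sigma>] permutes_image[OF \<sigma>] unfolding set_map s by (auto simp: distinct_map s simp del: upt_Suc)
  have "?g \<in> K.adm_functions n"
  proof (rule K.adm_functions_monomial[OF n L])
    show "kact (?q i) (kscale c x + y) = kscale c (kact (?q i) x) + kact (?q i) y" for i c x y by (rule kact_linear)
    show "kact (?q i) x \<in> KV" if "x \<in> KV" for i x by (rule kact_closed[OF K.subspace_V kext_KV that])
    show "kact (?q i) x \<in> K.J" if "x \<in> K.J" for i x
      by (rule kact_closed[OF K.J_ideal(1) K.J_deriv[OF kext_deriv[OF act_derivation]] that])
    show "kact (?q i) x \<in> K.block_ideal e" if "e \<in> K.Es" "x \<in> K.block_ideal e" for i x e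
      by (rule kact_closed[OF K.subspace_block_ideal K.block_ideal_deriv[OF kext_deriv[OF act_derivation] K.idem_Es[OF that(1)]] that(2)])
  qed
  moreover have "?g (\<lambda>i. emb (\<psi> i)) = emb (list_product (map (\<lambda>k. free_act scaleA act (q k) (\<psi> (\<sigma> k))) [1..<Suc n]))" for \<psi>
    using n by (subst emb_list_product) (auto simp: kact_emb permutes_inverses[OF \<sigma>] o_def simp del: upt_Suc)
  ultimately show ?thesis unfolding lifts_def by blast
qed

lemma lifts_combination:
  assumes "lifts n f g" "lifts n f' g'" shows "\<exists>h. lifts n (fscale c f + f') h"
proof -
  let ?h = "\<lambda>\<psi>. \<Sum>i\<in>{0::nat, 1}. kscale (if i = 0 then to_ac c else 1) ((if i = 0 then g else g') \<psi>)"
  have "?h \<in> K.adm_functions n" by (rule K.adm_functions_sum) (use assms in \<open>auto simp: lifts_def\<close>)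
  moreover have "?h (\<lambda>i. emb (\<psi> i)) = emb ((fscale c f + f') \<psi>)" for \<psi>
    using assms by (auto simp: lifts_def fscale_def emb_add fun_eq_iff emb_scale kscale_def)
  ultimately show ?thesis unfolding lifts_def by blast
qed

lemma ev_lifts: assumes n: "n \<ge> 1" and p: "p \<in> PP n" shows "\<exists>g. lifts n (ev p) g"
  using p unfolding multilinear_polys_def
proof (induction rule: free.span_induct_alt)
  case base
  have "ev 0 = 0" using ev_add[of 0 0] by simp
  moreover have "(\<lambda>\<psi>. 0) \<in> K.adm_functions n" using K.adm_functions_sum[of "{}" "\<lambda>_. undefined" n] by simp
  ultimately show ?case unfolding lifts_def by (intro exI[of _ "\<lambda>\<psi>. 0"]) (auto simp: emb_zero)
next
  case (step c x y)
  then obtain \<sigma> h where x: "x = prod_list (map (\<lambda>k. var_power U \<Lambda> \<gamma> (\<sigma> k) (h k)) [1..<Suc n])"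
    and \<sigma>: "\<sigma> permutes {1..n}" and h: "\<And>k. k \<in> {1..n} \<Longrightarrow> h k \<in> carrier U" by blast
  have "\<exists>q. h k = coset J q" if "k \<in> {1..n}" for k
    using h[OF that] by (auto simp: enveloping_algebra_def Let_def quotient_space_def)
  then obtain q where q: "\<And>k. k \<in> {1..n} \<Longrightarrow> h k = coset J (q k)" by metis
  have "ev x = (\<lambda>\<psi>. list_product (map (\<lambda>k. free_act scaleA act (q k) (\<psi> (\<sigma> k))) [1..<Suc n]))"
    unfolding x by (rule ext, subst ev_monomial[OF n h])
      (auto intro!: arg_cong[of _ _ list_product] simp: q enveloping_act_coset less_Suc_eq_le simp del: upt_Suc)
  then obtain g where g: "lifts n (ev x) g" using monomial_lifts[OF n \<sigma>, of q] by auto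
  from step(2) obtain g' where "lifts n (ev y) g'" by blast
  from lifts_combination[OF g this, of c] show ?case by (simp only: ev_add ev_scale)
qed

text \<open>The lifted functions satisfy a relation over the closure. A functional with value 1 at
  one nonzero coefficient turns it into a relation over the ground field, since the values
  \<open>f \<psi>\<close> have their coordinates there.\<close>

lemma ev_dependent:
  assumes n: "n \<ge> 1" and G: "finite G" "G \<subseteq> ev ` PP n" "card (K.adm_labelings n) * K.dim KV < card G"
  shows "FF.dependent G"
proof -
  have "\<exists>g. lifts n f g" if "f \<in> G" for f using that G(2) ev_lifts[OF n] by auto
  then obtain g where g: "\<And>f. f \<in> G \<Longrightarrow> lifts n f (g f)" by metis
  obtain c f0 where c: "f0 \<in> G" "c f0 \<noteq> 0" and 0: "\<And>\<psi>. (\<forall>i\<in>{1..n}. \<psi> i \<in> KV) \<Longrightarrow> (\<Sum>f\<in>G. kscale (c f) (g f \<psi>)) = 0"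
    using K.adm_functions_dependent[OF G(1) _ G(3), of g] g unfolding lifts_def by blast
  obtain \<phi> :: "'f alg_closure \<Rightarrow> 'f" where \<phi>: "\<And>x y. \<phi> (x + y) = \<phi> x + \<phi> y" "\<And>a x. \<phi> (to_ac a * x) = a * \<phi> x" "\<phi> (c f0) = 1"
    by (rule functional_extension[of to_ac "c f0", OF to_ac_add to_ac_mult to_ac_1 c(2)]) (rule that)
  have "(\<Sum>f\<in>G. scaleA (\<phi> (c f)) (f \<psi>)) = 0" for \<psi>
  proof -
    have "(\<Sum>f\<in>G. kscale (c f) (emb (f \<psi>))) = 0"
      using 0[of "\<lambda>i. emb (\<psi> i)"] g by (simp add: emb_KV lifts_def)
    then have s: "(\<Sum>f\<in>G. c f * emb (f \<psi>) b) = 0" for b using sum_app[of "\<lambda>f. kscale (c f) (emb (f \<psi>))" G b]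
      by (simp add: kscale_def)
    have "emb (\<Sum>f\<in>G. scaleA (\<phi> (c f)) (f \<psi>)) = 0"
    proof
      fix b
      have "(\<Sum>f\<in>G. \<phi> (c f) * A.representation Basis (f \<psi>) b) = \<phi> (\<Sum>f\<in>G. c f * emb (f \<psi>) b)"
        unfolding additive_sum[of \<phi>, OF \<phi>(1)]
        by (rule sum.cong) (use \<phi>(2) in \<open>simp_all add: emb_def mult.commute\<close>)
      also have "\<dots> = 0" unfolding s using \<phi>(1)[of 0 0] by simp
      finally have 0: "(\<Sum>f\<in>G. \<phi> (c f) * A.representation Basis (f \<psi>) b) = 0" .
      have "emb (\<Sum>f\<in>G. scaleA (\<phi> (c f)) (f \<psi>)) b = (\<Sum>f\<in>G. to_ac (\<phi> (c f)) * emb (f \<psi>) b)"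
        by (simp only: emb_sum emb_scale)
      also have "\<dots> = to_ac (\<Sum>f\<in>G. \<phi> (c f) * A.representation Basis (f \<psi>) b)"
        by (simp only: emb_def to_ac_sum to_ac_mult)
      finally show "emb (\<Sum>f\<in>G. scaleA (\<phi> (c f)) (f \<psi>)) b = 0 b" unfolding 0 by simp
    qed
    then show ?thesis by (rule emb_eq_0)
  qed
  then have "(\<Sum>f\<in>G. fscale (\<phi> (c f)) f) = 0"
    by (intro ext) (simp add: additive_sum[of "\<lambda>f. f _"] fscale_def)
  moreover have "\<phi> (c f0) \<noteq> 0" using \<phi>(3) by simp
  ultimately show ?thesis unfolding FF.dependent_finite[OF G(1)] using c(1) by (intro exI[of _ "\<lambda>f. \<phi> (c f)"]) auto
qed

section \<open>Bounds for the codimensions\<close>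

abbreviation codim where "codim n \<equiv> differential_codim scaleA scaleG bracket act \<Lambda> \<gamma> n"

lemma codim_spanning:
  assumes n: "n \<ge> 1"
  shows "codim n \<le> card (K.adm_labelings n) * K.dim KV"
    "\<exists>G. finite G \<and> ev ` PP n \<subseteq> FF.span G \<and> card G \<le> codim n"
proof -
  interpret qi: quotient_image free_scale "PP n" "WW n" fscale ev by (rule quotient_image[OF n])
  obtain G where G: "finite G" "G \<subseteq> ev ` PP n" "ev ` PP n \<subseteq> FF.span G" "card G \<le> card (K.adm_labelings n) * K.dim KV"
    by (rule FF.finite_spanning_subset[of "ev ` PP n" "card (K.adm_labelings n) * K.dim KV"])
      (use ev_dependent[OF n] in auto)
  show "codim n \<le> card (K.adm_labelings n) * K.dim KV"
    unfolding differential_codim_eq using qi.dim_quotient_le[OF G(1-3)] G(4) by simp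
  show "\<exists>G. finite G \<and> ev ` PP n \<subseteq> FF.span G \<and> card G \<le> codim n"
    unfolding differential_codim_eq by (rule qi.dim_quotient_attained[OF G(1-3)]) auto
qed

text \<open>Taking the unit of the enveloping algebra for all exponents makes the ordinary
  multilinear monomials available for the lower bound.\<close>

lemma monomial_in_image:
  assumes n: "n \<ge> 1" and L: "distinct L" "set L = {1..n}"
  shows "(\<lambda>\<psi>. list_product (map \<psi> L)) \<in> ev ` PP n"
proof -
  have len: "length L = n" using L distinct_card[OF L(1)] by simp
  define \<sigma> where "\<sigma> k = (if k \<in> {1..n} then L ! (k - 1) else k)" for k
  have map: "map \<sigma> [1..<Suc n] = L" by (rule nth_equalityI) (auto simp: len \<sigma>_def simp del: upt_Suc)
  have s: "set [1..<Suc n] = {1..n}" by auto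
  have img: "\<sigma> ` {1..n} = {1..n}" using arg_cong[OF map, of set] L(2) unfolding set_map s by simp
  have \<sigma>: "\<sigma> permutes {1..n}"
    by (rule bij_imp_permutes) (use img in \<open>auto simp: bij_betw_def \<sigma>_def[of "_::nat"] intro!: eq_card_imp_inj_on\<close>)
  let ?h = "\<lambda>_::nat. coset J 1"
  have h: "coset J 1 \<in> carrier U" by (auto simp: enveloping_algebra_def Let_def quotient_space_def)
  let ?p = "prod_list (map (\<lambda>k. var_power U \<Lambda> \<gamma> (\<sigma> k) (?h k)) [1..<Suc n])"
  have p: "?p \<in> PP n" unfolding multilinear_polys_def using \<sigma> h
    by (intro free.span_base CollectI exI[of _ \<sigma>] exI[of _ ?h]) simp
  have e: "ev ?p = (\<lambda>\<psi>. list_product (map \<psi> L))"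
  proof
    fix \<psi>
    have "ev ?p \<psi> = list_product (map (\<lambda>k. \<psi> (\<sigma> k)) [1..<Suc n])"
      by (subst ev_monomial[OF n]) (auto simp: h enveloping_act_coset free_act_one simp del: upt_Suc)
    also have "map (\<lambda>k. \<psi> (\<sigma> k)) [1..<Suc n] = map \<psi> L" unfolding map[symmetric] by simp
    finally show "ev ?p \<psi> = list_product (map \<psi> L)" .
  qed
  show ?thesis using imageI[OF p, of ev] unfolding e .
qed

lemma codim_lower:
  assumes n: "n \<ge> 1" and I: "finite I" and f: "\<And>i. i \<in> I \<Longrightarrow> f i \<in> ev ` PP n"
    and indep: "\<And>a. (\<And>\<psi>. (\<Sum>i\<in>I. scaleA (a i) (f i \<psi>)) = 0) \<Longrightarrow> (\<And>i. i \<in> I \<Longrightarrow> a i = 0)"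
  shows "card I \<le> codim n"
proof (rule ccontr)
  obtain G where G: "finite G" "ev ` PP n \<subseteq> FF.span G" "card G \<le> codim n" using codim_spanning(2)[OF n] by auto
  assume "\<not> card I \<le> codim n"
  then have "card G < card I" using G by simp
  moreover have "f ` I \<subseteq> FF.span G" using f G(2) by auto
  ultimately obtain c i where c: "i \<in> I" "c i \<noteq> 0" "(\<Sum>i\<in>I. fscale (c i) (f i)) = 0"
    using FF.dependent_family[OF G(1) I] by metis
  have "(\<Sum>i\<in>I. scaleA (c i) (f i \<psi>)) = 0" for \<psi>
    using arg_cong[OF c(3), of "\<lambda>F. F \<psi>"] by (simp add: additive_sum[of "\<lambda>f. f \<psi>"] fscale_def)
  then show False using indep[of c i] c by auto
qed

text \<open>Covers the numbers of variables below c, which \<open>codim_lower_bound\<close> does not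
  reach.\<close>

lemma codim_pos:
  assumes "\<not> nilpotent_algebra TYPE('a)" "n \<ge> 1" shows "codim n \<ge> 1"
proof -
  obtain xs :: "'a list" where xs: "length xs = n" "list_product xs \<noteq> 0"
    using assms unfolding nilpotent_algebra_def by blast
  have s: "set [1..<Suc n] = {1..n}" by auto
  have "card {()} \<le> codim n"
  proof (rule codim_lower[OF assms(2), of "{()}" "\<lambda>_ \<psi>. list_product (map \<psi> [1..<Suc n])"])
    show "(\<lambda>\<psi>. list_product (map \<psi> [1..<Suc n])) \<in> ev ` PP n"
      by (rule monomial_in_image[OF assms(2) _ s]) simp
    fix a :: "unit \<Rightarrow> 'f" and i
    assume a: "\<And>\<psi>. (\<Sum>i\<in>{()}. scaleA (a i) (list_product (map \<psi> [1..<Suc n]))) = 0"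
    have "map (\<lambda>i. xs ! (i - 1)) [1..<Suc n] = xs" by (rule nth_equalityI) (auto simp: xs simp del: upt_Suc)
    then have "scaleA (a ()) (list_product xs) = 0" using a[of "\<lambda>i. xs ! (i - 1)"] by (simp del: upt_Suc)
    then show "a i = 0" using xs by simp
  qed auto
  then show ?thesis by simp
qed

lemma Es_nonempty: assumes "\<not> nilpotent_algebra TYPE('a)" shows "K.Es \<noteq> {}"
proof
  assume Es: "K.Es = {}"
  have nil_index: "K.nil_index \<ge> 1" by (simp add: K.nil_index_def)
  have "list_product xs = 0" if "length xs = K.nil_index" for xs :: "'a list"
  proof -
    have "xs \<noteq> []" using that nil_index by auto
    then have "emb (list_product xs) = K.prodl (map emb xs)" by (rule emb_list_product)
    also have "\<dots> = 0" using K.nilpotent_if_no_block[OF Es, of "map emb xs"] that by simp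
    finally show ?thesis by (rule emb_eq_0)
  qed
  then show False using assms nil_index unfolding nilpotent_algebra_def by blast
qed

text \<open>A relation among monomials as functions on A extends by multilinearity to the algebra
  over the closure, because the image of A spans it; there \<open>independent_monomials\<close>
  applies.\<close>

lemma codim_lower_bound:
  assumes nn: "\<not> nilpotent_algebra TYPE('a)"
  shows "\<exists>c \<kappa> r. \<kappa> > (0::real) \<and> (\<forall>n. n + c \<ge> 1 \<longrightarrow> real K.expo ^ n \<le> real (codim (n + c)) * (\<kappa> * real (n + 2) ^ r))"
proof -
  obtain c \<kappa> r where \<kappa>: "\<kappa> > (0::real)" and main: "\<And>n. \<exists>(I :: (('a \<Rightarrow> 'f alg_closure) \<Rightarrow> nat list) set) L. finite I \<and>
    (\<forall>w\<in>I. distinct (L w) \<and> set (L w) = {1..n + c}) \<and>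
    real K.expo ^ n \<le> real (card I) * (\<kappa> * real (n + 2) ^ r) \<and>
    (\<forall>a. (\<forall>\<psi>. (\<forall>i\<in>{1..n+c}. \<psi> i \<in> KV) \<longrightarrow> (\<Sum>w\<in>I. kscale (a w) (K.prodl (map \<psi> (L w)))) = 0) \<longrightarrow> (\<forall>w\<in>I. a w = 0))"
    using K.independent_monomials[OF Es_nonempty[OF nn]]
    by (elim exE conjE) (rule that, assumption, erule spec)
  have "real K.expo ^ n \<le> real (codim (n + c)) * (\<kappa> * real (n + 2) ^ r)" if nc: "n + c \<ge> 1" for n
  proof -
    obtain I :: "(('a \<Rightarrow> 'f alg_closure) \<Rightarrow> nat list) set" and L where I: "finite I"
      and L': "\<forall>w\<in>I. distinct (L w) \<and> set (L w) = {1..n + c}"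
      and card: "real K.expo ^ n \<le> real (card I) * (\<kappa> * real (n + 2) ^ r)"
      and indep: "\<forall>a. (\<forall>\<psi>. (\<forall>i\<in>{1..n+c}. \<psi> i \<in> KV) \<longrightarrow> (\<Sum>w\<in>I. kscale (a w) (K.prodl (map \<psi> (L w)))) = 0) \<longrightarrow> (\<forall>w\<in>I. a w = 0)"
      using main[of n] by (elim exE conjE) (rule that)
    have L: "distinct (L w)" "set (L w) = {1..n + c}" if "w \<in> I" for w using L' that by auto
    have "card I \<le> codim (n + c)"
    proof (rule codim_lower[OF nc I])
      show "(\<lambda>\<psi>. list_product (map \<psi> (L w))) \<in> ev ` PP (n + c)" if "w \<in> I" for w
        by (rule monomial_in_image[OF nc L(1)[OF that] L(2)[OF that]])
      fix a :: "_ \<Rightarrow> 'f" and w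
      assume a: "\<And>\<psi>. (\<Sum>w\<in>I. scaleA (a w) (list_product (map \<psi> (L w)))) = 0" and w: "w \<in> I"
      let ?g = "\<lambda>\<psi>. \<Sum>w\<in>I. kscale (to_ac (a w)) (K.prodl (map \<psi> (L w)))"
      have "?g \<psi> = 0" if \<psi>: "\<forall>i\<in>{1..n+c}. \<psi> i \<in> KV" for \<psi>
      proof (rule K.multilinear_vanish[of "n + c" ?g "range emb"])
        show "K.multilinear (n + c) ?g"
          by (rule K.multilinear_sum) (use K.multilinear_monomial[OF L, of _ "\<lambda>i x. x"] in simp)
        show "\<psi> i \<in> K.span (range emb)" if "i \<in> {1..n+c}" for i
          using \<psi> that KV_span K.span_mono[of "emb ` Basis" "range emb"] by blast
        fix \<psi> assume rng: "\<And>i. i \<in> {1..n+c} \<Longrightarrow> \<psi> i \<in> range emb"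
        define \<psi>' where "\<psi>' i = inv_into UNIV emb (\<psi> i)" for i
        have \<psi>': "\<psi> i = emb (\<psi>' i)" if "i \<in> {1..n+c}" for i
          unfolding \<psi>'_def by (rule f_inv_into_f[OF rng[OF that], symmetric])
        have "K.prodl (map \<psi> (L w)) = emb (list_product (map \<psi>' (L w)))" if "w \<in> I" for w
        proof -
          have "L w \<noteq> []" using L(2)[OF that] nc by auto
          then have "emb (list_product (map \<psi>' (L w))) = K.prodl (map emb (map \<psi>' (L w)))"
            by (intro emb_list_product) simp
          also have "map emb (map \<psi>' (L w)) = map \<psi> (L w)" using \<psi>' L(2)[OF that] by auto
          finally show ?thesis by (rule sym)
        qed
        then have "?g \<psi> = (\<Sum>w\<in>I. kscale (to_ac (a w)) (emb (list_product (map \<psi>' (L w)))))" by simp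
        also have "\<dots> = emb (\<Sum>w\<in>I. scaleA (a w) (list_product (map \<psi>' (L w))))"
          by (rule ext) (simp add: sum_app emb_sum emb_scale kscale_def)
        also have "\<dots> = 0" unfolding a by (rule emb_zero)
        finally show "?g \<psi> = 0" .
      qed
      then have "\<forall>w\<in>I. to_ac (a w) = 0" using spec[OF indep, of "\<lambda>w. to_ac (a w)"] by blast
      then show "a w = 0" using w by simp
    qed
    then have "real (card I) * (\<kappa> * real (n + 2) ^ r) \<le> real (codim (n + c)) * (\<kappa> * real (n + 2) ^ r)"
      using \<kappa> by (intro mult_right_mono) auto
    then show ?thesis using card by simp
  qed
  then show ?thesis using \<kappa> by blast
qed

lemma codim_asymptotics:
  assumes nn: "\<not> nilpotent_algebra TYPE('a)"
  shows "\<exists>(d::nat) (C1::real) (C2::real) (r1::real) (r2::real). d \<ge> 1 \<and> C1 > 0 \<and> C2 > 0 \<and>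
    (\<forall>n::nat. n \<ge> 1 \<longrightarrow>
      C1 * real n powr r1 * real d ^ n \<le> real (codim n) \<and> real (codim n) \<le> C2 * real n powr r2 * real d ^ n)"
proof -
  let ?d = "K.expo"
  have d1: "?d \<ge> 1" by (rule K.expo_pos[OF Es_nonempty[OF nn]])
  obtain C where C: "C > 0" "\<And>n. n \<ge> 1 \<Longrightarrow> real (card (K.adm_labelings n)) \<le> C * real n ^ K.nil_index * real ?d ^ n"
    using K.card_adm_labelings[OF Es_nonempty[OF nn]] by auto
  obtain c \<kappa> r where \<kappa>: "\<kappa> > (0::real)"
    and low: "\<And>n. n + c \<ge> 1 \<Longrightarrow> real ?d ^ n \<le> real (codim (n + c)) * (\<kappa> * real (n + 2) ^ r)"
    using codim_lower_bound[OF nn] by blast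
  \<comment> \<open>The power of d pays for the c auxiliary variables, and 3^r for m + 2 \<le> 3 n
    where n = m + c. The maximum with 1 makes M at least d^c, as the case n < c requires.\<close>
  define M where "M = real ?d ^ c * max \<kappa> 1 * 3 ^ r"
  have M: "M > 0" unfolding M_def using d1 by (intro mult_pos_pos) auto
  define C2 where "C2 = C * (real (K.dim KV) + 1)"
  have "C2 > 0" using C by (simp add: C2_def)
  have upper: "real (codim n) \<le> C2 * real n powr real K.nil_index * real ?d ^ n" if n: "n \<ge> 1" for n
  proof -
    have "real (codim n) \<le> real (card (K.adm_labelings n)) * real (K.dim KV)"
      using codim_spanning(1)[OF n] by (simp flip: of_nat_mult)
    also have "\<dots> \<le> (C * real n ^ K.nil_index * real ?d ^ n) * (real (K.dim KV) + 1)"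
      using C n by (intro mult_mono) auto
    finally show ?thesis using n by (simp add: C2_def powr_realpow ac_simps)
  qed
  have lower: "1 / M * real n powr (- real r) * real ?d ^ n \<le> real (codim n)" if n: "n \<ge> 1" for n
  proof -
    have "real ?d ^ n \<le> real (codim n) * (M * real n ^ r)"
    proof (cases "n < c")
      case True
      have "real ?d ^ n \<le> real ?d ^ c" using True d1 by (intro power_increasing) auto
      also have "\<dots> \<le> 1 * (M * real n ^ r)"
      proof -
        have "1 * 1 \<le> max \<kappa> 1 * 3 ^ r" by (intro mult_mono) auto
        also have "\<dots> * 1 \<le> max \<kappa> 1 * 3 ^ r * real n ^ r" using n by (intro mult_left_mono) auto
        finally have "real ?d ^ c * 1 \<le> real ?d ^ c * (max \<kappa> 1 * 3 ^ r * real n ^ r)"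
          by (intro mult_left_mono) auto
        then show ?thesis by (simp add: M_def ac_simps)
      qed
      also have "\<dots> \<le> real (codim n) * (M * real n ^ r)"
        using codim_pos[OF nn n] M by (intro mult_right_mono) auto
      finally show ?thesis .
    next
      case False
      then obtain m where m: "n = m + c" using le_Suc_ex by (metis add.commute not_less)
      have "real ?d ^ n = real ?d ^ c * real ?d ^ m" by (simp add: m power_add mult.commute)
      also have "\<dots> \<le> real ?d ^ c * (real (codim n) * (\<kappa> * real (m + 2) ^ r))"
        using low[of m] n by (intro mult_left_mono) (auto simp: m)
      also have "\<dots> \<le> real ?d ^ c * (real (codim n) * (max \<kappa> 1 * (3 * real n) ^ r))"
        using n \<kappa> by (intro mult_left_mono mult_mono power_mono) (auto simp: m)
      finally show ?thesis by (simp add: M_def power_mult_distrib ac_simps)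
    qed
    then have "real ?d ^ n / (M * real n ^ r) \<le> real (codim n)"
      using M n by (simp add: pos_divide_le_eq)
    then show ?thesis using n by (simp add: powr_minus powr_realpow divide_inverse ac_simps)
  qed
  show ?thesis
    by (rule exI[of _ ?d], rule exI[of _ "1 / M"], rule exI[of _ C2], rule exI[of _ "- real r"], rule exI[of _ "real K.nil_index"])
      (use d1 M \<open>C2 > 0\<close> upper lower in auto)
qed

end

theorem theorem3:
  fixes scaleA :: "'f::field_char_0 \<Rightarrow> 'a::ring \<Rightarrow> 'a"
    and scaleG :: "'f \<Rightarrow> 'g::ab_group_add \<Rightarrow> 'g"
    and bracket :: "'g \<Rightarrow> 'g \<Rightarrow> 'g"
    and act :: "'g \<Rightarrow> 'a \<Rightarrow> 'a"
    and \<Lambda> :: "'b set"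
    and \<gamma> :: "'b \<Rightarrow> ('g, 'f) free_algebra set"
  assumes "derivation_action scaleA scaleG bracket act"
    and "\<exists>Basis. finite_dimensional_vector_space scaleA Basis"
    and "\<not> nilpotent_algebra TYPE('a)"
    and "enveloping_basis scaleG bracket \<Lambda> \<gamma>"
  shows "\<exists>(d::nat) (C1::real) (C2::real) (r1::real) (r2::real). d \<ge> 1 \<and> C1 > 0 \<and> C2 > 0 \<and>
    (\<forall>n::nat. n \<ge> 1 \<longrightarrow>
      C1 * real n powr r1 * real d ^ n
        \<le> real (differential_codim scaleA scaleG bracket act \<Lambda> \<gamma> n) \<and>
      real (differential_codim scaleA scaleG bracket act \<Lambda> \<gamma> n)
        \<le> C2 * real n powr r2 * real d ^ n)"
proof -
  obtain Basis where B: "finite_dimensional_vector_space scaleA Basis" using assms(2) by auto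
  interpret B: finite_dimensional_vector_space scaleA Basis by (rule B)
  interpret derivation_action scaleA scaleG bracket act by (rule assms(1))
  interpret differential_action scaleA scaleG bracket act Basis \<Lambda> \<gamma>
    by unfold_locales (use assms(4) B.finite_Basis B.independent_Basis B.span_Basis in auto)
  show ?thesis by (rule codim_asymptotics[OF assms(3)])
qed

end
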